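(* (B-O systems.) Let $0<\gamma<1$, $\alpha>1$, $T>0$, $\mu>3/2$, and let $g(\xi)=\frac{\alpha}{\gamma}|\xi|$ for $\xi\in\mathbb{R}$. Let $\zeta_0,u_0$ be real-valued smooth $1$-periodic functions, and assume that the $1$-periodic initial-value problem $$\zeta_{t}+\frac{1}{\gamma}(1+g(D))^{-1}\Big(1+\frac{\alpha-1}{\alpha}g(D)\Big)u_{x}=\frac{1}{\gamma}(1+g(D))^{-1}(\zeta u)_{x},$$ $$u_{t}+(1-\gamma)\zeta_{x}=\frac{1}{2\gamma}\partial_{x}(u^{2}),$$ $$\zeta(x,0)=\zeta_{0}(x),\qquad u(x,0)=u_{0}(x),$$ for $0\le x\le 1$, $0\le t\le T$, has a unique real-valued solution $(\zeta,u)$ with $\zeta,u\in C([0,T];H^{\mu})$. For each integer $N\ge1$ let $(\zeta_N,u_N)$ denote the Fourier-Galerkin semidiscretization, i.e. the real-valued solution with $\zeta_N(t),u_N(t)\in S_N$ of $$\zeta_{N,t}+\frac{1}{\gamma}(1+g(D))^{-1}\Big(1+\frac{\alpha-1}{\alpha}g(D)\Big)u_{N,x}=\frac{1}{\gamma}(1+g(D))^{-1}\partial_{x}P_{N}(\zeta_{N}u_{N}),$$ $$u_{N,t}+(1-\gamma)\zeta_{N,x}=\frac{1}{2\gamma}\partial_{x}P_{N}(u_{N}^{2}),$$ $$\zeta_{N}|_{t=0}=P_{N}\zeta_{0},\qquad u_{N}|_{t=0}=P_{N}u_{0}.$$ Then there exist a constant $C$ independent of $N$ and an integer $N_0$ such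 that for all $N\ge N_0$ the solution $(\zeta_N,u_N)$ exists uniquely up to $t=T$ and satisfies $$\max_{0\leq t\leq T}\big(\|\zeta_{N}-\zeta\|+\|u_{N}-u\|\big)\leq C N^{1-\mu}.$$
   Context: All functions of $x$ are $1$-periodic. $\|\cdot\|$ is the norm of $L^2=L^2(0,1)$. For $k\in\mathbb{Z}$, $\widehat v(k)=\int_0^1 v(x)e^{-2\pi i kx}\,dx$ is the $k$th Fourier coefficient. For real $\mu\ge 0$, $H^\mu$ is the $L^2$-based Sobolev space of $1$-periodic functions with norm $\|v\|_\mu=\big(\sum_{k\in\mathbb{Z}}(1+k^2)^\mu|\widehat v(k)|^2\big)^{1/2}$. For an even function $m:\mathbb{R}\to\mathbb{R}$, the operator $m(D)$ is the Fourier multiplier $\widehat{m(D)v}(k)=m(2\pi k)\widehat v(k)$; in particular $(1+g(D))^{-1}$ has symbol $1/(1+g)$. For an integer $N\ge1$, $S_N=\mathrm{span}\{e^{2\pi i kx}: k\in\mathbb{Z},\,-N\le k\le N\}$, and $P_N$ is the $L^2$-projection onto $S_N$, $P_Nv=\sum_{|k|\le N}\widehat v(k)e^{2\pi i kx}$. *)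

theory Defs
  imports "HOL-Analysis.Analysis"
begin

text \<open>
  Functions of $x$ are total functions \<open>real \<Rightarrow> complex\<close>, and functions of $(t,x)$ are curried with
  the time first. Being real-valued is a predicate, so that real-valued functions, their Fourier
  coefficients and the complex space $S_N$ live in one type.
\<close>

definition periodic1 :: "(real \<Rightarrow> complex) \<Rightarrow> bool" where
  "periodic1 v \<longleftrightarrow> (\<forall>x. v (x + 1) = v x)"

definition real_valued :: "(real \<Rightarrow> complex) \<Rightarrow> bool" where
  "real_valued v \<longleftrightarrow> (\<forall>x. v x \<in> \<real>)"

definition smooth :: "(real \<Rightarrow> complex) \<Rightarrow> bool" where
  "smooth v \<longleftrightarrow>
     (\<exists>D :: nat \<Rightarrow> real \<Rightarrow> complex.
        D 0 = v \<and> (\<forall>n x. (D n has_vector_derivative D (Suc n) x) (at x)))"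

definition fourier_mode :: "int \<Rightarrow> real \<Rightarrow> complex" where
  "fourier_mode k x = exp (2 * of_real pi * \<i> * of_int k * of_real x)"

definition fourier_coeff :: "(real \<Rightarrow> complex) \<Rightarrow> int \<Rightarrow> complex" where
  "fourier_coeff v k = (LINT x:{0..1}|lborel. v x * exp (- (2 * of_real pi * \<i> * of_int k * of_real x)))"

definition L2_per :: "(real \<Rightarrow> complex) set" where
  "L2_per = {v. periodic1 v \<and> v \<in> borel_measurable borel
               \<and> set_integrable lborel {0..1} (\<lambda>x. (cmod (v x))\<^sup>2)}"

definition L2_norm :: "(real \<Rightarrow> complex) \<Rightarrow> real" where
  "L2_norm v = sqrt (LINT x:{0..1}|lborel. (cmod (v x))\<^sup>2)"

definition sobolev :: "real \<Rightarrow> (real \<Rightarrow> complex) set" where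
  "sobolev \<mu> = {v \<in> L2_per.
     (\<lambda>k::int. (1 + (real_of_int k)\<^sup>2) powr \<mu> * (cmod (fourier_coeff v k))\<^sup>2) summable_on UNIV}"

definition sobolev_norm :: "real \<Rightarrow> (real \<Rightarrow> complex) \<Rightarrow> real" where
  "sobolev_norm \<mu> v =
     sqrt (\<Sum>\<^sub>\<infinity>k::int. (1 + (real_of_int k)\<^sup>2) powr \<mu> * (cmod (fourier_coeff v k))\<^sup>2)"

text \<open>The space $C([0,T];H^\mu)$; nothing is said about times outside $[0,T]$.\<close>

definition cont_sobolev :: "real \<Rightarrow> real \<Rightarrow> (real \<Rightarrow> real \<Rightarrow> complex) set" where
  "cont_sobolev T \<mu> = {v.
     (\<forall>t\<in>{0..T}. v t \<in> sobolev \<mu>) \<and>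
     (\<forall>t\<in>{0..T}. ((\<lambda>s. sobolev_norm \<mu> (\<lambda>x. v s x - v t x)) \<longlongrightarrow> 0) (at t within {0..T}))}"

text \<open>
  $m(D)v$, given pointwise by its Fourier series. In the equations below, $m$ is bounded and $v$ is
  a trigonometric polynomial or lies in $H^{\mu-1}$ with $\mu - 1 > 1/2$; then the series converges
  absolutely and uniformly, so it is the continuous function with Fourier coefficients
  $m(2\pi k)\,\widehat v(k)$.
\<close>

definition fourier_multiplier :: "(real \<Rightarrow> real) \<Rightarrow> (real \<Rightarrow> complex) \<Rightarrow> real \<Rightarrow> complex" where
  "fourier_multiplier m v x =
     (\<Sum>\<^sub>\<infinity>k::int. of_real (m (2 * pi * real_of_int k)) * fourier_coeff v k * fourier_mode k x)"

definition S_space :: "nat \<Rightarrow> (real \<Rightarrow> complex) set" where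
  "S_space N = {v. \<exists>c :: int \<Rightarrow> complex. v = (\<lambda>x. \<Sum>k = - int N..int N. c k * fourier_mode k x)}"

definition P_proj :: "nat \<Rightarrow> (real \<Rightarrow> complex) \<Rightarrow> real \<Rightarrow> complex" where
  "P_proj N v x = (\<Sum>k = - int N..int N. fourier_coeff v k * fourier_mode k x)"

definition dx :: "(real \<Rightarrow> complex) \<Rightarrow> real \<Rightarrow> complex" where
  "dx v x = vector_derivative v (at x)"

definition has_dt :: "real \<Rightarrow> (real \<Rightarrow> real \<Rightarrow> complex) \<Rightarrow> (real \<Rightarrow> real \<Rightarrow> complex) \<Rightarrow> bool" where
  "has_dt T v v' \<longleftrightarrow>
     (\<forall>t\<in>{0..T}. \<forall>x. ((\<lambda>s. v s x) has_vector_derivative v' t x) (at t within {0..T}))"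

text \<open>
  Solutions in $C([0,T];H^\mu)$ of the initial-value problem, for $\mu > 3/2$. By the embedding
  $H^\mu \subset C^1$ the equations hold classically, with one-sided time derivatives at $0$ and $T$.
  The differentiability clause in $x$ selects the $C^1$ representative of the $L^2$ class.
  The product $(1+g(D))^{-1}\bigl(1+\frac{\alpha-1}{\alpha}g(D)\bigr)$ is a single multiplier of
  order $0$, since its second factor alone may leave $L^2$.
\<close>

definition bo_solution ::
  "real \<Rightarrow> real \<Rightarrow> (real \<Rightarrow> real) \<Rightarrow> real \<Rightarrow> real \<Rightarrow> (real \<Rightarrow> complex) \<Rightarrow> (real \<Rightarrow> complex)
    \<Rightarrow> (real \<Rightarrow> real \<Rightarrow> complex) \<Rightarrow> (real \<Rightarrow> real \<Rightarrow> complex) \<Rightarrow> bool" where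
  "bo_solution \<gamma> \<alpha> g T \<mu> \<zeta>0 u0 \<zeta> u \<longleftrightarrow>
     \<zeta> \<in> cont_sobolev T \<mu> \<and> u \<in> cont_sobolev T \<mu> \<and>
     (\<forall>t\<in>{0..T}. real_valued (\<zeta> t) \<and> real_valued (u t)) \<and>
     (\<forall>t\<in>{0..T}. \<forall>x. \<zeta> t differentiable (at x) \<and> u t differentiable (at x)) \<and>
     \<zeta> 0 = \<zeta>0 \<and> u 0 = u0 \<and>
     (\<exists>\<zeta>t ut. has_dt T \<zeta> \<zeta>t \<and> has_dt T u ut \<and>
       (\<forall>t\<in>{0..T}. \<forall>x.
          \<zeta>t t x + of_real (1 / \<gamma>) *
              fourier_multiplier (\<lambda>\<xi>. 1 / (1 + g \<xi>) * (1 + (\<alpha> - 1) / \<alpha> * g \<xi>)) (dx (u t)) x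
            = of_real (1 / \<gamma>) *
              fourier_multiplier (\<lambda>\<xi>. 1 / (1 + g \<xi>)) (dx (\<lambda>y. \<zeta> t y * u t y)) x \<and>
          ut t x + of_real (1 - \<gamma>) * dx (\<zeta> t) x
            = of_real (1 / (2 * \<gamma>)) * dx (\<lambda>y. (u t y)\<^sup>2) x))"

definition galerkin_solution ::
  "real \<Rightarrow> real \<Rightarrow> (real \<Rightarrow> real) \<Rightarrow> real \<Rightarrow> nat \<Rightarrow> (real \<Rightarrow> complex) \<Rightarrow> (real \<Rightarrow> complex)
    \<Rightarrow> (real \<Rightarrow> real \<Rightarrow> complex) \<Rightarrow> (real \<Rightarrow> real \<Rightarrow> complex) \<Rightarrow> bool" where
  "galerkin_solution \<gamma> \<alpha> g T N \<zeta>0 u0 \<zeta>N uN \<longleftrightarrow>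
     (\<forall>t\<in>{0..T}. \<zeta>N t \<in> S_space N \<and> uN t \<in> S_space N) \<and>
     (\<forall>t\<in>{0..T}. real_valued (\<zeta>N t) \<and> real_valued (uN t)) \<and>
     \<zeta>N 0 = P_proj N \<zeta>0 \<and> uN 0 = P_proj N u0 \<and>
     (\<exists>\<zeta>t ut. has_dt T \<zeta>N \<zeta>t \<and> has_dt T uN ut \<and>
       (\<forall>t\<in>{0..T}. \<forall>x.
          \<zeta>t t x + of_real (1 / \<gamma>) *
              fourier_multiplier (\<lambda>\<xi>. 1 / (1 + g \<xi>) * (1 + (\<alpha> - 1) / \<alpha> * g \<xi>)) (dx (uN t)) x
            = of_real (1 / \<gamma>) *
              fourier_multiplier (\<lambda>\<xi>. 1 / (1 + g \<xi>)) (dx (P_proj N (\<lambda>y. \<zeta>N t y * uN t y))) x \<and>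
          ut t x + of_real (1 - \<gamma>) * dx (\<zeta>N t) x
            = of_real (1 / (2 * \<gamma>)) * dx (P_proj N (\<lambda>y. (uN t y)\<^sup>2)) x))"

end

theory Submission
  imports Defs "HOL-Probability.Discrete_Topology"
begin

text \<open>
  With \<open>\<theta> = P\<^sub>N \<zeta> - \<zeta>\<^sub>N\<close> and \<open>\<xi> = P\<^sub>N u - u\<^sub>N\<close>, consider the energy
  \<open>E = (1 - \<gamma>) \<parallel>\<theta>\<parallel>\<^sup>2 + \<gamma>\<inverse> (M \<xi>, \<xi>)\<close>, where \<open>M\<close> is the multiplier of \<open>u\<^sub>x\<close> in the first
  equation. The linear terms cancel in \<open>E'\<close>. Since \<open>(1 + g(D))\<inverse> \<partial>\<^sub>x\<close> is bounded on \<open>L\<^sup>2\<close> and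
  \<open>M = (\<alpha> - 1)/\<alpha> + \<alpha>\<inverse> (1 + g(D))\<inverse>\<close>, the only nonlinear term which loses a derivative is
  \<open>(\<xi>, \<partial>\<^sub>x (u\<^sup>2 - u\<^sub>N\<^sup>2))\<close>, and integration by parts controls it. As long as
  \<open>\<parallel>\<xi>\<parallel>\<^sub>\<infinity> \<le> 1\<close> this gives \<open>E' \<le> K (E + N\<^bsup>2 - 2\<mu>\<^esup>)\<close>, hence \<open>E \<le> C N\<^bsup>2 - 2\<mu>\<^esup>\<close>. By the inverse
  inequality \<open>\<parallel>\<xi>\<parallel>\<^sub>\<infinity>\<^sup>2 \<le> (2 N + 1) \<parallel>\<xi>\<parallel>\<^sup>2\<close> and \<open>\<mu> > 3/2\<close> the proviso is never violated for large
  \<open>N\<close>. Existence on \<open>[0, T]\<close> and uniqueness come from a system with truncated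
  coefficients, which is globally Lipschitz and agrees with the Galerkin system as long as \<open>E\<close> is
  small.
\<close>

section \<open>Fourier modes and trigonometric polynomials\<close>

text \<open>The weights of the energy come from the linear part. Mode by mode it couples \<theta> to
  \<xi> with factor m/\<gamma> and \<xi> to \<theta> with factor 1-\<gamma>, both times an imaginary
  number; weighting |\<theta>|^2 by 1-\<gamma> and |\<xi>|^2 by m/\<gamma> makes the two couplings
  equal in size, and their real parts cancel. The form is coercive because \<gamma> < 1 and m \<ge>
  (\<alpha>-1)/\<alpha> > 0. The first flux is smoothed, so \<theta> is needed in L^2 only and a sup
  bound for \<xi> alone. The exponent is 1-\<mu> instead of -\<mu> because the second flux is
  differentiated, so that the L^2 tail of u_x enters. The Galerkin system is quadratic, hence only
  locally Lipschitz. Clipping its coefficients replaces a continuation argument, and the energy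
  estimate asks for the Galerkin equations only while the energy is below a threshold. It thus
  applies to the clipped solution, where clipping is then never active, and to an arbitrary Galerkin
  solution, which therefore solves the clipped system and coincides with the first.\<close>

definition trig :: "nat \<Rightarrow> (int \<Rightarrow> complex) \<Rightarrow> real \<Rightarrow> complex" where
  "trig N c x = (\<Sum>k = - int N..int N. c k * fourier_mode k x)"

definition fdiff :: "(int \<Rightarrow> complex) \<Rightarrow> int \<Rightarrow> complex" where
  "fdiff c k = 2 * of_real pi * \<i> * of_int k * c k"

text \<open>A gauge integral instead of the Lebesgue integral of \<open>L2_norm\<close>, because the
  fundamental theorem of calculus and the linearity rules for \<open>integral\<close> are used
  throughout; on continuous functions the two agree by \<open>L2_norm_eq\<close>.\<close>

definition l2sq :: "(real \<Rightarrow> complex) \<Rightarrow> real" where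
  "l2sq f = integral {0..1} (\<lambda>x. (cmod (f x))\<^sup>2)"

lemma norm_fourier_mode [simp]: "cmod (fourier_mode k x) = 1"
  by (simp add: fourier_mode_def norm_exp_eq_Re)

lemma fourier_mode_0 [simp]: "fourier_mode 0 x = 1" "fourier_mode k 0 = 1"
  by (simp_all add: fourier_mode_def)

lemma fourier_mode_add: "fourier_mode (k + l) x = fourier_mode k x * fourier_mode l x"
  by (simp add: fourier_mode_def exp_add [symmetric] ring_distribs)

lemma fourier_mode_add_arg: "fourier_mode k (x + y) = fourier_mode k x * fourier_mode k y"
  by (simp add: fourier_mode_def exp_add [symmetric] ring_distribs)

lemma fourier_mode_minus: "fourier_mode (- k) x = cnj (fourier_mode k x)"
  by (simp add: fourier_mode_def exp_cnj)

lemma fourier_mode_1 [simp]: "fourier_mode k 1 = 1"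
  using exp_integer_2pi[of "of_int k"] by (simp add: fourier_mode_def mult_ac)

lemma periodic1_fourier_mode: "periodic1 (fourier_mode k)"
  by (simp add: periodic1_def fourier_mode_add_arg)

lemma has_vector_derivative_fourier_mode:
  "(fourier_mode k has_vector_derivative 2 * of_real pi * \<i> * of_int k * fourier_mode k x) (at x within S)"
  unfolding fourier_mode_def
  by (auto intro!: derivative_eq_intros has_vector_derivative_real_field simp: mult_ac)

lemma continuous_on_fourier_mode [continuous_intros]: "continuous_on S (fourier_mode k)"
  unfolding fourier_mode_def by (intro continuous_intros)

lemma integral_fourier_mode: "integral {0..1} (fourier_mode k) = (if k = 0 then 1 else 0)"
proof (cases "k = 0")
  case True
  have "fourier_mode 0 = (\<lambda>_. 1)" by auto
  then show ?thesis using True by simp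
next
  case False
  let ?c = "2 * of_real pi * \<i> * of_int k :: complex"
  have "((\<lambda>x. fourier_mode k x) has_integral (fourier_mode k 1 / ?c - fourier_mode k 0 / ?c)) {0..1}"
  proof (rule fundamental_theorem_of_calculus)
    fix x :: real
    have "((\<lambda>x. fourier_mode k x / ?c) has_vector_derivative (?c * fourier_mode k x) / ?c) (at x within {0..1})"
      by (intro has_vector_derivative_divide has_vector_derivative_fourier_mode)
    then show "((\<lambda>x. fourier_mode k x / ?c) has_vector_derivative fourier_mode k x) (at x within {0..1})"
      using False by simp
  qed simp
  then show ?thesis using False by (simp add: integral_unique)
qed

lemma fourier_coeff_eq:
  assumes "continuous_on {0..1} v"
  shows "fourier_coeff v k = integral {0..1} (\<lambda>x. cnj (fourier_mode k x) * v x)"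
proof -
  have "continuous_on {0..1} (\<lambda>x. cnj (fourier_mode k x) * v x)"
    by (intro continuous_intros assms)
  then have "set_integrable lborel {0..1} (\<lambda>x. cnj (fourier_mode k x) * v x)"
    by (rule borel_integrable_atLeastAtMost')
  then show ?thesis
    by (simp add: fourier_coeff_def set_borel_integral_eq_integral(2) [symmetric] fourier_mode_def
        exp_cnj mult.commute)
qed

lemma L2_norm_eq:
  assumes "continuous_on {0..1} v"
  shows "L2_norm v = sqrt (l2sq v)"
proof -
  have "continuous_on {0..1} (\<lambda>x. (cmod (v x))\<^sup>2)"
    by (intro continuous_intros assms)
  then have "set_integrable lborel {0..1} (\<lambda>x. (cmod (v x))\<^sup>2)"
    by (rule borel_integrable_atLeastAtMost')
  then show ?thesis
    by (simp add: L2_norm_def l2sq_def set_borel_integral_eq_integral(2))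
qed

section \<open>Elementary rules for squared norms and Fourier coefficients\<close>

lemma l2sq_nonneg: "0 \<le> l2sq f"
  unfolding l2sq_def by (cases "(\<lambda>x. (cmod (f x))\<^sup>2) integrable_on {0..1}")
    (auto intro: integral_nonneg simp: not_integrable_integral)

lemma l2sq_mono:
  assumes "continuous_on {0..1} f" "continuous_on {0..1} g"
    "\<And>x. x \<in> {0..1} \<Longrightarrow> cmod (f x) \<le> M * cmod (g x)"
  shows "l2sq f \<le> M\<^sup>2 * l2sq g"
proof -
  have "integral {0..1} (\<lambda>x. (cmod (f x))\<^sup>2) \<le> integral {0..1} (\<lambda>x. M\<^sup>2 * (cmod (g x))\<^sup>2)"
    using assms(3)
    by (intro integral_le integrable_continuous_real continuous_intros assms(1,2))
      (simp add: power_mono flip: power_mult_distrib)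
  then show ?thesis by (simp add: l2sq_def)
qed

lemma cmod_add_square_le: "(cmod (a + b))\<^sup>2 \<le> 2 * (cmod a)\<^sup>2 + 2 * (cmod b)\<^sup>2"
proof -
  have "(cmod (a + b))\<^sup>2 + (cmod (a - b))\<^sup>2 = 2 * (cmod a)\<^sup>2 + 2 * (cmod b)\<^sup>2"
    unfolding cmod_power2 by (simp add: power2_eq_square algebra_simps)
  then show ?thesis by (smt (verit) zero_le_power2)
qed

lemma l2sq_add_le:
  assumes "continuous_on {0..1} f" "continuous_on {0..1} g"
  shows "l2sq (\<lambda>x. f x + g x) \<le> 2 * l2sq f + 2 * l2sq g"
proof -
  have "integral {0..1} (\<lambda>x. (cmod (f x + g x))\<^sup>2) \<le> integral {0..1} (\<lambda>x. 2 * (cmod (f x))\<^sup>2 + 2 * (cmod (g x))\<^sup>2)"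
    by (intro integral_le integrable_continuous_real continuous_intros assms cmod_add_square_le)
  also have "\<dots> = 2 * l2sq f + 2 * l2sq g"
    by (subst integral_add) (auto intro!: integrable_continuous_real continuous_intros assms simp: l2sq_def)
  finally show ?thesis by (simp add: l2sq_def)
qed

lemma l2sq_le_const:
  assumes "continuous_on {0..1} f" "\<And>x. x \<in> {0..1} \<Longrightarrow> cmod (f x) \<le> M"
  shows "l2sq f \<le> M\<^sup>2"
  using l2sq_mono[of f "\<lambda>_. 1" M] assms by (simp add: l2sq_def)

lemma fourier_coeff_add:
  assumes "continuous_on {0..1} f" "continuous_on {0..1} g"
  shows "fourier_coeff (\<lambda>x. f x + g x) k = fourier_coeff f k + fourier_coeff g k"
  by (simp add: fourier_coeff_eq assms continuous_intros ring_distribs)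
     (intro integral_add integrable_continuous_real continuous_intros assms)

lemma fourier_coeff_diff:
  assumes "continuous_on {0..1} f" "continuous_on {0..1} g"
  shows "fourier_coeff (\<lambda>x. f x - g x) k = fourier_coeff f k - fourier_coeff g k"
  by (simp add: fourier_coeff_eq assms continuous_intros ring_distribs)
     (intro integral_diff integrable_continuous_real continuous_intros assms)

lemma fourier_coeff_cmult: "fourier_coeff (\<lambda>x. c * f x) k = c * fourier_coeff f k"
  by (simp add: fourier_coeff_def mult.assoc)

lemma fourier_coeff_cnj:
  assumes "continuous_on {0..1} f"
  shows "fourier_coeff (\<lambda>x. cnj (f x)) (- k) = cnj (fourier_coeff f k)"
  by (simp add: fourier_coeff_eq assms continuous_intros integral_cnj fourier_mode_minus)

lemma trig_eq_fourier_sum: "trig N c = (\<lambda>x. \<Sum>k\<in>{- int N..int N}. c k * fourier_mode k x)"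
  by (auto simp: trig_def)

lemma continuous_on_fsum [continuous_intros]: "continuous_on S (\<lambda>x. \<Sum>k\<in>F. c k * fourier_mode k x)"
  by (intro continuous_intros)

lemma continuous_on_trig [continuous_intros]: "continuous_on S (trig N c)"
  unfolding trig_eq_fourier_sum by (intro continuous_intros)

lemma integral_pairing:
  assumes "continuous_on {0..1} f" "finite F"
  shows "integral {0..1} (\<lambda>x. cnj (\<Sum>k\<in>F. c k * fourier_mode k x) * f x) = (\<Sum>k\<in>F. cnj (c k) * fourier_coeff f k)"
proof -
  have "integral {0..1} (\<lambda>x. cnj (\<Sum>k\<in>F. c k * fourier_mode k x) * f x)
     = integral {0..1} (\<lambda>x. \<Sum>k\<in>F. cnj (c k) * (cnj (fourier_mode k x) * f x))"
    by (simp add: sum_distrib_right mult.assoc)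
  also have "\<dots> = (\<Sum>k\<in>F. integral {0..1} (\<lambda>x. cnj (c k) * (cnj (fourier_mode k x) * f x)))"
    by (intro integral_sum assms integrable_continuous_real continuous_intros)
  also have "\<dots> = (\<Sum>k\<in>F. cnj (c k) * fourier_coeff f k)"
    by (simp add: fourier_coeff_eq assms)
  finally show ?thesis .
qed

lemma fourier_coeff_fourier_mode: "fourier_coeff (fourier_mode l) k = (if k = l then 1 else 0)"
proof -
  have "fourier_coeff (fourier_mode l) k = integral {0..1} (fourier_mode (l - k))"
    by (simp add: fourier_coeff_eq continuous_intros fourier_mode_minus [symmetric] fourier_mode_add [symmetric])
  then show ?thesis by (simp add: integral_fourier_mode)
qed

lemma fourier_coeff_fsum:
  assumes "finite F"
  shows "fourier_coeff (\<lambda>x. \<Sum>l\<in>F. c l * fourier_mode l x) k = (if k \<in> F then c k else 0)"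
  using assms
proof (induction F rule: finite_induct)
  case empty
  then show ?case by (simp add: fourier_coeff_def)
next
  case (insert l F)
  then show ?case
    by (simp add: fourier_coeff_add continuous_intros fourier_coeff_cmult fourier_coeff_fourier_mode)
qed

lemma fourier_coeff_trig: "fourier_coeff (trig N c) k = (if \<bar>k\<bar> \<le> int N then c k else 0)"
  unfolding trig_eq_fourier_sum by (subst fourier_coeff_fsum) auto

text \<open>Expand |f - s|^2 and integrate. With \<open>c\<close> the coefficients of
  \<open>f\<close> this yields Bessel's inequality, with \<open>f = 0\<close> Parseval's identity
  for finite sums.\<close>

lemma l2sq_diff_fsum:
  assumes "continuous_on {0..1} f" "finite F"
  shows "l2sq (\<lambda>x. f x - (\<Sum>k\<in>F. c k * fourier_mode k x))
    = l2sq f - 2 * Re (\<Sum>k\<in>F. cnj (c k) * fourier_coeff f k) + (\<Sum>k\<in>F. (cmod (c k))\<^sup>2)"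
proof -
  define s where "s x = (\<Sum>k\<in>F. c k * fourier_mode k x)" for x
  have s: "continuous_on {0..1} s" unfolding s_def by (intro continuous_intros)
  have 1: "(cmod (a - b))\<^sup>2 = (cmod a)\<^sup>2 - 2 * Re (cnj b * a) + Re (cnj b * b)" for a b
    unfolding cmod_power2 by (simp add: power2_eq_square algebra_simps)
  have Re_int: "integral {0..1} (\<lambda>x. Re (cnj (s x) * h x)) = Re (\<Sum>k\<in>F. cnj (c k) * fourier_coeff h k)"
    if "continuous_on {0..1} h" for h
  proof -
    have "(\<lambda>x. cnj (s x) * h x) integrable_on {0..1}"
      by (intro integrable_continuous_real continuous_intros that s)
    from integral_linear[OF this bounded_linear_Re] show ?thesis
      using integral_pairing[OF that assms(2), of c] by (simp add: s_def o_def)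
  qed
  have "l2sq (\<lambda>x. f x - s x)
     = integral {0..1} (\<lambda>x. (cmod (f x))\<^sup>2 - 2 * Re (cnj (s x) * f x) + Re (cnj (s x) * s x))"
    by (simp add: l2sq_def 1)
  also have "\<dots> = integral {0..1} (\<lambda>x. (cmod (f x))\<^sup>2
      - 2 * Re (cnj (s x) * f x)) + integral {0..1} (\<lambda>x. Re (cnj (s x) * s x))"
    by (intro integral_add integrable_continuous_real continuous_intros assms s)
  also have "integral {0..1} (\<lambda>x. (cmod (f x))\<^sup>2 - 2 * Re (cnj (s x) * f x)) =
     l2sq f - integral {0..1} (\<lambda>x. 2 * Re (cnj (s x) * f x))"
    unfolding l2sq_def
    by (intro integral_diff integrable_continuous_real continuous_intros assms s)
  also have "integral {0..1} (\<lambda>x. 2 * Re (cnj (s x) * f x)) = 2 * Re (\<Sum>k\<in>F. cnj (c k) * fourier_coeff f k)"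
    by (simp only: integral_mult_right Re_int[OF assms(1)])
  also have "integral {0..1} (\<lambda>x. Re (cnj (s x) * s x)) = (\<Sum>k\<in>F. (cmod (c k))\<^sup>2)"
    unfolding Re_int[OF s] unfolding s_def fourier_coeff_fsum[OF assms(2)] Re_sum
    by (intro sum.cong) (auto simp: cmod_power2, simp add: power2_eq_square)
  finally show ?thesis by (simp add: s_def)
qed

lemma Bessel:
  assumes "continuous_on {0..1} f" "finite F"
  shows "(\<Sum>k\<in>F. (cmod (fourier_coeff f k))\<^sup>2) \<le> l2sq f"
proof -
  have *: "Re (cnj z * z) = (cmod z)\<^sup>2" for z
    unfolding cmod_power2 by (simp add: power2_eq_square)
  show ?thesis
    using l2sq_diff_fsum[OF assms, of "fourier_coeff f"]
      l2sq_nonneg[of "\<lambda>x. f x - (\<Sum>k\<in>F. fourier_coeff f k * fourier_mode k x)"]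
    unfolding Re_sum * by linarith
qed

lemma l2sq_fsum: "finite F \<Longrightarrow> l2sq (\<lambda>x. \<Sum>k\<in>F. c k * fourier_mode k x) = (\<Sum>k\<in>F. (cmod (c k))\<^sup>2)"
  using l2sq_diff_fsum[of "\<lambda>_. 0" F "\<lambda>k. - c k"]
  by (simp add: sum_negf fourier_coeff_def l2sq_def)

text \<open>The sets {-n..n} are cofinal among the finite sets of integers. This links unordered
  sums to the symmetric partial sums \<open>trig\<close>.\<close>

lemma has_sum_int_symmetric:
  fixes f :: "int \<Rightarrow> 'a::{comm_monoid_add,topological_space}"
  assumes "(f has_sum s) UNIV"
  shows "(\<lambda>n. \<Sum>k = - int n..int n. f k) \<longlonglongrightarrow> s"
proof -
  have "filterlim (\<lambda>n. {- int n..int n}) (finite_subsets_at_top UNIV) sequentially"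
    unfolding filterlim_finite_subsets_at_top
  proof safe
    fix X :: "int set" assume "finite X"
    then obtain m where m: "\<And>x. x \<in> X \<Longrightarrow> \<bar>x\<bar> \<le> m"
      by (metis finite_imageI imageI Max_ge)
    have "\<forall>n\<ge>nat m. X \<subseteq> {- int n..int n}"
      using m by fastforce
    then show "\<forall>\<^sub>F n in sequentially. finite {- int n..int n} \<and> X \<subseteq> {- int n..int n} \<and> {- int n..int n} \<subseteq> UNIV"
      by (auto simp: eventually_sequentially)
  qed
  from filterlim_compose[OF assms[unfolded has_sum_def] this] show ?thesis .
qed

section \<open>Absolutely convergent Fourier series\<close>

text \<open>The multiplier terms of the equations are series of this form, with \<open>c\<close> the
  product of the symbol and the Fourier coefficients.\<close>

definition fser :: "(int \<Rightarrow> complex) \<Rightarrow> real \<Rightarrow> complex" where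
  "fser c x = (\<Sum>\<^sub>\<infinity>k. c k * fourier_mode k x)"

text \<open>The tail of the series of moduli does not depend on \<open>x\<close>: the Weierstrass
  test in quantitative form.\<close>

lemma fser_trig_dist:
  assumes c: "(\<lambda>k. cmod (c k)) summable_on UNIV"
  shows "cmod (fser c x - trig n c x) \<le> (\<Sum>\<^sub>\<infinity>k. cmod (c k)) - (\<Sum>k = - int n..int n. cmod (c k))"
proof -
  let ?I = "{- int n..int n}"
  have norm: "(\<lambda>k. cmod (c k * fourier_mode k x)) = (\<lambda>k. cmod (c k))"
    by (simp add: norm_mult)
  have abs: "(\<lambda>k. c k * fourier_mode k x) summable_on UNIV"
    by (rule abs_summable_summable) (simp add: norm c)
  have split: "infsum f UNIV = infsum f ?I + infsum f (- ?I)"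
    if "f summable_on UNIV" for f :: "int \<Rightarrow> 'a::banach"
  proof -
    have "infsum f (?I \<union> - ?I) = infsum f ?I + infsum f (- ?I)"
      by (intro infsum_Un_disjoint summable_on_subset_banach[OF that]) auto
    then show ?thesis by (simp only: Compl_partition)
  qed
  have "fser c x - trig n c x = (\<Sum>\<^sub>\<infinity>k\<in>-?I. c k * fourier_mode k x)"
    using split[OF abs] by (simp add: fser_def trig_def)
  also have "cmod \<dots> \<le> (\<Sum>\<^sub>\<infinity>k\<in>-?I. cmod (c k * fourier_mode k x))"
    by (rule norm_infsum_bound, unfold norm) (rule summable_on_subset_banach[OF c subset_UNIV])
  also have "\<dots> = (\<Sum>\<^sub>\<infinity>k. cmod (c k)) - (\<Sum>k\<in>?I. cmod (c k))"
    unfolding norm using split[OF c] by simp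
  finally show ?thesis .
qed

lemma cmod_fser_le:
  assumes c: "(\<lambda>k. cmod (c k)) summable_on UNIV"
  shows "cmod (fser c x) \<le> (\<Sum>\<^sub>\<infinity>k. cmod (c k))"
    and "cmod (trig n c x) \<le> (\<Sum>\<^sub>\<infinity>k. cmod (c k))"
proof -
  have "cmod (trig n c x) \<le> (\<Sum>k = - int n..int n. cmod (c k))"
    unfolding trig_def by (rule order_trans[OF norm_sum]) (simp add: norm_mult)
  moreover have "(\<Sum>k = - int n..int n. cmod (c k)) \<le> (\<Sum>\<^sub>\<infinity>k. cmod (c k))"
    by (rule finite_sum_le_infsum[OF c]) auto
  moreover have "cmod (fser c x) \<le> cmod (fser c x - trig n c x) + cmod (trig n c x)"
    using norm_triangle_ineq[of "fser c x - trig n c x" "trig n c x"] by simp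
  ultimately show "cmod (fser c x) \<le> (\<Sum>\<^sub>\<infinity>k. cmod (c k))" "cmod (trig n c x) \<le> (\<Sum>\<^sub>\<infinity>k. cmod (c k))"
    using fser_trig_dist[OF c, of x n] by linarith+
qed

lemma abs_tail_tendsto_0:
  assumes c: "(\<lambda>k. cmod (c k)) summable_on (UNIV :: int set)"
  shows "(\<lambda>n. (\<Sum>\<^sub>\<infinity>k. cmod (c k)) - (\<Sum>k = - int n..int n. cmod (c k))) \<longlonglongrightarrow> 0"
  using tendsto_diff[OF tendsto_const has_sum_int_symmetric[OF has_sum_infsum[OF c]], of "\<Sum>\<^sub>\<infinity>k. cmod (c k)"]
  by simp

lemma uniform_limit_fser:
  assumes c: "(\<lambda>k. cmod (c k)) summable_on UNIV"
  shows "uniform_limit UNIV (\<lambda>n. trig n c) (fser c) sequentially"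
proof (rule uniform_limitI)
  fix e :: real assume "e > 0"
  then have "\<forall>\<^sub>F n in sequentially. (\<Sum>\<^sub>\<infinity>k. cmod (c k)) - (\<Sum>k = - int n..int n. cmod (c k)) < e"
    by (rule order_tendstoD(2)[OF abs_tail_tendsto_0[OF c]])
  then show "\<forall>\<^sub>F n in sequentially. \<forall>x\<in>UNIV. dist (trig n c x) (fser c x) < e"
  proof eventually_elim
    case (elim n)
    show ?case
    proof
      fix x
      show "dist (trig n c x) (fser c x) < e"
        using fser_trig_dist[OF c, of x n] elim norm_minus_commute[of "trig n c x" "fser c x"]
        unfolding dist_norm by linarith
    qed
  qed
qed

lemma continuous_on_fser [continuous_intros]:
  assumes c: "(\<lambda>k. cmod (c k)) summable_on UNIV"
  shows "continuous_on S (fser c)"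
proof -
  have "continuous_on UNIV (fser c)"
    by (rule uniform_limit_theorem[OF _ uniform_limit_fser[OF c]])
      (auto intro!: always_eventually continuous_intros)
  then show ?thesis using continuous_on_subset by blast
qed

lemma l2sq_fser_diff_tendsto_0:
  assumes c: "(\<lambda>k. cmod (c k)) summable_on UNIV"
  shows "(\<lambda>n. l2sq (\<lambda>x. fser c x - trig n c x)) \<longlonglongrightarrow> 0"
proof -
  let ?e = "\<lambda>n. (\<Sum>\<^sub>\<infinity>k. cmod (c k)) - (\<Sum>k = - int n..int n. cmod (c k))"
  have 1: "(\<lambda>n. (?e n)\<^sup>2) \<longlonglongrightarrow> 0"
    using tendsto_power[OF abs_tail_tendsto_0[OF c], of 2] by simp
  have "l2sq (\<lambda>x. fser c x - trig n c x) \<le> (?e n)\<^sup>2" for n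
    by (intro l2sq_le_const continuous_intros c fser_trig_dist)
  then show ?thesis
    by (intro tendsto_sandwich[OF _ _ tendsto_const 1] always_eventually allI l2sq_nonneg)
qed

text \<open>For n \<ge> |k| the partial sum \<open>trig n c\<close> already has the coefficient
  \<open>c k\<close>; Bessel's inequality for the single mode k bounds the difference by an L^2
  distance that tends to 0.\<close>

lemma fourier_coeff_fser:
  assumes c: "(\<lambda>k. cmod (c k)) summable_on UNIV"
  shows "fourier_coeff (fser c) k = c k"
proof -
  have "(\<lambda>n. l2sq (\<lambda>x. fser c x - trig n c x)) \<longlonglongrightarrow> 0"
    by (rule l2sq_fser_diff_tendsto_0[OF c])
  moreover have "\<forall>\<^sub>F n in sequentially. (cmod (fourier_coeff (fser c) k - c k))\<^sup>2 \<le> l2sq (\<lambda>x. fser c x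
      - trig n c x)"
    unfolding eventually_sequentially
  proof (intro exI allI impI)
    fix n assume "n \<ge> nat \<bar>k\<bar>"
    then have "fourier_coeff (\<lambda>x. fser c x - trig n c x) k = fourier_coeff (fser c) k - c k"
      by (subst fourier_coeff_diff) (auto intro!: continuous_intros c simp: fourier_coeff_trig)
    then show "(cmod (fourier_coeff (fser c) k - c k))\<^sup>2 \<le> l2sq (\<lambda>x. fser c x - trig n c x)"
      using Bessel[of "\<lambda>x. fser c x - trig n c x" "{k}"] by (simp add: continuous_intros c)
  qed
  ultimately have "(cmod (fourier_coeff (fser c) k - c k))\<^sup>2 \<le> 0"
    by (intro tendsto_lowerbound) auto
  then show ?thesis by simp
qed

text \<open>Pythagoras compares the distances to \<open>trig N c\<close> and to
  \<open>trig n c\<close>: they differ by a finite sum over N < |k| \<le> n, and the second one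
  tends to 0. Hence a bound on finite sums is enough.\<close>

lemma l2sq_fser_tail_le:
  assumes c: "(\<lambda>k. cmod (c k)) summable_on UNIV"
    and B: "\<And>F. finite F \<Longrightarrow> (\<And>k. k \<in> F \<Longrightarrow> \<bar>k\<bar> > int N) \<Longrightarrow> (\<Sum>k\<in>F. (cmod (c k))\<^sup>2) \<le> B"
  shows "l2sq (\<lambda>x. fser c x - trig N c x) \<le> B"
proof -
  have sq: "l2sq (\<lambda>x. fser c x - trig n c x) = l2sq (fser c) - (\<Sum>k = - int n..int n. (cmod (c k))\<^sup>2)" for n
  proof -
    have "Re (\<Sum>k = - int n..int n. cnj (c k) * c k) = (\<Sum>k = - int n..int n. (cmod (c k))\<^sup>2)"
      unfolding Re_sum cmod_power2 by (simp add: power2_eq_square)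
    then show ?thesis
      unfolding trig_def
      by (subst l2sq_diff_fsum) (auto simp: fourier_coeff_fser[OF c] intro!: continuous_intros c)
  qed
  have "\<forall>\<^sub>F n in sequentially. l2sq (\<lambda>x. fser c x - trig N c x) \<le> B + l2sq (\<lambda>x. fser c x - trig n c x)"
    unfolding eventually_sequentially
  proof (intro exI allI impI)
    fix n assume n: "n \<ge> N"
    have "(\<Sum>k = - int n..int n. (cmod (c k))\<^sup>2) =
        (\<Sum>k = - int N..int N. (cmod (c k))\<^sup>2) + (\<Sum>k \<in> {- int n..int n} - {- int N..int N}. (cmod (c k))\<^sup>2)"
      using n by (subst sum.subset_diff[of "{- int N..int N}"]) auto
    also have "(\<Sum>k \<in> {- int n..int n} - {- int N..int N}. (cmod (c k))\<^sup>2) \<le> B"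
      by (rule B) auto
    finally show "l2sq (\<lambda>x. fser c x - trig N c x) \<le> B + l2sq (\<lambda>x. fser c x - trig n c x)"
      by (simp add: sq)
  qed
  then show ?thesis
    using tendsto_add[OF tendsto_const[of B] l2sq_fser_diff_tendsto_0[OF c]]
    by (intro tendsto_lowerbound) auto
qed

lemma has_vector_derivative_trig:
  "(trig n c has_vector_derivative trig n (fdiff c) x) (at x within S)"
  unfolding trig_eq_fourier_sum
  by (rule has_vector_derivative_eq_rhs, (rule has_vector_derivative_sum has_vector_derivative_mult_right
      has_vector_derivative_fourier_mode)+)
     (simp add: fdiff_def mult_ac)

text \<open>Termwise differentiation: the derivatives of the partial sums converge uniformly because
  the differentiated coefficients are absolutely summable.\<close>

lemma has_vector_derivative_fser:
  assumes c: "(\<lambda>k. cmod (c k)) summable_on UNIV" and d: "(\<lambda>k. cmod (fdiff c k)) summable_on UNIV"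
  shows "(fser c has_vector_derivative fser (fdiff c) x) (at x)"
proof -
  have "\<exists>g. \<forall>x\<in>UNIV. (\<lambda>n. trig n c x) \<longlonglongrightarrow> g x \<and>
    (g has_derivative (\<lambda>h. h *\<^sub>R fser (fdiff c) x)) (at x within UNIV)"
  proof (rule has_derivative_sequence[of UNIV "\<lambda>n. trig n c" "\<lambda>n x h. h *\<^sub>R trig n (fdiff c) x"])
    show "(trig n c has_derivative (\<lambda>h. h *\<^sub>R trig n (fdiff c) x)) (at x within UNIV)" for n x
      using has_vector_derivative_trig by (simp add: has_vector_derivative_def)
    show "(\<lambda>n. trig n c 0) \<longlonglongrightarrow> fser c 0"
      by (rule tendsto_uniform_limitI[OF uniform_limit_fser[OF c]]) simp
    fix e :: real assume "e > 0"
    from uniform_limitD[OF uniform_limit_fser[OF d] this]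
    show "\<forall>\<^sub>F n in sequentially. \<forall>x\<in>UNIV. \<forall>h. cmod (h *\<^sub>R trig n (fdiff c) x - h *\<^sub>R fser (fdiff c) x) \<le> e * norm h"
      by eventually_elim
        (auto simp: dist_norm mult.commute[of e] less_imp_le simp flip: scaleR_diff_right intro!: mult_left_mono)
  qed auto
  then obtain g where g: "\<And>x. (\<lambda>n. trig n c x) \<longlonglongrightarrow> g x"
    "\<And>x. (g has_derivative (\<lambda>h. h *\<^sub>R fser (fdiff c) x)) (at x within UNIV)"
    by auto
  have "g = fser c"
    using g(1) tendsto_uniform_limitI[OF uniform_limit_fser[OF c]] LIMSEQ_unique by blast
  then show ?thesis using g(2) by (simp add: has_vector_derivative_def)
qed

section \<open>Uniqueness of Fourier coefficients\<close>

lemma fourier_mode_1_eq_1_iff: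
  assumes "\<bar>y\<bar> < 1"
  shows "fourier_mode 1 y = 1 \<longleftrightarrow> y = 0"
proof
  assume "fourier_mode 1 y = 1"
  then obtain n :: int where "Im (2 * of_real pi * \<i> * of_int 1 * of_real y) = of_int (2 * n) * pi"
    unfolding fourier_mode_def exp_eq_1 by blast
  then have "y = of_int n" by (simp add: field_simps)
  with assms show "y = 0" by (simp flip: of_int_abs)
qed simp

text \<open>
  Chernoff's argument: dividing \<open>f - f x0\<close> by \<open>fourier_mode 1 (x - x0) - 1\<close> leaves a continuous
  function whose Fourier coefficients have constant modulus on either side of \<open>k = 0\<close>,
  so Bessel's inequality makes them vanish.
\<close>

lemma fourier_coeff_zero_imp_zero:
  assumes f: "continuous_on {0..1} f" and x0: "0 < x0" "x0 < 1"
    and D: "(f has_vector_derivative D) (at x0)"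
    and zero: "\<And>k. fourier_coeff f k = 0"
  shows "f x0 = 0"
proof -
  define d where "d x = fourier_mode 1 (x - x0) - 1" for x
  \<comment> \<open>The value at \<open>x0\<close> is the limit of the quotient, since
    \<open>d\<close> has derivative 2 pi i there.\<close>
  define h where "h x = (if x = x0 then D / (2 * of_real pi * \<i>) else (f x - f x0) / d x)" for x
  have d0: "d x \<noteq> 0" if "x \<in> {0..1}" "x \<noteq> x0" for x
  proof -
    have "\<bar>x - x0\<bar> < 1" using that(1) x0 by (auto simp: abs_if)
    from fourier_mode_1_eq_1_iff[OF this] that(2) show ?thesis by (simp add: d_def)
  qed
  have dcont: "continuous_on S d" for S
    unfolding d_def fourier_mode_def by (intro continuous_intros)
  have dderiv: "(d has_vector_derivative 2 * of_real pi * \<i>) (at x0)"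
    unfolding d_def fourier_mode_def
    by (auto intro!: derivative_eq_intros has_vector_derivative_real_field)
  have hcont: "continuous_on {0..1} h"
  proof (rule continuous_on_eq_continuous_within[THEN iffD2], rule ballI)
    fix x :: real assume x: "x \<in> {0..1}"
    show "continuous (at x within {0..1}) h"
    proof (cases "x = x0")
      case False
      have "continuous_on ({0..1} - {x0}) (\<lambda>x. (f x - f x0) / d x)"
        using d0 by (intro continuous_intros dcont continuous_on_subset[OF f]) auto
      then have "continuous (at x within ({0..1} - {x0})) (\<lambda>x. (f x - f x0) / d x)"
        using False x by (simp add: continuous_on_eq_continuous_within)
      moreover have "at x within ({0..1} - {x0}) = at x within {0..1}"
        by (rule at_within_nhd[of _ "- {x0}"]) (use False in auto)
      ultimately have "((\<lambda>x. (f x - f x0) / d x) \<longlongrightarrow> h x) (at x within {0..1})"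
        using False by (simp add: continuous_within h_def)
      moreover have "\<forall>\<^sub>F y in at x within {0..1}. y \<noteq> x0"
        using False by (intro tendsto_imp_eventually_ne[OF tendsto_ident_at])
      then have "\<forall>\<^sub>F y in at x within {0..1}. (f y - f x0) / d y = h y"
        by eventually_elim (simp add: h_def)
      ultimately show ?thesis
        unfolding continuous_within by (rule Lim_transform_eventually)
    next
      case True
      \<comment> \<open>The definition of the derivative divides by the norm of y - x0. It is
        rewritten for the signed difference quotient, so that the quotients of \<open>f\<close> and
        \<open>d\<close> can be divided by each other.\<close>
      have q: "((\<lambda>y. (g y - g x0) /\<^sub>R (y - x0)) \<longlongrightarrow> D) (at x0)" if "(g has_vector_derivative D) (at x0)" for g
          and D :: complex
      proof -
        have "((\<lambda>y. (g y - g x0) /\<^sub>R (y - x0) - D) \<longlongrightarrow> 0) (at x0)"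
        proof (rule tendsto_norm_zero_cancel, rule Lim_transform_eventually)
          have L: "((\<lambda>y. (1 / norm (y - x0)) *\<^sub>R (g y - (g x0 + (y - x0) *\<^sub>R D))) \<longlongrightarrow> 0) (at x0)"
            using that unfolding has_vector_derivative_def has_derivative_within by blast
          show "((\<lambda>y. norm ((1 / norm (y - x0)) *\<^sub>R (g y - (g x0 + (y - x0) *\<^sub>R D)))) \<longlongrightarrow> 0) (at x0)"
            by (rule tendsto_norm_zero[OF L])
          have "norm ((1 / norm (y - x0)) *\<^sub>R (g y - (g x0 + (y - x0) *\<^sub>R D)))
              = norm ((g y - g x0) /\<^sub>R (y - x0) - D)" if "y \<noteq> x0" for y
          proof -
            have "g y - (g x0 + (y - x0) *\<^sub>R D) = (y - x0) *\<^sub>R ((g y - g x0) /\<^sub>R (y - x0) - D)"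
              using that by (simp add: scaleR_diff_right)
            then show ?thesis using that by simp
          qed
          then show "\<forall>\<^sub>F y in at x0. norm ((1 / norm (y - x0)) *\<^sub>R (g y - (g x0 + (y - x0) *\<^sub>R D)))
              = norm ((g y - g x0) /\<^sub>R (y - x0) - D)"
            by (auto simp: eventually_at_filter)
        qed
        then show ?thesis by (simp add: Lim_null[symmetric])
      qed
      have "((\<lambda>y. ((f y - f x0) /\<^sub>R (y - x0)) / ((d y - d x0) /\<^sub>R (y - x0))) \<longlongrightarrow> D / (2 * of_real pi * \<i>)) (at x0)"
        by (intro tendsto_divide q D dderiv) simp
      moreover have "((f y - f x0) /\<^sub>R (y - x0)) / ((d y - d x0) /\<^sub>R (y - x0)) = h y" if "y \<noteq> x0" for y
        using that by (simp add: h_def d_def scaleR_conv_of_real)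
      then have "\<forall>\<^sub>F y in at x0. ((f y - f x0) /\<^sub>R (y - x0)) / ((d y - d x0) /\<^sub>R (y - x0)) = h y"
        by (simp add: eventually_at_filter)
      ultimately have "(h \<longlongrightarrow> D / (2 * of_real pi * \<i>)) (at x0)"
        by (rule Lim_transform_eventually)
      then have "(h \<longlongrightarrow> h x0) (at x0 within {0..1})"
        by (rule tendsto_within_subset[THEN tendsto_eq_rhs]) (simp_all add: h_def)
      then show ?thesis
        by (simp only: True continuous_within)
    qed
  qed
  define w where "w = fourier_mode 1 (- x0)"
  have [simp]: "cmod w = 1" by (simp add: w_def)
  have eq: "f x - f x0 = w * (fourier_mode 1 x * h x) - h x" if "x \<in> {0..1}" for x
  proof -
    have "d x = w * fourier_mode 1 x - 1"
      using fourier_mode_add_arg[of 1 x "- x0"] by (simp add: d_def w_def mult.commute)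
    then have "d x * h x = w * (fourier_mode 1 x * h x) - h x"
      by (simp add: left_diff_distrib mult.assoc)
    moreover have "f x - f x0 = d x * h x"
    proof (cases "x = x0")
      case False
      then show ?thesis using d0[OF that] by (simp add: h_def)
    qed (simp add: d_def)
    ultimately show ?thesis by simp
  qed
  \<comment> \<open>Multiplication by \<open>fourier_mode 1\<close> shifts the coefficients by one,
    so f - f x0 = d h becomes a two-term recursion. The coefficients of \<open>f\<close> vanish, and
    the constant \<open>f x0\<close> contributes at k = 0 only.\<close>
  have rec: "w * fourier_coeff h (k - 1) - fourier_coeff h k = (if k = 0 then - f x0 else 0)" for k
  proof -
    have cont: "continuous_on {0..1} (\<lambda>x. fourier_mode 1 x * h x)"
      by (intro continuous_intros hcont)
    have shift: "fourier_coeff (\<lambda>x. fourier_mode 1 x * h x) k = fourier_coeff h (k - 1)"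
    proof -
      have "cnj (fourier_mode k x) * fourier_mode 1 x = cnj (fourier_mode (k - 1) x)" for x
        using fourier_mode_add[of "- k" 1 x] by (simp flip: fourier_mode_minus)
      then show ?thesis
        unfolding fourier_coeff_eq[OF hcont] fourier_coeff_eq[OF cont] by (simp only: mult.assoc [symmetric])
    qed
    have "fourier_coeff (\<lambda>x. f x - f x0) k = fourier_coeff (\<lambda>x. w * (fourier_mode 1 x * h x) - h x) k"
    proof -
      have "integral {0..1} (\<lambda>x. cnj (fourier_mode k x) * (f x - f x0))
          = integral {0..1} (\<lambda>x. cnj (fourier_mode k x) * (w * (fourier_mode 1 x * h x) - h x))"
        by (rule integral_cong) (simp only: eq)
      moreover have "continuous_on {0..1} (\<lambda>x. f x - f x0)"
        "continuous_on {0..1} (\<lambda>x. w * (fourier_mode 1 x * h x) - h x)"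
        by (intro continuous_intros f cont hcont)+
      ultimately show ?thesis by (simp only: fourier_coeff_eq)
    qed
    moreover have "fourier_coeff (\<lambda>x. f x0) k = (if k = 0 then f x0 else 0)"
      using fourier_coeff_cmult[of "f x0" "fourier_mode 0" k] by (simp add: fourier_coeff_fourier_mode)
    ultimately show ?thesis
      by (simp add: fourier_coeff_diff f hcont cont continuous_intros fourier_coeff_cmult zero shift split:
          if_splits)
  qed
  have step: "cmod (fourier_coeff h (k - 1)) = cmod (fourier_coeff h k)" if "k \<noteq> 0" for k
  proof -
    have "w * fourier_coeff h (k - 1) = fourier_coeff h k" using rec[of k] that by simp
    then have "cmod (w * fourier_coeff h (k - 1)) = cmod (fourier_coeff h k)" by (rule arg_cong)
    then show ?thesis unfolding norm_mult by simp
  qed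
  have pos: "cmod (fourier_coeff h (int n)) = cmod (fourier_coeff h 0)" for n
  proof (induction n)
    case (Suc n)
    then show ?case using step[of "int (Suc n)"] by simp
  qed simp
  \<comment> \<open>At k = 0 the recursion may have a nonzero right-hand side, so nothing links the
    indices -1 and 0 yet; the negative side therefore starts at -1.\<close>
  have neg: "cmod (fourier_coeff h (- 1 - int n)) = cmod (fourier_coeff h (- 1))" for n
  proof (induction n)
    case (Suc n)
    then show ?case using step[of "- 1 - int n"] by (simp add: algebra_simps)
  qed simp
  have van: "a = 0" if "inj \<phi>" "\<And>n. cmod (fourier_coeff h (\<phi> n)) = cmod a" for a and \<phi> :: "nat \<Rightarrow> int"
  proof (rule ccontr)
    assume "a \<noteq> 0"
    then obtain n where n: "l2sq h < real n * (cmod a)\<^sup>2"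
      using reals_Archimedean3[of "(cmod a)\<^sup>2"] by auto
    have "(\<Sum>k\<in>\<phi> ` {..<n}. (cmod (fourier_coeff h k))\<^sup>2) \<le> l2sq h"
      by (rule Bessel[OF hcont]) simp
    then show False
      using n that(2) sum.reindex[OF inj_on_subset[OF that(1) subset_UNIV, of "{..<n}"], of "\<lambda>k. (cmod
          (fourier_coeff h k))\<^sup>2"]
      by simp
  qed
  have "fourier_coeff h 0 = 0"
    by (rule van[of int, OF _ pos]) simp
  moreover have "fourier_coeff h (- 1) = 0"
    by (rule van[of "\<lambda>n. - 1 - int n", OF _ neg]) (simp add: inj_def)
  ultimately show ?thesis using rec[of 0] by simp
qed

lemma periodic1_of_int: "periodic1 v \<Longrightarrow> v (x + of_int n) = v x"
proof (induction n rule: int_induct[where k = 0])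
  case (step1 i)
  then have "v ((x + of_int i) + 1) = v (x + of_int i)" unfolding periodic1_def by blast
  then show ?case using step1 by (simp add: add.assoc)
next
  case (step2 i)
  then have "v (x + of_int (i - 1) + 1) = v (x + of_int (i - 1))" unfolding periodic1_def by blast
  then show ?case using step2 by simp
qed simp

text \<open>The difference of \<open>v\<close> and its series is differentiable with vanishing
  coefficients, so \<open>fourier_coeff_zero_imp_zero\<close> makes it 0 at interior points of the
  period; continuity adds the endpoints and periodicity the rest.\<close>

lemma fser_fourier_coeff:
  assumes v: "periodic1 v" "\<And>x. v differentiable (at x)"
    and c: "(\<lambda>k. cmod (fourier_coeff v k)) summable_on UNIV"
    and d: "(\<lambda>k. cmod (fdiff (fourier_coeff v) k)) summable_on UNIV"
  shows "fser (fourier_coeff v) = v"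
proof
  fix x
  let ?s = "fser (fourier_coeff v)"
  have vc: "continuous_on S v" for S
    using v(2) by (intro differentiable_imp_continuous_on) (simp add: differentiable_on_def
        differentiable_at_withinI)
  define e where "e x = v x - ?s x" for x
  have ec: "continuous_on S e" for S
    unfolding e_def by (intro continuous_intros vc c)
  have e0: "e x = 0" if x: "x \<in> {0<..<1}" for x
  proof (rule fourier_coeff_zero_imp_zero[OF ec])
    show "(e has_vector_derivative vector_derivative v (at x) - fser (fdiff (fourier_coeff v)) x) (at x)"
      unfolding e_def
      by (intro has_vector_derivative_diff has_vector_derivative_fser c d)
        (use v(2) vector_derivative_works in blast)
    show "fourier_coeff e k = 0" for k
      unfolding e_def by (subst fourier_coeff_diff) (auto intro!: continuous_intros vc c simp: fourier_coeff_fser c)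
  qed (use x in auto)
  have e1: "e x = 0" if "x \<in> {0..1}" for x
    using continuous_constant_on_closure[of "{0<..<1}" e 0 x] e0 ec that
    by (simp add: closure_greaterThanLessThan)
  have "periodic1 e"
    using v(1) periodic1_fourier_mode by (simp add: e_def periodic1_def fser_def)
  from periodic1_of_int[OF this, of "frac x" "\<lfloor>x\<rfloor>"] e1[of "frac x"] have "e x = 0"
    using frac_lt_1[of x] by (simp add: frac_def)
  then show "?s x = v x" by (simp add: e_def)
qed

text \<open>Integration by parts over a period; the boundary terms cancel because \<open>v\<close>
  and the modes are 1-periodic.\<close>

lemma fourier_coeff_deriv:
  assumes v: "periodic1 v" and D: "\<And>x. (v has_vector_derivative v' x) (at x)" and c: "continuous_on {0..1} v'"
  shows "fourier_coeff v' k = fdiff (fourier_coeff v) k"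
proof -
  have vc: "continuous_on {0..1} v"
    using D by (meson continuous_on_eq_continuous_within has_vector_derivative_at_within
        has_vector_derivative_continuous)
  let ?c = "2 * of_real pi * \<i> * of_int k :: complex"
  have "((\<lambda>x. cnj (fourier_mode k x) * v' x + cnj (?c * fourier_mode k x) * v x) has_integral
      cnj (fourier_mode k 1) * v 1 - cnj (fourier_mode k 0) * v 0) {0..1}"
    by (intro fundamental_theorem_of_calculus zero_le_one has_vector_derivative_mult has_vector_derivative_cnj
        has_vector_derivative_fourier_mode has_vector_derivative_at_within[OF D])
  moreover have "v 1 = v 0" using v unfolding periodic1_def by (metis add_0)
  ultimately have "0 = integral {0..1} (\<lambda>x. cnj (fourier_mode k x) * v' x + cnj (?c * fourier_mode k x) * v x)"
    by (simp add: integral_unique)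
  also have "\<dots> = fourier_coeff v' k + integral {0..1} (\<lambda>x. cnj (?c * fourier_mode k x) * v x)"
    by (subst integral_add) (auto intro!: integrable_continuous_real continuous_intros c vc simp:
        fourier_coeff_eq[OF c])
  also have "integral {0..1} (\<lambda>x. cnj (?c * fourier_mode k x) * v x) = cnj ?c * fourier_coeff v k"
  proof -
    have "(\<lambda>x. cnj (?c * fourier_mode k x) * v x) = (\<lambda>x. cnj ?c * (cnj (fourier_mode k x) * v x))"
      by (simp only: complex_cnj_mult mult.assoc)
    then show ?thesis by (simp only: integral_mult_right fourier_coeff_eq[OF vc])
  qed
  finally show ?thesis by (simp add: fdiff_def algebra_simps)
qed


text \<open>\<open>has_dt\<close> is only pointwise in \<open>x\<close>. The bound \<open>M\<close>
  dominates the difference quotients through the mean value inequality, and dominated convergence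
  moves the limit inside the integral.\<close>

lemma fourier_coeff_has_dt:
  assumes v: "\<And>t. t \<in> {0..T} \<Longrightarrow> continuous_on {0..1} (v t)" and v': "\<And>t. t \<in> {0..T} \<Longrightarrow> continuous_on {0..1} (v' t)"
    and dt: "has_dt T v v'" and M: "\<And>t x. t \<in> {0..T} \<Longrightarrow> cmod (v' t x) \<le> M"
    and t: "t \<in> {0..T}"
  shows "((\<lambda>s. fourier_coeff (v s) k) has_vector_derivative fourier_coeff (v' t) k) (at t within {0..T})"
proof -
  \<comment> \<open>The remainder of the first-order expansion in time, normalised as in
    \<open>has_derivative_within\<close>. Its Fourier coefficient is the corresponding remainder for
    the coefficients, by \<open>eq\<close> below.\<close>
  define q where "q s x = (1 / norm (s - t)) *\<^sub>R (v s x - (v t x + (s - t) *\<^sub>R v' t x))" for s x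
  have D: "((\<lambda>s. v s x) has_derivative (\<lambda>h. h *\<^sub>R v' t x)) (at t within {0..T})" if "t \<in> {0..T}" for t x
    using dt that by (auto simp: has_dt_def has_vector_derivative_def)
  have q0: "((\<lambda>s. q s x) \<longlongrightarrow> 0) (at t within {0..T})" for x
    using D[OF t] unfolding has_derivative_within q_def by auto
  have qM: "cmod (q s x) \<le> 2 * M" if s: "s \<in> {0..T} - {t}" for s x
  proof -
    have "cmod (v s x - v t x) \<le> M * norm (s - t)"
      by (rule differentiable_bound[of "{0..T}" "\<lambda>s. v s x" "\<lambda>t h. h *\<^sub>R v' t x"])
        (use D M t s in \<open>auto intro!: onorm_le simp: mult.commute[of M] mult_left_mono\<close>)
    moreover have "cmod ((s - t) *\<^sub>R v' t x) \<le> M * norm (s - t)"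
      using M[OF t, of x] by (simp add: mult.commute[of M] mult_left_mono)
    ultimately have "cmod (v s x - (v t x + (s - t) *\<^sub>R v' t x)) \<le> 2 * M * norm (s - t)"
      using norm_triangle_ineq4[of "v s x - v t x" "(s - t) *\<^sub>R v' t x"] by (simp add: algebra_simps)
    then show ?thesis using s unfolding q_def norm_scaleR by (simp add: pos_divide_le_eq)
  qed
  have qc: "continuous_on {0..1} (q s)" if "s \<in> {0..T}" for s
    unfolding q_def by (intro continuous_intros v v' that t)
  have eq: "(1 / norm (s - t)) *\<^sub>R (fourier_coeff (v s) k - (fourier_coeff (v t) k + (s
      - t) *\<^sub>R fourier_coeff (v' t) k))
      = fourier_coeff (q s) k" if s: "s \<in> {0..T}" for s
  proof -
    have 1: "fourier_coeff (\<lambda>x. v t x + of_real (s - t) * v' t x) k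
        = fourier_coeff (v t) k + of_real (s - t) * fourier_coeff (v' t) k"
      by (subst fourier_coeff_add) (intro continuous_intros v v' t | simp only: fourier_coeff_cmult)+
    have "fourier_coeff (\<lambda>x. v s x - (v t x + of_real (s - t) * v' t x)) k
        = fourier_coeff (v s) k - fourier_coeff (\<lambda>x. v t x + of_real (s - t) * v' t x) k"
      by (subst fourier_coeff_diff) (intro continuous_intros v v' t s | simp)+
    then show ?thesis
      unfolding q_def scaleR_conv_of_real fourier_coeff_cmult 1 by simp
  qed
  show ?thesis
    unfolding has_vector_derivative_def has_derivative_within
  proof (intro conjI bounded_linear_scaleR_left)
    have "((\<lambda>s. fourier_coeff (q s) k) \<longlongrightarrow> 0) (at t within {0..T})"
      unfolding tendsto_at_iff_sequentially
    proof (intro allI impI)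
      fix X assume X: "\<forall>i. X i \<in> {0..T} - {t}" "X \<longlonglongrightarrow> t"
      have "(\<lambda>n. integral {0..1} (\<lambda>x. cnj (fourier_mode k x) * q (X n) x)) \<longlonglongrightarrow> integral {0..1} (\<lambda>x::real. 0 ::
          complex)"
      proof (rule dominated_convergence(2)[of "\<lambda>n x. cnj (fourier_mode k x) * q (X n) x" "{0..1}" "\<lambda>_. 2 *
          M" "\<lambda>_. 0"])
        show "(\<lambda>x. cnj (fourier_mode k x) * q (X n) x) integrable_on {0..1}" for n
          using X by (intro integrable_continuous_real continuous_intros qc) auto
        show "cmod (cnj (fourier_mode k x) * q (X n) x) \<le> 2 * M" for n x
          using qM X(1) by (simp add: norm_mult)
        fix x
        have "(\<lambda>n. q (X n) x) \<longlonglongrightarrow> 0"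
          using q0[of x] X unfolding tendsto_at_iff_sequentially o_def by blast
        then show "(\<lambda>n. cnj (fourier_mode k x) * q (X n) x) \<longlonglongrightarrow> 0"
          by (rule tendsto_mult_right_zero)
      qed (rule integrable_continuous_real, intro continuous_intros)
      moreover have "fourier_coeff (q (X n)) k = integral {0..1} (\<lambda>x. cnj (fourier_mode k x) * q (X n) x)" for n
        using X by (intro fourier_coeff_eq qc) auto
      ultimately show "((\<lambda>s. fourier_coeff (q s) k) \<circ> X) \<longlonglongrightarrow> 0" by (simp add: o_def)
    qed
    then show "((\<lambda>s. (1 / norm (s - t)) *\<^sub>R (fourier_coeff (v s) k - (fourier_coeff (v t) k + (s
        - t) *\<^sub>R fourier_coeff (v' t) k)))
        \<longlongrightarrow> 0) (at t within {0..T})"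
      by (rule Lim_transform_within[OF _ zero_less_one]) (rule eq[symmetric], simp)
  qed
qed

section \<open>Ordinary differential equations with a Lipschitz right-hand side\<close>

text \<open>The integrating factor exp(-K t) turns the inequality into monotonicity, for \<phi> and
  K of any sign.\<close>

lemma Gronwall:
  fixes \<phi> :: "real \<Rightarrow> real"
  assumes D: "\<And>t. t \<in> {0..T} \<Longrightarrow> (\<phi> has_vector_derivative \<phi>' t) (at t within {0..T})"
    and le: "\<And>t. t \<in> {0..T} \<Longrightarrow> \<phi>' t \<le> K * \<phi> t" and "0 \<le> T"
  shows "\<phi> T \<le> \<phi> 0 * exp (K * T)"
proof -
  define \<psi> where "\<psi> t = \<phi> t * exp (- (K * t))" for t
  have \<psi>D: "(\<psi> has_real_derivative (\<phi>' t - K * \<phi> t) * exp (- (K * t))) (at t within {0..T})" if "t \<in> {0..T}" for t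
    unfolding \<psi>_def using D[OF that]
    by (auto intro!: derivative_eq_intros simp: algebra_simps simp flip:
        has_real_derivative_iff_has_vector_derivative)
  have "\<psi> 0 \<ge> \<psi> T"
  proof (rule DERIV_nonpos_imp_decreasing_open[OF \<open>0 \<le> T\<close>])
    show "continuous_on {0..T} \<psi>"
      by (rule DERIV_continuous_on[OF \<psi>D])
    fix t assume t: "0 < t" "t < T"
    then have "(\<psi> has_real_derivative (\<phi>' t - K * \<phi> t) * exp (- (K * t))) (at t)"
      using \<psi>D[of t] by (simp add: at_within_Icc_at)
    moreover have "(\<phi>' t - K * \<phi> t) * exp (- (K * t)) \<le> 0"
      using le[of t] t by (simp add: mult_nonpos_nonneg)
    ultimately show "\<exists>y. (\<psi> has_real_derivative y) (at t) \<and> y \<le> 0" by blast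
  qed
  then have "\<phi> T * exp (- (K * T)) * exp (K * T) \<le> \<phi> 0 * exp (K * T)"
    by (intro mult_right_mono) (simp_all add: \<psi>_def)
  then show ?thesis by (simp add: mult.assoc flip: exp_add)
qed

text \<open>
  The weight \<open>exp (- c t)\<close> with \<open>c > L\<close> makes the Picard operator a contraction on all of
  \<open>{0..T}\<close>; the unknown of the fixed-point problem is \<open>exp (- c t) y t\<close>.
\<close>

lemma Picard_global:
  fixes f :: "'a::banach \<Rightarrow> 'a"
  assumes L: "L-lipschitz_on UNIV f" and T: "0 \<le> T"
  obtains y where "y 0 = y0" "\<And>t. t \<in> {0..T} \<Longrightarrow> (y has_vector_derivative f (y t)) (at t within {0..T})"
proof -
  define c where "c = L + 1"
  have L0: "0 \<le> L" using L by (rule lipschitz_on_nonneg)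
  then have c0: "c > 0" by (simp add: c_def)
  have fc: "continuous_on UNIV f" by (rule lipschitz_on_continuous_on[OF L])
  \<comment> \<open>With z = exp(-c t) y the argument of \<open>f\<close> is \<open>y s\<close>, so
    \<open>G z\<close> is the weighted Picard integral of y.\<close>
  define G where "G z t = exp (- (c * t)) *\<^sub>R (y0 + integral {0..t} (\<lambda>s. f (exp (c * s) *\<^sub>R apply_bcontfun z s)))"
    for z :: "real \<Rightarrow>\<^sub>C 'a" and t
  have zc: "continuous_on S (\<lambda>s. f (exp (c * s) *\<^sub>R apply_bcontfun z s))" for S and z :: "real \<Rightarrow>\<^sub>C 'a"
    by (intro continuous_on_compose2[OF fc] continuous_intros) auto
  have Gc: "continuous_on (cbox 0 T) (G z)" for z
    unfolding G_def cbox_interval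
    by (intro continuous_intros indefinite_integral_continuous_1 integrable_continuous_real zc)
  \<comment> \<open>Clamping the time extends \<open>G z\<close> from the interval to a bounded
    continuous function on the whole line, so that the fixed point is sought in a complete
    space.\<close>
  have "\<exists>g. \<forall>t. apply_bcontfun g t = G z (clamp 0 T t)" for z
    using continuous_on_cbox_bcontfunE[OF Gc[of z]] by metis
  then obtain \<Phi> where \<Phi>: "\<And>z t. apply_bcontfun (\<Phi> z) t = G z (clamp 0 T t)" by metis
  have clamp: "clamp 0 T t \<in> {0..T}" for t :: real
    using T clamp_in_interval[of 0 T t] by simp
  have exp_int: "integral {0..t} (\<lambda>s. exp (c * s)) = (exp (c * t) - 1) / c" if "0 \<le> t" for t
  proof -
    have "((\<lambda>s. exp (c * s)) has_integral exp (c * t) / c - exp (c * 0) / c) {0..t}"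
      using c0 by (intro fundamental_theorem_of_calculus that)
        (auto intro!: derivative_eq_intros simp flip: has_real_derivative_iff_has_vector_derivative)
    then show ?thesis by (simp add: integral_unique diff_divide_distrib)
  qed
  \<comment> \<open>The integral of exp(c s) over {0..t} is at most exp(c t)/c; the weight exp(-c t)
    cancels the growth and leaves L/c.\<close>
  have dG: "dist (G z t) (G w t) \<le> L / c * dist z w" if t: "t \<in> {0..T}" for z w t
  proof -
    have "norm (integral {0..t} (\<lambda>s. f (exp (c * s) *\<^sub>R apply_bcontfun z s)
        - f (exp (c * s) *\<^sub>R apply_bcontfun w s)))
       \<le> integral {0..t} (\<lambda>s. L * dist z w * exp (c * s))"
    proof (rule integral_norm_bound_integral)
      fix s
      have "dist (f (exp (c * s) *\<^sub>R apply_bcontfun z s)) (f (exp (c * s) *\<^sub>R apply_bcontfun w s))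
          \<le> L * dist (exp (c * s) *\<^sub>R apply_bcontfun z s) (exp (c * s) *\<^sub>R apply_bcontfun w s)"
        by (rule lipschitz_onD[OF L]) auto
      also have "\<dots> = L * (exp (c * s) * dist (apply_bcontfun z s) (apply_bcontfun w s))"
        by (simp add: dist_norm flip: scaleR_diff_right)
      also have "\<dots> \<le> L * (exp (c * s) * dist z w)"
        using L0 by (intro mult_left_mono dist_bounded) auto
      finally show "norm (f (exp (c * s) *\<^sub>R apply_bcontfun z s)
          - f (exp (c * s) *\<^sub>R apply_bcontfun w s)) \<le> L * dist z w * exp (c * s)"
        by (simp add: dist_norm mult_ac)
    qed (intro integrable_continuous_real continuous_intros zc)+
    also have "\<dots> = L * dist z w * ((exp (c * t) - 1) / c)"
      using t exp_int[of t] by simp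
    also have "\<dots> \<le> L * dist z w * (exp (c * t) / c)"
      using L0 c0 by (intro mult_left_mono divide_right_mono) auto
    finally have *: "norm (integral {0..t} (\<lambda>s. f (exp (c * s) *\<^sub>R apply_bcontfun z s)
        - f (exp (c * s) *\<^sub>R apply_bcontfun w s)))
       \<le> L * dist z w * (exp (c * t) / c)" .
    have "G z t - G w t = exp (- (c * t)) *\<^sub>R integral {0..t} (\<lambda>s. f (exp (c * s) *\<^sub>R apply_bcontfun z s)
        - f (exp (c * s) *\<^sub>R apply_bcontfun w s))"
      unfolding G_def
      by (subst integral_diff) (intro integrable_continuous_real zc | simp add: scaleR_diff_right scaleR_add_right)+
    then have "dist (G z t) (G w t) \<le> exp (- (c * t)) * (L * dist z w * (exp (c * t) / c))"
      using mult_left_mono[OF *, of "exp (- (c * t))"] by (simp add: dist_norm)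
    also have "\<dots> = L / c * dist z w"
      using c0 by (simp add: exp_minus field_simps)
    finally show ?thesis .
  qed
  have "dist (\<Phi> z) (\<Phi> w) \<le> L / c * dist z w" for z w
    by (rule dist_bound) (simp only: \<Phi> dG clamp)
  moreover have "L / c < 1" "0 \<le> L / c" using L0 by (auto simp: c_def field_simps)
  ultimately obtain z where z: "\<Phi> z = z"
    using banach_fix_type[of "L / c" \<Phi>] by auto
  define y where "y t = y0 + integral {0..t} (\<lambda>s. f (exp (c * s) *\<^sub>R apply_bcontfun z s))" for t
  have yz: "exp (c * t) *\<^sub>R apply_bcontfun z t = y t" if t: "t \<in> {0..T}" for t
  proof -
    have "clamp 0 T t = t" using t by (intro clamp_cancel_cbox) simp
    then have "apply_bcontfun z t = G z t" using \<Phi>[of z t] z by simp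
    then show ?thesis unfolding G_def y_def by (simp flip: exp_add)
  qed
  show ?thesis
  proof (rule that[of y])
    show "y 0 = y0" by (simp add: y_def)
    fix t assume t: "t \<in> {0..T}"
    have "((\<lambda>t. integral {0..t} (\<lambda>s. f (exp (c * s) *\<^sub>R apply_bcontfun z s))) has_vector_derivative
        f (exp (c * t) *\<^sub>R apply_bcontfun z t)) (at t within {0..T})"
      by (rule integral_has_vector_derivative[OF zc t])
    then show "(y has_vector_derivative f (y t)) (at t within {0..T})"
      unfolding y_def[abs_def] yz[OF t] by (auto intro!: derivative_eq_intros simp: y_def)
  qed
qed

text \<open>The state space of \<open>Picard_coordinates\<close> has to be of the class that
  \<open>Picard_global\<close> asks for.\<close>

instance bcontfun :: (metric_space, banach) banach ..

lemma bounded_linear_apply_bcontfun: "bounded_linear (\<lambda>z. apply_bcontfun z k)"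
  by (rule bounded_linear_intro[of _ 1]) (auto simp: plus_bcontfun.rep_eq scaleR_bcontfun.rep_eq norm_bounded)

text \<open>The number of coordinates varies with N, so the state is placed in one fixed Banach
  space: bounded functions on the index type with its discrete topology, where continuity is
  automatic. \<open>R\<close> cuts a family down to \<open>K\<close>, which makes it bounded, and
  \<open>E\<close> reads it back.\<close>

lemma Picard_coordinates:
  fixes F :: "('i \<Rightarrow> 'b::banach) \<Rightarrow> 'i \<Rightarrow> 'b"
  assumes K: "finite K" and L: "0 \<le> L"
    and lip: "\<And>y z k. k \<in> K \<Longrightarrow> norm (F y k - F z k) \<le> L * (\<Sum>j\<in>K. norm (y j - z j))"
    and T: "0 \<le> T"
  obtains y where "\<And>k. k \<in> K \<Longrightarrow> y 0 k = y0 k"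
    "\<And>t k. t \<in> {0..T} \<Longrightarrow> k \<in> K \<Longrightarrow> ((\<lambda>s. y s k) has_vector_derivative F (y t) k) (at t within {0..T})"
proof -
  define R where "R v = Bcontfun (\<lambda>d. if of_discrete d \<in> K then v (of_discrete d) else 0)" for v :: "'i \<Rightarrow> 'b"
  define E where "E z k = apply_bcontfun z (discrete k)" for z :: "'i discrete \<Rightarrow>\<^sub>C 'b" and k
  have R: "apply_bcontfun (R v) = (\<lambda>d. if of_discrete d \<in> K then v (of_discrete d) else 0)" for v
    unfolding R_def
  proof (rule Bcontfun_inverse, rule bcontfun_normI)
    show "norm (if of_discrete d \<in> K then v (of_discrete d) else 0) \<le> (\<Sum>j\<in>K. norm (v j))" for d
      using K by (auto intro: member_le_sum sum_nonneg)
    show "continuous_on UNIV (\<lambda>d. if of_discrete d \<in> K then v (of_discrete d) else 0)"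
      by (simp add: continuous_on_open_vimage open_discrete)
  qed
  have ER: "E (R v) k = (if k \<in> K then v k else 0)" for v k
    by (simp add: E_def R discrete_inverse)
  \<comment> \<open>Each summand over \<open>K\<close> is at most the sup distance, hence the factor
    \<open>card K\<close>.\<close>
  have lip': "(L * card K)-lipschitz_on UNIV (\<lambda>z. R (F (E z)))"
  proof (rule lipschitz_onI)
    fix z w :: "'i discrete \<Rightarrow>\<^sub>C 'b"
    show "dist (R (F (E z))) (R (F (E w))) \<le> L * card K * dist z w"
    proof (rule dist_bound)
      fix d :: "'i discrete"
      define k where "k = of_discrete d"
      have "(\<Sum>j\<in>K. norm (E z j - E w j)) \<le> (\<Sum>j\<in>K. dist z w)"
        using dist_bounded[of z _ w] unfolding E_def by (intro sum_mono) (simp only: dist_norm)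
      from mult_left_mono[OF this L]
      show "dist (apply_bcontfun (R (F (E z))) d) (apply_bcontfun (R (F (E w))) d) \<le> L * card K * dist z w"
        using L lip[of k "E z" "E w"] unfolding R
        by (cases "k \<in> K") (simp_all add: dist_norm mult.assoc flip: k_def)
    qed
  qed (use L in simp)
  obtain y where y: "y 0 = R y0" "\<And>t. t \<in> {0..T} \<Longrightarrow> (y has_vector_derivative R (F (E (y t)))) (at t within {0..T})"
    by (rule Picard_global[OF lip' T, where ?y0.0 = "R y0"]) blast
  show ?thesis
  proof (rule that[of "\<lambda>t. E (y t)"])
    fix t k assume t: "t \<in> {0..T}" and k: "k \<in> K"
    have "((\<lambda>s. E (y s) k) has_vector_derivative E (R (F (E (y t)))) k) (at t within {0..T})"
      unfolding E_def[of _ k] by (rule bounded_linear.has_vector_derivative[OF bounded_linear_apply_bcontfun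
          y(2)[OF t]])
    then show "((\<lambda>s. E (y s) k) has_vector_derivative F (E (y t)) k) (at t within {0..T})"
      using k by (simp add: ER)
  qed (simp add: y(1) ER)
qed

text \<open>Gronwall for the sum of squared distances, which starts at 0; passing from the squared
  sum of distances to the sum of squares costs a factor \<open>card K\<close> by
  Cauchy-Schwarz.\<close>

lemma ode_coordinates_unique:
  fixes F :: "('i \<Rightarrow> 'b::euclidean_space) \<Rightarrow> 'i \<Rightarrow> 'b"
  assumes K: "finite K" and L: "0 \<le> L"
    and lip: "\<And>y z k. k \<in> K \<Longrightarrow> norm (F y k - F z k) \<le> L * (\<Sum>j\<in>K. norm (y j - z j))"
    and y: "\<And>t k. t \<in> {0..T} \<Longrightarrow> k \<in> K \<Longrightarrow> ((\<lambda>s. y s k) has_vector_derivative F (y t) k) (at t within {0..T})"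
    and z: "\<And>t k. t \<in> {0..T} \<Longrightarrow> k \<in> K \<Longrightarrow> ((\<lambda>s. z s k) has_vector_derivative F (z t) k) (at t within {0..T})"
    and init: "\<And>k. k \<in> K \<Longrightarrow> y 0 k = z 0 k" and t: "t \<in> {0..T}" "k \<in> K"
  shows "y t k = z t k"
proof -
  define \<phi> where "\<phi> t = (\<Sum>k\<in>K. (y t k - z t k) \<bullet> (y t k - z t k))" for t
  define \<phi>' where "\<phi>' t = (\<Sum>k\<in>K. 2 * ((y t k - z t k) \<bullet> (F (y t) k - F (z t) k)))" for t
  have D: "(\<phi> has_vector_derivative \<phi>' s) (at s within {0..t})" if s: "s \<in> {0..t}" for s
  proof -
    have "((\<lambda>s. (y s k - z s k) \<bullet> (y s k - z s k)) has_vector_derivative 2 * ((y s k - z s k) \<bullet> (F (y s) k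
        - F (z s) k))) (at s within {0..t})"
      if "k \<in> K" for k
    proof -
      have "((\<lambda>s. y s k - z s k) has_vector_derivative F (y s) k - F (z s) k) (at s within {0..t})"
        using s t that by (intro has_vector_derivative_diff has_vector_derivative_within_subset[OF y]
            has_vector_derivative_within_subset[OF z]) auto
      from bounded_bilinear.has_vector_derivative[OF bounded_bilinear_inner this this] show ?thesis
        by (simp add: inner_commute)
    qed
    then show ?thesis unfolding \<phi>_def \<phi>'_def by (intro has_vector_derivative_sum)
  qed
  have le: "\<phi>' s \<le> 2 * (L * card K) * \<phi> s" for s
  proof -
    let ?n = "\<lambda>k. norm (y s k - z s k)"
    have "\<phi>' s \<le> (\<Sum>k\<in>K. 2 * (?n k * (L * (\<Sum>j\<in>K. ?n j))))"
      unfolding \<phi>'_def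
    proof (intro sum_mono mult_left_mono)
      fix k assume "k \<in> K"
      have "(y s k - z s k) \<bullet> (F (y s) k - F (z s) k) \<le> ?n k * norm (F (y s) k - F (z s) k)"
        by (rule norm_cauchy_schwarz)
      also have "\<dots> \<le> ?n k * (L * (\<Sum>j\<in>K. ?n j))"
        by (intro mult_left_mono lip \<open>k \<in> K\<close>) auto
      finally show "(y s k - z s k) \<bullet> (F (y s) k - F (z s) k) \<le> ?n k * (L * (\<Sum>j\<in>K. ?n j))" .
    qed simp
    also have "\<dots> = 2 * L * (\<Sum>k\<in>K. ?n k)\<^sup>2"
      by (simp add: power2_eq_square sum_distrib_left sum_distrib_right mult_ac)
    also have "\<dots> \<le> 2 * L * ((\<Sum>k\<in>K. (?n k)\<^sup>2) * card K)"
      using L by (intro mult_left_mono sum_squared_le_sum_of_squares) auto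
    also have "\<dots> = 2 * (L * card K) * \<phi> s"
      by (simp add: \<phi>_def power2_norm_eq_inner)
    finally show ?thesis .
  qed
  have "\<phi> t \<le> \<phi> 0 * exp (2 * (L * card K) * t)"
    by (rule Gronwall[OF D le]) (use t in auto)
  also have "\<phi> 0 = 0" using init by (simp add: \<phi>_def)
  finally have "\<phi> t \<le> 0" by simp
  moreover have "(y t k - z t k) \<bullet> (y t k - z t k) \<le> \<phi> t"
    unfolding \<phi>_def using K t by (intro member_le_sum) auto
  ultimately have "(y t k - z t k) \<bullet> (y t k - z t k) = 0"
    using inner_ge_zero[of "y t k - z t k"] by linarith
  then show ?thesis by simp
qed

section \<open>Sobolev bounds on Fourier coefficients\<close>

lemma summable_on_int_if_nat:
  fixes f :: "int \<Rightarrow> real"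
  assumes nn: "\<And>k. 0 \<le> f k" and "summable (\<lambda>n. f (int n))" "summable (\<lambda>n. f (- int n))"
  shows "f summable_on UNIV"
proof -
  have 1: "(f \<circ> int) summable_on UNIV"
    using assms by (intro summable_nonneg_imp_summable_on) (auto simp: o_def)
  have 2: "(f \<circ> (\<lambda>n. - int n)) summable_on UNIV"
    using assms by (intro summable_nonneg_imp_summable_on) (auto simp: o_def)
  have "f summable_on range int"
    using 1 by (subst summable_on_reindex) auto
  moreover have "f summable_on range (\<lambda>n. - int n)"
    using 2 by (subst summable_on_reindex) (auto simp: inj_def)
  moreover have "(UNIV :: int set) = range int \<union> range (\<lambda>n. - int n)"
    using int_cases2 by blast
  ultimately show ?thesis
    using summable_on_union by metis
qed

abbreviation wt :: "int \<Rightarrow> real" where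
  "wt k \<equiv> 1 + (real_of_int k)\<^sup>2"

text \<open>Comparison with n^(-2s). It is used with s = \<mu> - 1, which exceeds 1/2 because \<mu>
  > 3/2, and with s = 1 for the squares of \<open>j_symbol\<close>.\<close>

lemma summable_weight:
  assumes "s > 1 / 2"
  shows "(\<lambda>k::int. wt k powr (- s)) summable_on UNIV"
proof -
  have "summable (\<lambda>n. (1 + (real n)\<^sup>2) powr (- s))"
  proof (rule summable_comparison_test')
    show "summable (\<lambda>n. real n powr (- (2 * s)))"
      using assms by (simp add: summable_real_powr_iff)
    fix n :: nat assume n: "n \<ge> 1"
    have "(1 + (real n)\<^sup>2) powr (- s) \<le> ((real n)\<^sup>2) powr (- s)"
      using assms n by (intro powr_mono2') auto
    also have "\<dots> = real n powr (- (2 * s))"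
      using n by (simp add: powr_powr flip: powr_numeral)
    finally show "norm ((1 + (real n)\<^sup>2) powr (- s)) \<le> real n powr (- (2 * s))" by simp
  qed
  then show ?thesis by (intro summable_on_int_if_nat) simp_all
qed

text \<open>\<open>R\<close> bounds the square of the norm. Summability is demanded separately,
  since \<open>infsum\<close> of a non-summable family is 0 and would meet every nonnegative
  bound.\<close>

definition sob_bd :: "real \<Rightarrow> real \<Rightarrow> (int \<Rightarrow> complex) \<Rightarrow> bool" where
  "sob_bd \<mu> R c \<longleftrightarrow> (\<lambda>k. wt k powr \<mu> * (cmod (c k))\<^sup>2) summable_on UNIV \<and>
     (\<Sum>\<^sub>\<infinity>k. wt k powr \<mu> * (cmod (c k))\<^sup>2) \<le> R"

text \<open>A common bound for the sums of |c k| and of |2 pi k c k| under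
  \<open>sob_bd \<mu> R c\<close>: it is 2 pi times the right-hand side of
  \<open>sob_bd_weight_le\<close>, summed over k.\<close>

definition sup_const :: "real \<Rightarrow> real \<Rightarrow> real" where
  "sup_const \<mu> R = pi * (R + (\<Sum>\<^sub>\<infinity>k. wt k powr (1 - \<mu>)))"

text \<open>Write sqrt w as w^(\<mu>/2) w^((1-\<mu>)/2) and use 2ab \<le> a^2 + b^2. Unlike
  Cauchy-Schwarz for the whole series this is a majorant for each k, so it also yields
  summability.\<close>

lemma sob_bd_weight_le:
  fixes k :: int and z :: complex
  shows "sqrt (wt k) * cmod z \<le>
    (wt k powr \<mu> * (cmod z)\<^sup>2 + wt k powr (1 - \<mu>)) / 2"
proof -
  define w where "w = wt k"
  have w: "w > 0" unfolding w_def by (simp add: add_pos_nonneg)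
  define a where "a = w powr (\<mu> / 2) * cmod z"
  define b where "b = w powr ((1 - \<mu>) / 2)"
  have ab: "a * b = sqrt w * cmod z"
    using w unfolding a_def b_def
    by (simp add: powr_half_sqrt [symmetric] mult.assoc mult.left_commute[of "cmod z"] flip: powr_add) (simp
        add: field_simps)
  have sq: "a\<^sup>2 = w powr \<mu> * (cmod z)\<^sup>2" "b\<^sup>2 = w powr (1 - \<mu>)"
    using w unfolding a_def b_def by (simp_all add: power2_eq_square mult_ac flip: powr_add)
  have "2 * (a * b) \<le> a\<^sup>2 + b\<^sup>2"
    using sum_squares_bound[of a b] by (simp add: mult.assoc)
  then show ?thesis unfolding ab sq w_def [symmetric] by simp
qed

lemma norm_fdiff: "cmod (fdiff c k) = 2 * pi * (\<bar>real_of_int k\<bar> * cmod (c k))"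
  by (simp add: fdiff_def norm_mult)

lemma sob_bd_abs_summable:
  assumes "sob_bd \<mu> R c" and \<mu>: "\<mu> > 3 / 2"
  shows "(\<lambda>k. cmod (c k)) summable_on UNIV" "(\<Sum>\<^sub>\<infinity>k. cmod (c k)) \<le> sup_const \<mu> R"
    "(\<lambda>k. cmod (fdiff c k)) summable_on UNIV" "(\<Sum>\<^sub>\<infinity>k. cmod (fdiff c k)) \<le> sup_const \<mu> R"
proof -
  define f where "f k = pi * (wt k powr \<mu> * (cmod (c k))\<^sup>2 + wt k powr (1 - \<mu>))" for k
  have s1: "(\<lambda>k. wt k powr \<mu> * (cmod (c k))\<^sup>2) summable_on UNIV"
    using assms by (simp add: sob_bd_def)
  have s2: "(\<lambda>k::int. wt k powr (1 - \<mu>)) summable_on UNIV"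
    using summable_weight[of "\<mu> - 1"] \<mu> by simp
  have fs: "f summable_on UNIV"
    unfolding f_def by (intro summable_on_cmult_right summable_on_add s1 s2)
  have fi: "infsum f UNIV \<le> sup_const \<mu> R"
    using assms(1) unfolding f_def sup_const_def sob_bd_def
    by (simp add: infsum_cmult_right' infsum_add s1 s2)
  have b: "2 * pi * (sqrt (wt k) * cmod (c k)) \<le> f k" for k
    using mult_left_mono[OF sob_bd_weight_le[of k "c k" \<mu>], of "2 * pi"] unfolding f_def by (simp add: mult.assoc)
  have 1: "cmod (c k) \<le> f k" for k
  proof -
    have "cmod (c k) \<le> sqrt (wt k) * cmod (c k)"
      by (simp add: mult_le_cancel_right1)
    also have "\<dots> \<le> 2 * pi * \<dots>"
      using pi_ge_two mult_right_mono[of 1 "2 * pi" "sqrt (wt k) * cmod (c k)"] by simp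
    finally show ?thesis using b[of k] by simp
  qed
  have 2: "cmod (fdiff c k) \<le> f k" for k
  proof -
    have "cmod (fdiff c k) \<le> 2 * pi * (sqrt (wt k) * cmod (c k))"
      unfolding norm_fdiff by (intro mult_left_mono mult_right_mono real_le_rsqrt) auto
    then show ?thesis using b[of k] by simp
  qed
  show 3: "(\<lambda>k. cmod (c k)) summable_on UNIV"
    by (rule summable_on_comparison_test[OF fs]) (use 1 in auto)
  show 4: "(\<lambda>k. cmod (fdiff c k)) summable_on UNIV"
    by (rule summable_on_comparison_test[OF fs]) (use 2 in auto)
  show "(\<Sum>\<^sub>\<infinity>k. cmod (c k)) \<le> sup_const \<mu> R"
    using infsum_mono[OF 3 fs 1] fi by simp
  show "(\<Sum>\<^sub>\<infinity>k. cmod (fdiff c k)) \<le> sup_const \<mu> R"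
    using infsum_mono[OF 4 fs 2] fi by simp
qed

text \<open>For |k| > N the factor wt^(1-\<mu>) is at most N^(2-2\<mu>), the exponent 1-\<mu> being
  negative. One power of the weight stays on the left because the tail of the derivative is needed;
  this is the source of the convergence rate.\<close>

lemma sob_bd_tail:
  assumes c: "sob_bd \<mu> R c" and \<mu>: "\<mu> > 3 / 2" and N: "N \<ge> 1"
    and F: "finite F" "\<And>k. k \<in> F \<Longrightarrow> \<bar>k\<bar> > int N"
  shows "(\<Sum>k\<in>F. wt k * (cmod (c k))\<^sup>2) \<le> real N powr (2 - 2 * \<mu>) * R"
proof -
  have "(\<Sum>k\<in>F. wt k * (cmod (c k))\<^sup>2) \<le>
      (\<Sum>k\<in>F. real N powr (2 - 2 * \<mu>) * (wt k powr \<mu> * (cmod (c k))\<^sup>2))"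
  proof (rule sum_mono)
    fix k assume "k \<in> F"
    then have "real N \<le> \<bar>real_of_int k\<bar>" using F(2)[of k] by linarith
    then have "(real N)\<^sup>2 \<le> (real_of_int k)\<^sup>2"
      by (metis abs_le_square_iff abs_of_nat)
    then have "wt k powr (1 - \<mu>) \<le> ((real N)\<^sup>2) powr (1 - \<mu>)"
      using N \<mu> by (intro powr_mono2') auto
    also have "\<dots> = real N powr (2 - 2 * \<mu>)"
      using N by (simp add: powr_powr algebra_simps flip: powr_numeral)
    finally have le: "wt k powr (1 - \<mu>) \<le> real N powr (2 - 2 * \<mu>)" .
    have pos: "wt k > 0" by (simp add: add_pos_nonneg)
    have "wt k = wt k powr (1 - \<mu>) * wt k powr \<mu>"
      using pos by (simp flip: powr_add)
    also have "\<dots> \<le> real N powr (2 - 2 * \<mu>) * wt k powr \<mu>"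
      by (intro mult_right_mono le) simp
    finally show "wt k * (cmod (c k))\<^sup>2 \<le>
        real N powr (2 - 2 * \<mu>) * (wt k powr \<mu> * (cmod (c k))\<^sup>2)"
      unfolding mult.assoc [symmetric] by (intro mult_right_mono) auto
  qed
  also have "\<dots> = real N powr (2 - 2 * \<mu>) * (\<Sum>k\<in>F. wt k powr \<mu> * (cmod (c k))\<^sup>2)"
    by (simp add: sum_distrib_left)
  also have "\<dots> \<le> real N powr (2 - 2 * \<mu>) * R"
  proof (intro mult_left_mono)
    have "(\<Sum>k\<in>F. wt k powr \<mu> * (cmod (c k))\<^sup>2) \<le> (\<Sum>\<^sub>\<infinity>k. wt k powr \<mu> * (cmod (c k))\<^sup>2)"
      using c F by (intro finite_sum_le_infsum) (auto simp: sob_bd_def)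
    then show "(\<Sum>k\<in>F. wt k powr \<mu> * (cmod (c k))\<^sup>2) \<le> R"
      using c unfolding sob_bd_def by linarith
  qed simp
  finally show ?thesis .
qed

text \<open>Everywhere differentiability makes \<open>v\<close> equal to its Fourier series at each
  point and not only almost everywhere; for the exact solution one \<open>R\<close> will serve all
  times.\<close>

definition reg :: "real \<Rightarrow> real \<Rightarrow> (real \<Rightarrow> complex) \<Rightarrow> bool" where
  "reg \<mu> R v \<longleftrightarrow> periodic1 v \<and> (\<forall>x. v differentiable (at x)) \<and> sob_bd \<mu> R (fourier_coeff v)"

section \<open>Sup and tail bounds from a Sobolev bound\<close>

context
  fixes \<mu> R :: real and v :: "real \<Rightarrow> complex"
  assumes \<mu>: "\<mu> > 3 / 2" and v: "reg \<mu> R v"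
begin

lemma reg_fser: "fser (fourier_coeff v) = v"
  and reg_deriv: "(v has_vector_derivative fser (fdiff (fourier_coeff v)) x) (at x)"
  and reg_dx: "dx v = fser (fdiff (fourier_coeff v))"
proof -
  have sb: "sob_bd \<mu> R (fourier_coeff v)" using v by (simp add: reg_def)
  note s = sob_bd_abs_summable[OF sb \<mu>]
  show 1: "fser (fourier_coeff v) = v"
    using v by (intro fser_fourier_coeff s) (auto simp: reg_def)
  show 2: "(v has_vector_derivative fser (fdiff (fourier_coeff v)) x) (at x)" for x
    using has_vector_derivative_fser[OF s(1,3), of x] by (simp only: 1)
  show "dx v = fser (fdiff (fourier_coeff v))"
    by (rule ext) (simp add: dx_def vector_derivative_at[OF 2])
qed

lemma reg_dx_deriv: "(v has_vector_derivative dx v x) (at x)"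
  using reg_deriv by (simp add: reg_dx)

lemma reg_continuous: "continuous_on S v" "continuous_on S (dx v)"
proof -
  have sb: "sob_bd \<mu> R (fourier_coeff v)" using v by (simp add: reg_def)
  note s = sob_bd_abs_summable[OF sb \<mu>]
  show "continuous_on S v" using continuous_on_fser[OF s(1)] by (simp add: reg_fser)
  show "continuous_on S (dx v)" using continuous_on_fser[OF s(3)] by (simp add: reg_dx)
qed

lemma reg_sup:
  "cmod (v x) \<le> sup_const \<mu> R" "cmod (dx v x) \<le> sup_const \<mu> R"
  "cmod (trig N (fourier_coeff v) x) \<le> sup_const \<mu> R" "cmod (trig N (fdiff (fourier_coeff v)) x) \<le> sup_const \<mu> R"
proof -
  have sb: "sob_bd \<mu> R (fourier_coeff v)" using v by (simp add: reg_def)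
  note s = sob_bd_abs_summable[OF sb \<mu>]
  show "cmod (v x) \<le> sup_const \<mu> R" using cmod_fser_le(1)[OF s(1), of x] s(2) by (simp add: reg_fser)
  show "cmod (dx v x) \<le> sup_const \<mu> R" using cmod_fser_le(1)[OF s(3), of x] s(4) by (simp add: reg_dx)
  show "cmod (trig N (fourier_coeff v) x) \<le> sup_const \<mu> R" using cmod_fser_le(2)[OF s(1), of N x] s(2) by simp
  show "cmod (trig N (fdiff (fourier_coeff v)) x) \<le> sup_const \<mu> R"
      using cmod_fser_le(2)[OF s(3), of N x] s(4) by simp
qed

text \<open>The factor 4 pi^2 is the square of the 2 pi in \<open>fdiff\<close>; as it is at least
  1, the same bound serves for the function itself.\<close>

lemma reg_tail:
  assumes N: "N \<ge> 1"
  shows "l2sq (\<lambda>x. v x - trig N (fourier_coeff v) x) \<le> 4 * pi\<^sup>2 * R * real N powr (2 - 2 * \<mu>)"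
    "l2sq (\<lambda>x. dx v x - trig N (fdiff (fourier_coeff v)) x) \<le> 4 * pi\<^sup>2 * R * real N powr (2 - 2 * \<mu>)"
proof -
  let ?c = "fourier_coeff v"
  have sb: "sob_bd \<mu> R ?c" using v by (simp add: reg_def)
  note s = sob_bd_abs_summable[OF sb \<mu>]
  have pi1: "1 \<le> 4 * pi\<^sup>2" using pi_ge_two power_mono[of 2 pi 2] by simp
  have t: "4 * pi\<^sup>2 * (\<Sum>k\<in>F. wt k * (cmod (?c k))\<^sup>2) \<le> 4 * pi\<^sup>2 * R * real N powr (2 - 2 * \<mu>)"
    if "finite F" "\<And>k. k \<in> F \<Longrightarrow> \<bar>k\<bar> > int N" for F
    using mult_left_mono[OF sob_bd_tail[OF sb \<mu> N that], of "4 * pi\<^sup>2"] by (simp add: mult_ac)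
  have "l2sq (\<lambda>x. fser ?c x - trig N ?c x) \<le> 4 * pi\<^sup>2 * R * real N powr (2 - 2 * \<mu>)"
  proof (rule l2sq_fser_tail_le[OF s(1)])
    fix F :: "int set" assume F: "finite F" "\<And>k. k \<in> F \<Longrightarrow> \<bar>k\<bar> > int N"
    have "(cmod (?c k))\<^sup>2 \<le> 4 * pi\<^sup>2 * (wt k * (cmod (?c k))\<^sup>2)" for k
      using mult_mono[OF pi1, of 1 "wt k"] mult_right_mono[of 1 "4 * pi\<^sup>2 * wt k" "(cmod (?c k))\<^sup>2"]
      by (simp add: mult.assoc)
    then have "(\<Sum>k\<in>F. (cmod (?c k))\<^sup>2) \<le> 4 * pi\<^sup>2 * (\<Sum>k\<in>F. wt k * (cmod (?c k))\<^sup>2)"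
      unfolding sum_distrib_left by (intro sum_mono)
    with t[OF F] show "(\<Sum>k\<in>F. (cmod (?c k))\<^sup>2) \<le> 4 * pi\<^sup>2 * R * real N powr (2 - 2 * \<mu>)" by linarith
  qed
  then show "l2sq (\<lambda>x. v x - trig N (fourier_coeff v) x) \<le> 4 * pi\<^sup>2 * R * real N powr (2 - 2 * \<mu>)"
    by (simp only: reg_fser)
  have "l2sq (\<lambda>x. fser (fdiff ?c) x - trig N (fdiff ?c) x) \<le> 4 * pi\<^sup>2 * R * real N powr (2 - 2 * \<mu>)"
  proof (rule l2sq_fser_tail_le[OF s(3)])
    fix F :: "int set" assume F: "finite F" "\<And>k. k \<in> F \<Longrightarrow> \<bar>k\<bar> > int N"
    have "(cmod (fdiff ?c k))\<^sup>2 \<le> 4 * pi\<^sup>2 * (wt k * (cmod (?c k))\<^sup>2)" for k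
      unfolding norm_fdiff power_mult_distrib by (simp add: algebra_simps)
    then have "(\<Sum>k\<in>F. (cmod (fdiff ?c k))\<^sup>2) \<le> 4 * pi\<^sup>2 * (\<Sum>k\<in>F. wt k * (cmod (?c k))\<^sup>2)"
      unfolding sum_distrib_left by (intro sum_mono)
    with t[OF F] show "(\<Sum>k\<in>F. (cmod (fdiff ?c k))\<^sup>2) \<le> 4 * pi\<^sup>2 * R * real N powr (2 - 2 * \<mu>)" by linarith
  qed
  then show "l2sq (\<lambda>x. dx v x - trig N (fdiff (fourier_coeff v)) x) \<le> 4 * pi\<^sup>2 * R * real N powr (2 - 2 * \<mu>)"
    by (simp only: reg_dx)
qed

end

text \<open>Compactness of the time interval, through \<open>Bolzano\<close>: boundedness passes to
  the union of adjacent intervals, and near each t it follows from continuity by |a+b|^2 \<le>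
  2|a|^2 + 2|b|^2.\<close>

lemma cont_sobolev_bounded:
  assumes v: "v \<in> cont_sobolev T \<mu>" and c: "\<And>t. t \<in> {0..T} \<Longrightarrow> continuous_on {0..1} (v t)" and T: "0 \<le> T"
  shows "\<exists>R. \<forall>t\<in>{0..T}. sob_bd \<mu> R (fourier_coeff (v t))"
proof -
  define h where "h c k = wt k powr \<mu> * (cmod (c k))\<^sup>2" for c :: "int \<Rightarrow> complex" and k
  have hs: "h (fourier_coeff (v t)) summable_on UNIV" if "t \<in> {0..T}" for t
    using v that unfolding cont_sobolev_def sobolev_def h_def[abs_def] by blast
  have hdiff: "h (\<lambda>k. a k - b k) k \<le> 2 * h a k + 2 * h b k" for a b k
    unfolding h_def using mult_left_mono[OF cmod_add_square_le[of "a k" "- b k"], of "wt k powr \<mu>"]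
    by (simp add: algebra_simps)
  have h0: "0 \<le> h a k" for a k unfolding h_def by simp
  define P where "P a b \<longleftrightarrow> (\<exists>R. \<forall>t\<in>{a..b} \<inter> {0..T}. infsum (h (fourier_coeff (v t))) UNIV \<le> R)" for a b
  have "P 0 T"
  proof (rule Bolzano[OF T])
    fix a b c assume "P a b" "P b c"
    then obtain R1 R2 where "\<forall>t\<in>{a..b} \<inter> {0..T}. infsum (h (fourier_coeff (v t))) UNIV \<le> R1"
      "\<forall>t\<in>{b..c} \<inter> {0..T}. infsum (h (fourier_coeff (v t))) UNIV \<le> R2" unfolding P_def by blast
    then have "\<forall>t\<in>{a..c} \<inter> {0..T}. infsum (h (fourier_coeff (v t))) UNIV \<le> max R1 R2"
      by (metis IntE IntI atLeastAtMost_iff le_max_iff_disj linear)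
    then show "P a c" unfolding P_def by blast
  next
    fix t assume "0 \<le> t" "t \<le> T"
    then have t: "t \<in> {0..T}" by simp
    have "((\<lambda>s. sobolev_norm \<mu> (\<lambda>x. v s x - v t x)) \<longlongrightarrow> 0) (at t within {0..T})"
      using v t unfolding cont_sobolev_def by blast
    then have "\<forall>\<^sub>F s in at t within {0..T}. sobolev_norm \<mu> (\<lambda>x. v s x - v t x) < 1"
      by (rule order_tendstoD) simp
    then obtain d where d: "d > 0" "\<And>s. s \<in> {0..T} \<Longrightarrow> s \<noteq> t \<Longrightarrow> dist s t < d \<Longrightarrow> sobolev_norm \<mu> (\<lambda>x. v s x - v t x) < 1"
      unfolding eventually_at by blast
    let ?Ht = "infsum (h (fourier_coeff (v t))) UNIV"
    have Ht: "0 \<le> ?Ht" by (simp add: infsum_nonneg h0)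
    have loc: "infsum (h (fourier_coeff (v s))) UNIV \<le> 2 + 2 * ?Ht" if s: "s \<in> {0..T}" "dist s t < d" for s
    proof (cases "s = t")
      case True
      then show ?thesis using Ht by simp
    next
      case False
      define e where "e k = fourier_coeff (v s) k - fourier_coeff (v t) k" for k
      \<comment> \<open>Without summability the infinite sum in \<open>sobolev_norm\<close> would be
        0 by default, and the smallness of the norm would say nothing.\<close>
      have es: "h e summable_on UNIV"
      proof (rule summable_on_comparison_test)
        show "(\<lambda>k. 2 * h (fourier_coeff (v s)) k + 2 * h (fourier_coeff (v t)) k) summable_on UNIV"
          by (intro summable_on_add summable_on_cmult_right hs s t)
        show "h e k \<le> 2 * h (fourier_coeff (v s)) k + 2 * h (fourier_coeff (v t)) k" for k
          unfolding e_def by (rule hdiff)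
      qed (rule h0)
      have "fourier_coeff (\<lambda>x. v s x - v t x) = e"
        unfolding e_def by (rule ext) (rule fourier_coeff_diff[OF c[OF s(1)] c[OF t]])
      then have "sqrt (infsum (h e) UNIV) < 1"
        using d(2)[OF s(1) False s(2)] by (simp add: sobolev_norm_def h_def[abs_def])
      then have e1: "infsum (h e) UNIV < 1" by simp
      have "infsum (h (fourier_coeff (v s))) UNIV \<le> (\<Sum>\<^sub>\<infinity>k. 2 * h e k + 2 * h (fourier_coeff (v t)) k)"
      proof (rule infsum_mono[OF hs[OF s(1)]])
        show "(\<lambda>k. 2 * h e k + 2 * h (fourier_coeff (v t)) k) summable_on UNIV"
          by (intro summable_on_add summable_on_cmult_right hs t es)
        show "h (fourier_coeff (v s)) k \<le> 2 * h e k + 2 * h (fourier_coeff (v t)) k" for k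
          using hdiff[of e "\<lambda>k. - fourier_coeff (v t) k" k] by (simp add: e_def h_def)
      qed
      also have "\<dots> = 2 * infsum (h e) UNIV + 2 * ?Ht"
        by (subst infsum_add) (intro summable_on_cmult_right hs t es | simp add: infsum_cmult_right')+
      finally show ?thesis using e1 by linarith
    qed
    show "\<exists>d>0. \<forall>a b. a \<le> t \<and> t \<le> b \<and> b - a < d \<longrightarrow> P a b"
    proof (intro exI conjI allI impI)
      fix a b assume ab: "a \<le> t \<and> t \<le> b \<and> b - a < d"
      have "\<forall>s\<in>{a..b} \<inter> {0..T}. infsum (h (fourier_coeff (v s))) UNIV \<le> 2 + 2 * ?Ht"
        using ab by (intro ballI loc) (auto simp: dist_real_def)
      then show "P a b" unfolding P_def by blast
    qed (rule d(1))
  qed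
  then obtain R where "\<forall>t\<in>{0..T}. infsum (h (fourier_coeff (v t))) UNIV \<le> R" unfolding P_def by auto
  then show ?thesis
    using hs unfolding sob_bd_def h_def[abs_def] by blast
qed

section \<open>The exact solution in Fourier space\<close>

definition j_symbol :: "real \<Rightarrow> real \<Rightarrow> int \<Rightarrow> real" where
  "j_symbol \<gamma> \<alpha> k = 1 / (1 + \<alpha> / \<gamma> * \<bar>2 * pi * real_of_int k\<bar>)"

text \<open>Kept literally as in the equations, so that unfolding \<open>fourier_multiplier\<close>
  produces it; the form used in estimates is \<open>m_symbol_eq\<close>.\<close>

definition m_symbol :: "real \<Rightarrow> real \<Rightarrow> int \<Rightarrow> real" where
  "m_symbol \<gamma> \<alpha> k = 1 / (1 + \<alpha> / \<gamma> * \<bar>2 * pi * real_of_int k\<bar>) * (1 + (\<alpha>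
      - 1) / \<alpha> * (\<alpha> / \<gamma> * \<bar>2 * pi * real_of_int k\<bar>))"

text \<open>
  In the two right-hand sides, \<open>a\<close> and \<open>b\<close> are the coefficients of \<open>\<zeta>\<close> and \<open>u\<close>, while \<open>w\<close> and \<open>q\<close> are those of
  \<open>\<zeta> u\<close> and \<open>u\<^sup>2\<close>; this covers both the exact and the Galerkin solution.
\<close>

definition rhs1 :: "real \<Rightarrow> real \<Rightarrow> (int \<Rightarrow> complex) \<Rightarrow> (int \<Rightarrow> complex) \<Rightarrow> int \<Rightarrow> complex" where
  "rhs1 \<gamma> \<alpha> b w k = of_real (1 / \<gamma>) * (of_real (j_symbol \<gamma> \<alpha> k) * fdiff w k)
      - of_real (1 / \<gamma>) * (of_real (m_symbol \<gamma> \<alpha> k) * fdiff b k)"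

definition rhs2 :: "real \<Rightarrow> (int \<Rightarrow> complex) \<Rightarrow> (int \<Rightarrow> complex) \<Rightarrow> int \<Rightarrow> complex" where
  "rhs2 \<gamma> a q k = of_real (1 / (2 * \<gamma>)) * fdiff q k - of_real (1 - \<gamma>) * fdiff a k"

section \<open>Bounds for the two symbols\<close>

context
  fixes \<gamma> \<alpha> :: real
  assumes \<gamma>: "0 < \<gamma>" "\<gamma> < 1" and \<alpha>: "1 < \<alpha>"
begin

lemma j_symbol_pos: "0 < j_symbol \<gamma> \<alpha> k" and j_symbol_le_1: "j_symbol \<gamma> \<alpha> k \<le> 1"
proof -
  have "0 \<le> \<alpha> / \<gamma> * \<bar>2 * pi * real_of_int k\<bar>" using \<gamma> \<alpha> by simp
  then show "0 < j_symbol \<gamma> \<alpha> k" "j_symbol \<gamma> \<alpha> k \<le> 1"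
    unfolding j_symbol_def by (simp_all only: zero_less_divide_1_iff divide_le_eq_1_pos add_pos_nonneg
        zero_less_one)
qed

lemma m_symbol_eq: "m_symbol \<gamma> \<alpha> k = (\<alpha> - 1) / \<alpha> + j_symbol \<gamma> \<alpha> k / \<alpha>"
proof -
  define x where "x = \<alpha> / \<gamma> * \<bar>2 * pi * real_of_int k\<bar>"
  have "1 + x > 0" using \<gamma> \<alpha> by (auto simp: x_def intro!: add_pos_nonneg)
  then show ?thesis
    using \<alpha> unfolding m_symbol_def j_symbol_def x_def [symmetric]
        by (simp add: divide_simps) (simp add: algebra_simps)
qed

lemma m_symbol_ge: "(\<alpha> - 1) / \<alpha> \<le> m_symbol \<gamma> \<alpha> k" and m_symbol_le_1: "m_symbol \<gamma> \<alpha> k \<le> 1"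
  using \<alpha> j_symbol_pos[of k] j_symbol_le_1[of k] by (simp_all add: m_symbol_eq divide_simps)

lemma m_symbol_pos: "0 < m_symbol \<gamma> \<alpha> k"
  using \<alpha> by (intro less_le_trans[OF _ m_symbol_ge]) simp

text \<open>The symbol has order -1: |2 pi k| \<le> 1 + (\<alpha>/\<gamma>) |2 pi k|, where \<gamma>
  < 1 < \<alpha> makes the constant 1.\<close>

lemma j_symbol_fdiff_le: "j_symbol \<gamma> \<alpha> k * cmod (fdiff w k) \<le> cmod (w k)"
proof -
  define x where "x = \<bar>2 * pi * real_of_int k\<bar>"
  have "x \<le> 1 + \<alpha> / \<gamma> * x"
    using \<gamma> \<alpha> mult_right_mono[of 1 "\<alpha> / \<gamma>" x] by (simp add: x_def)
  moreover have "0 < 1 + \<alpha> / \<gamma> * x"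
    using \<gamma> \<alpha> by (auto simp: x_def intro!: add_pos_nonneg)
  ultimately have "j_symbol \<gamma> \<alpha> k * x \<le> 1"
    unfolding j_symbol_def x_def [symmetric] by (simp add: divide_simps)
  from mult_right_mono[OF this, of "cmod (w k)"] show ?thesis
    by (simp add: norm_fdiff x_def abs_mult mult_ac)
qed

lemma j_symbol_square_le: "(j_symbol \<gamma> \<alpha> k)\<^sup>2 \<le> wt k powr (- 1)"
proof -
  define x where "x = \<bar>real_of_int k\<bar>"
  have "1 \<le> \<alpha> / \<gamma> * (2 * pi)"
    using \<gamma> \<alpha> pi_ge_two mult_mono[of 1 "\<alpha> / \<gamma>" 1 "2 * pi"] by simp
  then have "x \<le> \<alpha> / \<gamma> * \<bar>2 * pi * real_of_int k\<bar>"
    using mult_right_mono[of 1 "\<alpha> / \<gamma> * (2 * pi)" x] by (simp add: x_def abs_mult mult.assoc)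
  then have le: "1 + x \<le> 1 + \<alpha> / \<gamma> * \<bar>2 * pi * real_of_int k\<bar>" by simp
  have "(1 + x)\<^sup>2 \<le> (1 + \<alpha> / \<gamma> * \<bar>2 * pi * real_of_int k\<bar>)\<^sup>2"
    by (rule power_mono[OF le]) (simp add: x_def)
  moreover have "wt k \<le> (1 + x)\<^sup>2"
    by (simp add: x_def power2_sum)
  moreover have pos: "0 < wt k" by (simp add: add_pos_nonneg)
  ultimately have "1 / (1 + \<alpha> / \<gamma> * \<bar>2 * pi * real_of_int k\<bar>)\<^sup>2 \<le> 1 / wt k"
    by (intro divide_left_mono mult_pos_pos) auto
  moreover have "wt k powr (- 1) = 1 / wt k"
    using pos by (simp add: powr_minus divide_inverse)
  moreover have "(j_symbol \<gamma> \<alpha> k)\<^sup>2 = 1 / (1 + \<alpha> / \<gamma> * \<bar>2 * pi * real_of_int k\<bar>)\<^sup>2"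
    unfolding j_symbol_def power_divide by simp
  ultimately show ?thesis by simp
qed

text \<open>The symbol and the coefficients of a continuous \<open>f\<close> are both square
  summable, so their product is absolutely summable. The intended \<open>f\<close> is the derivative
  of \<zeta> u, which is known to be continuous and bounded.\<close>

lemma j_symbol_coeff_abs_summable:
  assumes "continuous_on {0..1} f" "l2sq f \<le> B"
  shows "(\<lambda>k. cmod (of_real (j_symbol \<gamma> \<alpha> k) * fourier_coeff f k)) summable_on UNIV"
    and "(\<Sum>\<^sub>\<infinity>k. cmod (of_real (j_symbol \<gamma> \<alpha> k) * fourier_coeff f k)) \<le> (\<Sum>\<^sub>\<infinity>k. wt k powr (- 1)) + B"
proof -
  have s1: "(\<lambda>k::int. wt k powr (- 1)) summable_on UNIV"
    by (rule summable_weight) simp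
  have s2: "(\<lambda>k. (cmod (fourier_coeff f k))\<^sup>2) summable_on UNIV"
    by (rule nonneg_bdd_above_summable_on) (auto intro!: bdd_aboveI2[where M = "l2sq f"] Bessel[OF assms(1)])
  have i2: "(\<Sum>\<^sub>\<infinity>k. (cmod (fourier_coeff f k))\<^sup>2) \<le> B"
    by (rule infsum_le_finite_sums[OF s2]) (rule order_trans[OF Bessel[OF assms(1)] assms(2)])
  have le: "cmod (of_real (j_symbol \<gamma> \<alpha> k) * fourier_coeff f k) \<le> wt k powr (- 1) + (cmod (fourier_coeff f
      k))\<^sup>2" for k
  proof -
    have "2 * (j_symbol \<gamma> \<alpha> k * cmod (fourier_coeff f k)) \<le> (j_symbol \<gamma> \<alpha> k)\<^sup>2 + (cmod (fourier_coeff f k))\<^sup>2"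
      using sum_squares_bound[of "j_symbol \<gamma> \<alpha> k" "cmod (fourier_coeff f k)"] by (simp add: mult.assoc)
    moreover have "0 \<le> j_symbol \<gamma> \<alpha> k * cmod (fourier_coeff f k)" using j_symbol_pos[of k] by simp
    moreover have "cmod (of_real (j_symbol \<gamma> \<alpha> k) * fourier_coeff f k) = j_symbol \<gamma> \<alpha> k * cmod (fourier_coeff f k)"
      using j_symbol_pos[of k] by (simp add: norm_mult)
    ultimately show ?thesis using j_symbol_square_le[of k] by linarith
  qed
  show 1: "(\<lambda>k. cmod (of_real (j_symbol \<gamma> \<alpha> k) * fourier_coeff f k)) summable_on UNIV"
    by (rule summable_on_comparison_test[OF summable_on_add[OF s1 s2] le]) simp
  show "(\<Sum>\<^sub>\<infinity>k. cmod (of_real (j_symbol \<gamma> \<alpha> k) * fourier_coeff f k)) \<le> (\<Sum>\<^sub>\<infinity>k. wt k powr (- 1)) + B"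
    using infsum_mono[OF 1 summable_on_add[OF s1 s2] le] infsum_add[OF s1 s2] i2 by linarith
qed

end

lemma sob_bd_mono: "sob_bd \<mu> R c \<Longrightarrow> R \<le> R' \<Longrightarrow> sob_bd \<mu> R' c"
  by (auto simp: sob_bd_def)

lemma sob_bd_nonneg: "sob_bd \<mu> R c \<Longrightarrow> 0 \<le> R"
  using infsum_nonneg[of UNIV "\<lambda>k. wt k powr \<mu> * (cmod (c k))\<^sup>2"]
  by (simp add: sob_bd_def)

text \<open>Turns the equations into an ordinary differential equation for each mode. The time
  derivatives are given only pointwise; the continuity and the bound that
  \<open>fourier_coeff_has_dt\<close> asks of them are read off from the equations, whose other
  terms the Sobolev bound controls uniformly in time.\<close>

lemma bo_solution_coeffs:
  fixes \<gamma> \<alpha> T \<mu> :: real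
  assumes \<gamma>: "0 < \<gamma>" "\<gamma> < 1" and \<alpha>: "1 < \<alpha>" and T: "0 < T" and \<mu>: "\<mu> > 3 / 2"
    and g: "\<And>\<xi>. g \<xi> = \<alpha> / \<gamma> * \<bar>\<xi>\<bar>"
    and sol: "bo_solution \<gamma> \<alpha> g T \<mu> \<zeta>0 u0 \<zeta> u"
  obtains R where "0 \<le> R"
    "\<And>t. t \<in> {0..T} \<Longrightarrow> reg \<mu> R (\<zeta> t) \<and> reg \<mu> R (u t)"
    "\<And>t k. t \<in> {0..T} \<Longrightarrow> ((\<lambda>s. fourier_coeff (\<zeta> s) k) has_vector_derivative
       rhs1 \<gamma> \<alpha> (fourier_coeff (u t)) (fourier_coeff (\<lambda>x. \<zeta> t x * u t x)) k) (at t within {0..T})"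
    "\<And>t k. t \<in> {0..T} \<Longrightarrow> ((\<lambda>s. fourier_coeff (u s) k) has_vector_derivative
       rhs2 \<gamma> (fourier_coeff (\<zeta> t)) (fourier_coeff (\<lambda>x. (u t x)\<^sup>2)) k) (at t within {0..T})"
proof -
  have cs: "\<zeta> \<in> cont_sobolev T \<mu>" "u \<in> cont_sobolev T \<mu>"
    and diff: "\<And>t x. t \<in> {0..T} \<Longrightarrow> \<zeta> t differentiable (at x)" "\<And>t x. t \<in> {0..T} \<Longrightarrow> u t differentiable (at x)"
    using sol unfolding bo_solution_def by blast+
  obtain \<zeta>t ut where dt: "has_dt T \<zeta> \<zeta>t" "has_dt T u ut"
    and eq1: "\<And>t x. t \<in> {0..T} \<Longrightarrow> \<zeta>t t x + of_real (1 / \<gamma>) *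
              fourier_multiplier (\<lambda>\<xi>. 1 / (1 + g \<xi>) * (1 + (\<alpha> - 1) / \<alpha> * g \<xi>)) (dx (u t)) x
            = of_real (1 / \<gamma>) *
              fourier_multiplier (\<lambda>\<xi>. 1 / (1 + g \<xi>)) (dx (\<lambda>y. \<zeta> t y * u t y)) x"
    and eq2: "\<And>t x. t \<in> {0..T} \<Longrightarrow> ut t x + of_real (1 - \<gamma>) * dx (\<zeta> t) x
        = of_real (1 / (2 * \<gamma>)) * dx (\<lambda>y. (u t y)\<^sup>2) x"
    using sol unfolding bo_solution_def by blast
  have per: "periodic1 (v t)" if "v \<in> cont_sobolev T \<mu>" "t \<in> {0..T}" for v t
    using that unfolding cont_sobolev_def sobolev_def L2_per_def by blast
  have cont: "continuous_on {0..1} f" if "\<And>x. f differentiable (at x)" for f :: "real \<Rightarrow> complex"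
    using that by (intro differentiable_imp_continuous_on) (simp add: differentiable_on_def
        differentiable_at_withinI)
  have ct: "continuous_on {0..1} (\<zeta> t)" "continuous_on {0..1} (u t)" if "t \<in> {0..T}" for t
    using cont diff that by blast+
  obtain R1 R2 where R1: "\<And>t. t \<in> {0..T} \<Longrightarrow> sob_bd \<mu> R1 (fourier_coeff (\<zeta> t))"
    and R2: "\<And>t. t \<in> {0..T} \<Longrightarrow> sob_bd \<mu> R2 (fourier_coeff (u t))"
    using cont_sobolev_bounded[OF cs(1) ct(1) less_imp_le[OF T]] cont_sobolev_bounded[OF cs(2) ct(2)
        less_imp_le[OF T]]
    by blast
  define R where "R = max R1 R2"
  have reg: "reg \<mu> R (\<zeta> t)" "reg \<mu> R (u t)" if t: "t \<in> {0..T}" for t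
    unfolding reg_def R_def
    using per[OF cs(1) t] per[OF cs(2) t] diff[OF t] sob_bd_mono[OF R1[OF t]] sob_bd_mono[OF R2[OF t]] by simp_all
  have R0: "0 \<le> R" using sob_bd_nonneg[OF R1[of 0]] T unfolding R_def by simp
  define B where "B = sup_const \<mu> R"
  have supB: "cmod (\<zeta> t x) \<le> B" "cmod (u t x) \<le> B" "cmod (dx (\<zeta> t) x) \<le> B" "cmod (dx (u t) x) \<le> B"
      if "t \<in> {0..T}" for t x
    unfolding B_def using reg_sup(1,2)[OF \<mu> reg(1)[OF that]] reg_sup(1,2)[OF \<mu> reg(2)[OF that]] by simp_all
  have B0: "0 \<le> B" using supB(1)[of 0 0] T norm_ge_zero[of "\<zeta> 0 0"] by (simp del: norm_ge_zero)
  note contR = reg_continuous[OF \<mu> reg(1)] reg_continuous[OF \<mu> reg(2)]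
  have prodD: "((\<lambda>y. \<zeta> t y * u t y) has_vector_derivative (\<zeta> t x * dx (u t) x + dx (\<zeta> t) x * u t x)) (at x)"
    if t: "t \<in> {0..T}" for t x
    by (rule has_vector_derivative_mult[OF reg_dx_deriv[OF \<mu> reg(1)[OF t]] reg_dx_deriv[OF \<mu> reg(2)[OF t]]])
  then have dxprod: "dx (\<lambda>y. \<zeta> t y * u t y) = (\<lambda>x. \<zeta> t x * dx (u t) x + dx (\<zeta> t) x * u t x)" if "t \<in> {0..T}" for t
    using that by (intro ext) (simp add: dx_def vector_derivative_at)
  have sqD: "((\<lambda>y. (u t y)\<^sup>2) has_vector_derivative (u t x * dx (u t) x + dx (u t) x * u t x)) (at x)"
    if t: "t \<in> {0..T}" for t x
    unfolding power2_eq_square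
    by (rule has_vector_derivative_mult[OF reg_dx_deriv[OF \<mu> reg(2)[OF t]] reg_dx_deriv[OF \<mu> reg(2)[OF t]]])
  then have dxsq: "dx (\<lambda>y. (u t y)\<^sup>2) = (\<lambda>x. u t x * dx (u t) x + dx (u t) x * u t x)" if "t \<in> {0..T}" for t
    using that by (intro ext) (simp add: dx_def vector_derivative_at)
  have dxprodc: "continuous_on {0..1} (dx (\<lambda>y. \<zeta> t y * u t y))" "continuous_on {0..1} (dx (\<lambda>y. (u t y)\<^sup>2))"
      if "t \<in> {0..T}" for t
    unfolding dxprod[OF that] dxsq[OF that] by (intro continuous_intros contR that)+
  have prodB: "cmod (a * b + c * d) \<le> 2 * B\<^sup>2" if "cmod a \<le> B" "cmod b \<le> B" "cmod c \<le> B" "cmod d \<le> B" for a b c d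
  proof -
    have "cmod (a * b) \<le> B * B" "cmod (c * d) \<le> B * B"
      unfolding norm_mult using that B0 by (auto intro!: mult_mono)
    then show ?thesis using norm_triangle_ineq[of "a * b" "c * d"] by (simp add: power2_eq_square)
  qed
  have coeff: "fourier_coeff (dx (\<lambda>y. \<zeta> t y * u t y)) = fdiff (fourier_coeff (\<lambda>y. \<zeta> t y * u t y))"
    "fourier_coeff (dx (\<lambda>y. (u t y)\<^sup>2)) = fdiff (fourier_coeff (\<lambda>y. (u t y)\<^sup>2))"
    "fourier_coeff (dx (\<zeta> t)) = fdiff (fourier_coeff (\<zeta> t))" "fourier_coeff (dx (u t))
        = fdiff (fourier_coeff (u t))"
    if t: "t \<in> {0..T}" for t
  proof -
    have "periodic1 (\<lambda>y. \<zeta> t y * u t y)" "periodic1 (\<lambda>y. (u t y)\<^sup>2)"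
      using per[OF cs(1) t] per[OF cs(2) t] unfolding periodic1_def by simp_all
    then show "fourier_coeff (dx (\<lambda>y. \<zeta> t y * u t y)) = fdiff (fourier_coeff (\<lambda>y. \<zeta> t y * u t y))"
      "fourier_coeff (dx (\<lambda>y. (u t y)\<^sup>2)) = fdiff (fourier_coeff (\<lambda>y. (u t y)\<^sup>2))"
      using dxprodc[OF t] prodD[OF t] sqD[OF t]
      by (auto intro!: fourier_coeff_deriv simp: dxprod[OF t] dxsq[OF t])
    show "fourier_coeff (dx (\<zeta> t)) = fdiff (fourier_coeff (\<zeta> t))" "fourier_coeff (dx (u t))
        = fdiff (fourier_coeff (u t))"
      using per[OF cs(1) t] per[OF cs(2) t] contR(2,4)[OF t] reg_dx_deriv[OF \<mu> reg(1)[OF t]] reg_dx_deriv[OF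
          \<mu> reg(2)[OF t]]
      by (auto intro!: fourier_coeff_deriv)
  qed
  \<comment> \<open>Coefficients of the two multiplier terms. The nonlinear ones are absolutely
    summable thanks to the smoothing symbol, the linear ones because those of u_x already
    are.\<close>
  define c1 where "c1 t k = of_real (j_symbol \<gamma> \<alpha> k) * fourier_coeff (dx (\<lambda>y. \<zeta> t y * u t y)) k" for t k
  define c2 where "c2 t k = of_real (m_symbol \<gamma> \<alpha> k) * fourier_coeff (dx (u t)) k" for t k
  define W where "W = (\<Sum>\<^sub>\<infinity>k::int. wt k powr (- 1)) + (2 * B\<^sup>2)\<^sup>2"
  have c1s: "(\<lambda>k. cmod (c1 t k)) summable_on UNIV" "(\<Sum>\<^sub>\<infinity>k. cmod (c1 t k)) \<le> W" if t: "t \<in> {0..T}" for t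
  proof -
    have "l2sq (dx (\<lambda>y. \<zeta> t y * u t y)) \<le> (2 * B\<^sup>2)\<^sup>2"
      by (rule l2sq_le_const[OF dxprodc(1)[OF t]]) (simp add: dxprod[OF t] prodB supB[OF t])
    from j_symbol_coeff_abs_summable[OF \<gamma> \<alpha> dxprodc(1)[OF t] this]
    show "(\<lambda>k. cmod (c1 t k)) summable_on UNIV" "(\<Sum>\<^sub>\<infinity>k. cmod (c1 t k)) \<le> W"
      by (simp_all add: c1_def W_def)
  qed
  have c2s: "(\<lambda>k. cmod (c2 t k)) summable_on UNIV" "(\<Sum>\<^sub>\<infinity>k. cmod (c2 t k)) \<le> B" if t: "t \<in> {0..T}" for t
  proof -
    have "sob_bd \<mu> R (fourier_coeff (u t))" using reg(2)[OF t] by (simp add: reg_def)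
    note s = sob_bd_abs_summable(3,4)[OF this \<mu>]
    have le: "cmod (c2 t k) \<le> cmod (fdiff (fourier_coeff (u t)) k)" for k
    proof -
      have "\<bar>m_symbol \<gamma> \<alpha> k\<bar> \<le> 1" using m_symbol_pos[OF \<gamma> \<alpha>, of k] m_symbol_le_1[OF \<gamma> \<alpha>, of k] by simp
      then show ?thesis using t by (simp add: c2_def coeff norm_mult mult_left_le_one_le)
    qed
    show 1: "(\<lambda>k. cmod (c2 t k)) summable_on UNIV"
      by (rule summable_on_comparison_test[OF s(1) le]) simp
    show "(\<Sum>\<^sub>\<infinity>k. cmod (c2 t k)) \<le> B"
      using infsum_mono[OF 1 s(1) le] s(2) unfolding B_def by simp
  qed
  \<comment> \<open>The first equation solved for the time derivative, which is thereby a difference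
    of two absolutely convergent Fourier series.\<close>
  have \<zeta>t: "\<zeta>t t = (\<lambda>x. of_real (1 / \<gamma>) * fser (c1 t) x - of_real (1 / \<gamma>) * fser (c2 t) x)" if t: "t \<in> {0..T}" for t
  proof
    fix x
    have "fourier_multiplier (\<lambda>\<xi>. 1 / (1 + g \<xi>) * (1 + (\<alpha> - 1) / \<alpha> * g \<xi>)) (dx (u t)) x = fser (c2 t) x"
      by (simp only: fourier_multiplier_def fser_def c2_def m_symbol_def g)
    moreover have "fourier_multiplier (\<lambda>\<xi>. 1 / (1 + g \<xi>)) (dx (\<lambda>y. \<zeta> t y * u t y)) x = fser (c1 t) x"
      by (simp only: fourier_multiplier_def fser_def c1_def j_symbol_def g)
    ultimately show "\<zeta>t t x = of_real (1 / \<gamma>) * fser (c1 t) x - of_real (1 / \<gamma>) * fser (c2 t) x"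
      using eq1[OF t, of x] by (simp only: eq_diff_eq)
  qed
  have ut: "ut t = (\<lambda>x. of_real (1 / (2 * \<gamma>)) * dx (\<lambda>y. (u t y)\<^sup>2) x - of_real (1
      - \<gamma>) * dx (\<zeta> t) x)" if t: "t \<in> {0..T}" for t
    using eq2[OF t] by (simp only: eq_diff_eq fun_eq_iff simp_thms)
  show ?thesis
  proof (rule that[of R])
    show "0 \<le> R" by (rule R0)
    show "reg \<mu> R (\<zeta> t) \<and> reg \<mu> R (u t)" if "t \<in> {0..T}" for t using reg that by blast
    fix t k assume t: "t \<in> {0..T}"
    have "((\<lambda>s. fourier_coeff (\<zeta> s) k) has_vector_derivative fourier_coeff (\<zeta>t t) k) (at t within {0..T})"
    proof (rule fourier_coeff_has_dt[OF _ _ dt(1) _ t])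
      show "continuous_on {0..1} (\<zeta> s)" if "s \<in> {0..T}" for s by (rule contR(1)[OF that])
      show "continuous_on {0..1} (\<zeta>t s)" if "s \<in> {0..T}" for s
        unfolding \<zeta>t[OF that] by (intro continuous_intros c1s c2s that)
      show "cmod (\<zeta>t s x) \<le> 1 / \<gamma> * W + 1 / \<gamma> * B" if "s \<in> {0..T}" for s x
      proof -
        have "cmod (of_real (1 / \<gamma>) * fser (c1 s) x) \<le> 1 / \<gamma> * W" "cmod (of_real (1 / \<gamma>) * fser (c2 s) x) \<le>
            1 / \<gamma> * B"
          unfolding norm_mult using \<gamma> cmod_fser_le(1)[OF c1s(1)[OF that], of x] c1s(2)[OF that]
            cmod_fser_le(1)[OF c2s(1)[OF that], of x] c2s(2)[OF that]
          by (auto simp: norm_divide intro!: divide_right_mono)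
        then show ?thesis unfolding \<zeta>t[OF that] by (meson add_mono norm_triangle_ineq4 order_trans)
      qed
    qed
    moreover have "fourier_coeff (\<zeta>t t) k = rhs1 \<gamma> \<alpha> (fourier_coeff (u t)) (fourier_coeff (\<lambda>x. \<zeta> t x * u t x)) k"
    proof -
      have "fourier_coeff (\<zeta>t t) k = of_real (1 / \<gamma>) * c1 t k - of_real (1 / \<gamma>) * c2 t k"
        unfolding \<zeta>t[OF t]
        by (subst fourier_coeff_diff)
          (intro continuous_intros c1s c2s t | simp only: fourier_coeff_cmult fourier_coeff_fser[OF
              c1s(1)[OF t]] fourier_coeff_fser[OF c2s(1)[OF t]])+
      then show ?thesis by (simp only: rhs1_def c1_def c2_def coeff[OF t])
    qed
    ultimately show "((\<lambda>s. fourier_coeff (\<zeta> s) k) has_vector_derivative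
       rhs1 \<gamma> \<alpha> (fourier_coeff (u t)) (fourier_coeff (\<lambda>x. \<zeta> t x * u t x)) k) (at t within {0..T})" by simp
    have "((\<lambda>s. fourier_coeff (u s) k) has_vector_derivative fourier_coeff (ut t) k) (at t within {0..T})"
    proof (rule fourier_coeff_has_dt[OF _ _ dt(2) _ t])
      show "continuous_on {0..1} (u s)" if "s \<in> {0..T}" for s by (rule contR(3)[OF that])
      show "continuous_on {0..1} (ut s)" if "s \<in> {0..T}" for s
        unfolding ut[OF that] by (intro continuous_intros dxprodc contR that)
      show "cmod (ut s x) \<le> 1 / (2 * \<gamma>) * (2 * B\<^sup>2) + (1 - \<gamma>) * B" if s: "s \<in> {0..T}" for s x
      proof -
        have "cmod (of_real (1 / (2 * \<gamma>)) * dx (\<lambda>y. (u s y)\<^sup>2) x) \<le> 1 / (2 * \<gamma>) * (2 * B\<^sup>2)"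
          unfolding norm_mult[of "of_real _"] dxsq[OF s] using \<gamma>
          by (intro mult_mono prodB supB[OF s]) (auto simp: norm_divide norm_mult)
        moreover have "cmod (of_real (1 - \<gamma>) * dx (\<zeta> s) x) \<le> (1 - \<gamma>) * B"
          unfolding norm_mult norm_of_real using \<gamma> supB[OF s] by (intro mult_mono) auto
        ultimately show ?thesis unfolding ut[OF s] by (meson add_mono norm_triangle_ineq4 order_trans)
      qed
    qed
    moreover have "fourier_coeff (ut t) k = rhs2 \<gamma> (fourier_coeff (\<zeta> t)) (fourier_coeff (\<lambda>x. (u t x)\<^sup>2)) k"
      unfolding ut[OF t]
      by (subst fourier_coeff_diff)
        (intro continuous_intros dxprodc contR t | simp only: fourier_coeff_cmult rhs2_def coeff[OF t])+
    ultimately show "((\<lambda>s. fourier_coeff (u s) k) has_vector_derivative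
       rhs2 \<gamma> (fourier_coeff (\<zeta> t)) (fourier_coeff (\<lambda>x. (u t x)\<^sup>2)) k) (at t within {0..T})" by simp
  qed
qed

section \<open>The energy of the error\<close>

abbreviation coeff_sq :: "nat \<Rightarrow> (int \<Rightarrow> complex) \<Rightarrow> real" where
  "coeff_sq N c \<equiv> \<Sum>k = - int N..int N. (cmod (c k))\<^sup>2"

lemma l2sq_trig: "l2sq (trig N c) = coeff_sq N c"
  unfolding trig_eq_fourier_sum by (rule l2sq_fsum) simp

lemma periodic1_trig: "periodic1 (trig N c)"
  using periodic1_fourier_mode by (simp add: periodic1_def trig_def)

lemma trig_diff: "trig N (\<lambda>k. a k - b k) x = trig N a x - trig N b x"
  by (simp add: trig_def left_diff_distrib sum_subtractf)

text \<open>The inverse inequality, by Cauchy-Schwarz over the 2N + 1 modes.\<close>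

lemma cmod_trig_le: "cmod (trig N c x) \<le> sqrt ((2 * real N + 1) * coeff_sq N c)"
proof -
  have "cmod (trig N c x) \<le> (\<Sum>k = - int N..int N. cmod (c k))"
    unfolding trig_def by (rule order_trans[OF norm_sum]) (simp add: norm_mult)
  moreover have "(\<Sum>k = - int N..int N. cmod (c k))\<^sup>2 \<le> coeff_sq N c * (2 * real N + 1)"
    using sum_squared_le_sum_of_squares[of "\<lambda>k. cmod (c k)" "{- int N..int N}"] by (simp add: add.commute)
  ultimately show ?thesis
    using power_mono[of "cmod (trig N c x)" "\<Sum>k = - int N..int N. cmod (c k)" 2]
    by (intro real_le_rsqrt) (simp add: mult.commute)
qed

lemma mult_le_half_squares: "a * b \<le> (a\<^sup>2 + b\<^sup>2) / 2" for a b :: real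
  using sum_squares_bound[of a b] by simp

lemma trig_pairing:
  assumes "continuous_on {0..1} f"
  shows "integral {0..1} (\<lambda>x. cnj (trig N c x) * f x) = (\<Sum>k = - int N..int N. cnj (c k) * fourier_coeff f k)"
  unfolding trig_def by (rule integral_pairing[OF assms]) simp

lemma pairing_le:
  assumes "continuous_on {0..1} f"
  shows "(\<Sum>k = - int N..int N. Re (cnj (c k) * fourier_coeff f k)) \<le> (coeff_sq N c + l2sq f) / 2"
proof -
  have "Re (cnj (c k) * fourier_coeff f k) \<le> ((cmod (c k))\<^sup>2 + (cmod (fourier_coeff f k))\<^sup>2) / 2" for k
    using complex_Re_le_cmod[of "cnj (c k) * fourier_coeff f k"] mult_le_half_squares[of "cmod (c k)" "cmod
        (fourier_coeff f k)"]
    unfolding norm_mult complex_mod_cnj by linarith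
  then have "(\<Sum>k = - int N..int N. Re (cnj (c k) * fourier_coeff f k))
      \<le> (\<Sum>k = - int N..int N. ((cmod (c k))\<^sup>2 + (cmod (fourier_coeff f k))\<^sup>2) / 2)"
    by (intro sum_mono)
  also have "\<dots> = (coeff_sq N c + coeff_sq N (fourier_coeff f)) / 2"
    by (simp add: sum.distrib flip: sum_divide_distrib)
  finally show ?thesis using Bessel[OF assms, of "{- int N..int N}"] by simp
qed

text \<open>The symbol absorbs the derivative in \<open>fdiff\<close>, so \<open>f\<close> enters
  with its L^2 norm alone, as in \<open>pairing_le\<close>.\<close>

lemma j_symbol_pairing_le:
  assumes "continuous_on {0..1} f" and \<gamma>: "0 < \<gamma>" "\<gamma> < 1" and \<alpha>: "1 < \<alpha>"
  shows "(\<Sum>k = - int N..int N. j_symbol \<gamma> \<alpha> k * Re (cnj (c k) * fdiff (fourier_coeff f) k)) \<le> (coeff_sq N c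
      + l2sq f) / 2"
proof -
  have "j_symbol \<gamma> \<alpha> k * Re (cnj (c k) * fdiff (fourier_coeff f) k) \<le> ((cmod (c k))\<^sup>2 + (cmod (fourier_coeff
      f k))\<^sup>2) / 2" for k
  proof -
    have "j_symbol \<gamma> \<alpha> k * Re (cnj (c k) * fdiff (fourier_coeff f) k) \<le> j_symbol \<gamma> \<alpha> k * (cmod (c k) * cmod
        (fdiff (fourier_coeff f) k))"
      using j_symbol_pos[OF \<gamma> \<alpha>, of k] complex_Re_le_cmod[of "cnj (c k) * fdiff (fourier_coeff f) k"]
      by (intro mult_left_mono) (auto simp: norm_mult)
    also have "\<dots> = cmod (c k) * (j_symbol \<gamma> \<alpha> k * cmod (fdiff (fourier_coeff f) k))" by simp
    also have "\<dots> \<le> cmod (c k) * cmod (fourier_coeff f k)"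
      by (intro mult_left_mono j_symbol_fdiff_le[OF \<gamma> \<alpha>]) simp
    also have "\<dots> \<le> ((cmod (c k))\<^sup>2 + (cmod (fourier_coeff f k))\<^sup>2) / 2"
      by (rule mult_le_half_squares)
    finally show ?thesis .
  qed
  then have "(\<Sum>k = - int N..int N. j_symbol \<gamma> \<alpha> k * Re (cnj (c k) * fdiff (fourier_coeff f) k))
      \<le> (\<Sum>k = - int N..int N. ((cmod (c k))\<^sup>2 + (cmod (fourier_coeff f k))\<^sup>2) / 2)"
    by (intro sum_mono)
  also have "\<dots> = (coeff_sq N c + coeff_sq N (fourier_coeff f)) / 2"
    by (simp add: sum.distrib flip: sum_divide_distrib)
  finally show ?thesis using Bessel[OF assms(1), of "{- int N..int N}"] by simp
qed

text \<open>
  With \<open>p\<close>, \<open>s\<close> the functions of the coefficients \<open>b\<close>, \<open>c\<close>, the pairing is the integral of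
  \<open>s (2 p s - s\<^sup>2)' = p' s\<^sup>2 + (p s\<^sup>2 - 2/3 s\<^sup>3)'\<close>, so that no derivative of \<open>s\<close> survives.
\<close>

lemma cubic_pairing_le:
  fixes N :: nat and b c :: "int \<Rightarrow> complex"
  defines "p \<equiv> trig N b" and "p' \<equiv> trig N (fdiff b)" and "s \<equiv> trig N c" and "s' \<equiv> trig N (fdiff c)"
  assumes real: "real_valued s" and B: "\<And>x. cmod (p' x) \<le> B"
  shows "(\<Sum>k = - int N..int N. Re (cnj (c k) * fourier_coeff (\<lambda>x. 2 * (p' x * s x + p x * s' x)
      - 2 * (s x * s' x)) k))
    \<le> B * coeff_sq N c"
proof -
  let ?G = "\<lambda>x. 2 * (p' x * s x + p x * s' x) - 2 * (s x * s' x)"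
  let ?H = "\<lambda>x. p x * (s x * s x) - 2 / 3 * (s x * (s x * s x))"
  let ?h = "\<lambda>x. (p x * (s x * s' x + s' x * s x) + p' x * (s x * s x))
      - 2 / 3 * (s x * (s x * s' x + s' x * s x) + s' x * (s x * s x))"
  have c: "continuous_on {0..1} p" "continuous_on {0..1} p'" "continuous_on {0..1} s" "continuous_on {0..1} s'"
    unfolding p_def p'_def s_def s'_def by (intro continuous_intros)+
  have D: "(p has_vector_derivative p' x) (at x within S)" "(s has_vector_derivative s' x) (at x within S)" for x S
    unfolding p_def p'_def s_def s'_def by (rule has_vector_derivative_trig)+
  \<comment> \<open>Reality of \<open>s\<close> makes the integrand a polynomial in p, s and their
    derivatives, which is what allows it to be split into p' s^2 and an exact derivative.\<close>
  have cnj: "cnj (s x) = s x" for x using real by (simp add: real_valued_def Reals_cnj_iff)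
  have "(?h has_integral ?H 1 - ?H 0) {0..1}"
    by (intro fundamental_theorem_of_calculus zero_le_one has_vector_derivative_diff
        has_vector_derivative_mult_right
        has_vector_derivative_mult D)
  moreover have "p 1 = p 0" "s 1 = s 0"
    using periodic1_trig[of N b] periodic1_trig[of N c] periodic1_of_int[of _ 0 1] by (simp_all add: p_def s_def)
  ultimately have h0: "integral {0..1} ?h = 0" by (simp add: integral_unique)
  have "(\<Sum>k = - int N..int N. cnj (c k) * fourier_coeff ?G k) = integral {0..1} (\<lambda>x. cnj (s x) * ?G x)"
  proof -
    have "continuous_on {0..1} ?G" by (intro continuous_intros c)
    from trig_pairing[OF this, of N c] show ?thesis by (simp only: s_def)
  qed
  also have "(\<lambda>x. cnj (s x) * ?G x) = (\<lambda>x. p' x * (s x * s x) + ?h x)"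
  proof
    fix x
    show "cnj (s x) * ?G x = p' x * (s x * s x) + ?h x"
      unfolding cnj by algebra
  qed
  also have "integral {0..1} \<dots> = integral {0..1} (\<lambda>x. p' x * (s x * s x)) + integral {0..1} ?h"
  proof (intro integral_add integrable_continuous_real)
    show "continuous_on {0..1} ?h" by (auto intro!: continuous_intros c)
    show "continuous_on {0..1} (\<lambda>x. p' x * (s x * s x))" by (intro continuous_intros c)
  qed
  finally have eq: "(\<Sum>k = - int N..int N. cnj (c k) * fourier_coeff ?G k)
      = integral {0..1} (\<lambda>x. p' x * (s x * s x))"
    unfolding h0 add_0_right .
  have "cmod (integral {0..1} (\<lambda>x. p' x * (s x * s x))) \<le> integral {0..1} (\<lambda>x. B * (cmod (s x))\<^sup>2)"
    using B by (intro integral_norm_bound_integral integrable_continuous_real continuous_intros c)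
      (simp add: norm_mult power2_eq_square mult_right_mono)
  also have "\<dots> = B * l2sq s" by (simp add: l2sq_def)
  also have "l2sq s = coeff_sq N c" unfolding s_def by (rule l2sq_trig)
  finally show ?thesis
    unfolding eq [symmetric] Re_sum [symmetric] using complex_Re_le_cmod order_trans by blast
qed

definition energy :: "real \<Rightarrow> real \<Rightarrow> nat \<Rightarrow> (int \<Rightarrow> complex) \<Rightarrow> (int \<Rightarrow> complex) \<Rightarrow> real" where
  "energy \<gamma> \<alpha> N \<theta> \<xi> = (\<Sum>k = - int N..int N. (1 - \<gamma>) * (cmod (\<theta> k))\<^sup>2 + 1 / \<gamma> * (m_symbol \<gamma> \<alpha> k * (cmod (\<xi> k))\<^sup>2))"

text \<open>The time derivative of \<open>energy\<close>, kept as a formula in the coefficients and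
  their rates so that it can be estimated at a fixed time.\<close>

definition energy_rate :: "real \<Rightarrow> real \<Rightarrow> nat \<Rightarrow> (int \<Rightarrow> complex) \<Rightarrow> (int \<Rightarrow> complex) \<Rightarrow> (int \<Rightarrow> complex) \<Rightarrow> (int \<Rightarrow>
    complex) \<Rightarrow> real" where
  "energy_rate \<gamma> \<alpha> N \<theta> \<xi> \<theta>' \<xi>' = (\<Sum>k = - int N..int N.
     (1 - \<gamma>) * (2 * Re (cnj (\<theta> k) * \<theta>' k)) + 1 / \<gamma> * (m_symbol \<gamma> \<alpha> k * (2 * Re (cnj (\<xi> k) * \<xi>' k))))"

text \<open>The smaller of the weight of \<theta> and the lower bound of the weight of \<xi>, the
  latter being \<open>m_symbol_ge\<close> divided by \<gamma>.\<close>

definition coercivity :: "real \<Rightarrow> real \<Rightarrow> real" where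
  "coercivity \<gamma> \<alpha> = min (1 - \<gamma>) ((\<alpha> - 1) / (\<alpha> * \<gamma>))"

lemma coercivity_pos: "0 < \<gamma> \<Longrightarrow> \<gamma> < 1 \<Longrightarrow> 1 < \<alpha> \<Longrightarrow> 0 < coercivity \<gamma> \<alpha>"
  by (simp add: coercivity_def)

lemma energy_ge:
  assumes \<gamma>: "0 < \<gamma>" "\<gamma> < 1" and \<alpha>: "1 < \<alpha>"
  shows "coercivity \<gamma> \<alpha> * (coeff_sq N \<theta> + coeff_sq N \<xi>) \<le> energy \<gamma> \<alpha> N \<theta> \<xi>"
proof -
  have "coercivity \<gamma> \<alpha> * ((cmod (\<theta> k))\<^sup>2 + (cmod (\<xi> k))\<^sup>2)
      \<le> (1 - \<gamma>) * (cmod (\<theta> k))\<^sup>2 + 1 / \<gamma> * (m_symbol \<gamma> \<alpha> k * (cmod (\<xi> k))\<^sup>2)" for k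
  proof -
    have "coercivity \<gamma> \<alpha> \<le> 1 / \<gamma> * ((\<alpha> - 1) / \<alpha>)"
      using \<gamma> \<alpha> by (simp add: coercivity_def min_le_iff_disj mult.commute)
    also have "\<dots> \<le> 1 / \<gamma> * m_symbol \<gamma> \<alpha> k"
      using \<gamma> by (intro mult_left_mono m_symbol_ge[OF \<gamma> \<alpha>]) simp
    finally have "coercivity \<gamma> \<alpha> * (cmod (\<xi> k))\<^sup>2 \<le> 1 / \<gamma> * m_symbol \<gamma> \<alpha> k * (cmod (\<xi> k))\<^sup>2"
      by (intro mult_right_mono) auto
    moreover have "coercivity \<gamma> \<alpha> * (cmod (\<theta> k))\<^sup>2 \<le> (1 - \<gamma>) * (cmod (\<theta> k))\<^sup>2"
      by (intro mult_right_mono) (auto simp: coercivity_def)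
    ultimately show ?thesis by (simp add: distrib_left mult.assoc)
  qed
  then show ?thesis
    unfolding energy_def sum.distrib [symmetric] sum_distrib_left by (intro sum_mono)
qed

text \<open>The linear couplings carry the same factor (1-\<gamma>) m/\<gamma> and opposite real
  parts, so they cancel. In the term with \<open>q\<close> the symbol m is split into its constant
  and its smoothing part; only the constant part, in the last sum, leaves a derivative
  unabsorbed.\<close>

lemma energy_rate_eq:
  assumes \<gamma>: "0 < \<gamma>" "\<gamma> < 1" and \<alpha>: "1 < \<alpha>"
  shows "energy_rate \<gamma> \<alpha> N \<theta> \<xi> (rhs1 \<gamma> \<alpha> \<xi> w) (rhs2 \<gamma> \<theta> q) =
    2 * (1 - \<gamma>) / \<gamma> * (\<Sum>k = - int N..int N. j_symbol \<gamma> \<alpha> k * Re (cnj (\<theta> k) * fdiff w k))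
    + 1 / (\<gamma>\<^sup>2 * \<alpha>) * (\<Sum>k = - int N..int N. j_symbol \<gamma> \<alpha> k * Re (cnj (\<xi> k) * fdiff q k))
    + (\<alpha> - 1) / (\<gamma>\<^sup>2 * \<alpha>) * (\<Sum>k = - int N..int N. Re (cnj (\<xi> k) * fdiff q k))"
proof -
  have lin: "Re (cnj (\<theta> k) * fdiff \<xi> k) + Re (cnj (\<xi> k) * fdiff \<theta> k) = 0" for k
    by (simp add: fdiff_def algebra_simps)
  have "(1 - \<gamma>) * (2 * Re (cnj (\<theta> k) * rhs1 \<gamma> \<alpha> \<xi> w k)) + 1 / \<gamma> * (m_symbol \<gamma> \<alpha> k * (2 * Re (cnj (\<xi> k) *
      rhs2 \<gamma> \<theta> q k)))
    = 2 * (1 - \<gamma>) / \<gamma> * (j_symbol \<gamma> \<alpha> k * Re (cnj (\<theta> k) * fdiff w k))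
    + 1 / (\<gamma>\<^sup>2 * \<alpha>) * (j_symbol \<gamma> \<alpha> k * Re (cnj (\<xi> k) * fdiff q k))
    + (\<alpha> - 1) / (\<gamma>\<^sup>2 * \<alpha>) * Re (cnj (\<xi> k) * fdiff q k)" for k
  proof -
    define X where "X = Re (cnj (\<theta> k) * fdiff w k)"
    define Y where "Y = Re (cnj (\<xi> k) * fdiff q k)"
    define Z where "Z = Re (cnj (\<theta> k) * fdiff \<xi> k)"
    have Z': "Re (cnj (\<xi> k) * fdiff \<theta> k) = - Z" using lin[of k] by (simp add: Z_def)
    have Re_real: "Re (a * (of_real r * z)) = r * Re (a * z)" for a z r by (simp add: algebra_simps)
    have 1: "Re (cnj (\<theta> k) * rhs1 \<gamma> \<alpha> \<xi> w k) = 1 / \<gamma> * (j_symbol \<gamma> \<alpha> k * X) - 1 / \<gamma> * (m_symbol \<gamma> \<alpha> k * Z)"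
      unfolding rhs1_def right_diff_distrib minus_complex.sel Re_real X_def Z_def by (rule refl)
    have 2: "Re (cnj (\<xi> k) * rhs2 \<gamma> \<theta> q k) = 1 / (2 * \<gamma>) * Y + (1 - \<gamma>) * Z"
      unfolding rhs2_def right_diff_distrib minus_complex.sel Re_real Z' Y_def by simp
    define m where "m = m_symbol \<gamma> \<alpha> k"
    define j where "j = j_symbol \<gamma> \<alpha> k"
    have m: "m = (\<alpha> - 1) / \<alpha> + j / \<alpha>" unfolding m_def j_def by (rule m_symbol_eq[OF \<gamma> \<alpha>])
    have "(1 - \<gamma>) * (2 * (1 / \<gamma> * (j * X) - 1 / \<gamma> * (m * Z))) + 1 / \<gamma> * (m * (2 * (1 / (2 * \<gamma>) * Y + (1 - \<gamma>) * Z)))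
        = 2 * (1 - \<gamma>) / \<gamma> * (j * X) + 1 / \<gamma>\<^sup>2 * (m * Y)"
      using \<gamma> by (simp add: divide_simps power2_eq_square) (simp add: algebra_simps)
    also have "1 / \<gamma>\<^sup>2 * (m * Y) = 1 / (\<gamma>\<^sup>2 * \<alpha>) * (j * Y) + (\<alpha> - 1) / (\<gamma>\<^sup>2 * \<alpha>) * Y"
      unfolding m using \<gamma> \<alpha> by (simp add: divide_simps) (simp add: algebra_simps)
    finally show ?thesis
      unfolding 1 2 X_def [symmetric] Y_def [symmetric] m_def [symmetric] j_def [symmetric]
          by (simp only: add.assoc)
  qed
  then show ?thesis
    unfolding energy_rate_def by (simp only: sum.distrib sum_distrib_left)
qed

lemma fourier_coeff_real:
  assumes "continuous_on {0..1} f" "real_valued f"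
  shows "fourier_coeff f (- k) = cnj (fourier_coeff f k)"
proof -
  have "(\<lambda>x. cnj (f x)) = f"
    using assms(2) by (auto simp: real_valued_def Reals_cnj_iff)
  then show ?thesis using fourier_coeff_cnj[OF assms(1), of k] by simp
qed

lemma real_valued_trig:
  assumes "\<And>k. \<bar>k\<bar> \<le> int N \<Longrightarrow> c (- k) = cnj (c k)"
  shows "real_valued (trig N c)"
proof -
  have "cnj (trig N c x) = trig N c x" for x
  proof -
    have "cnj (trig N c x) = (\<Sum>k = - int N..int N. c (- k) * fourier_mode (- k) x)"
      unfolding trig_def cnj_sum using assms by (intro sum.cong) (auto simp: fourier_mode_minus)
    also have "\<dots> = trig N c x"
      unfolding trig_def by (rule sum.reindex_bij_witness[of _ uminus uminus]) auto
    finally show ?thesis .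
  qed
  then show ?thesis by (simp add: real_valued_def Reals_cnj_iff)
qed

lemma fdiff_diff: "fdiff (\<lambda>k. a k - b k) k = fdiff a k - fdiff b k"
  by (simp add: fdiff_def algebra_simps)

lemma rhs1_diff: "rhs1 \<gamma> \<alpha> b w k - rhs1 \<gamma> \<alpha> b' w' k = rhs1 \<gamma> \<alpha> (\<lambda>k. b k - b' k) (\<lambda>k. w k - w' k) k"
  unfolding rhs1_def fdiff_diff by (simp add: right_diff_distrib)

lemma rhs2_diff: "rhs2 \<gamma> a q k - rhs2 \<gamma> a' q' k = rhs2 \<gamma> (\<lambda>k. a k - a' k) (\<lambda>k. q k - q' k) k"
  unfolding rhs2_def fdiff_diff by (simp add: right_diff_distrib)

text \<open>\<open>c1\<close> and \<open>c3\<close> bound the three sums of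
  \<open>energy_rate_eq\<close> by multiples of the squared error plus the squared tail, and the
  prefactors are the ones found there. The last factor converts error and tail into energy and
  N^(2-2\<mu>); it contains the coercivity and the constant of \<open>reg_tail\<close>.\<close>

definition growth_const :: "real \<Rightarrow> real \<Rightarrow> real \<Rightarrow> real \<Rightarrow> real" where
  "growth_const \<gamma> \<alpha> \<mu> R = (let B = sup_const \<mu> R; c1 = (1 + 8 * (B + 1)\<^sup>2) / 2; c3 = (1 + 16 * B\<^sup>2) / 2 + B in
     (2 * (1 - \<gamma>) / \<gamma> * c1 + 1 / (\<gamma>\<^sup>2 * \<alpha>) * c1 + (\<alpha> - 1) / (\<gamma>\<^sup>2 * \<alpha>) * c3) * (1 / coercivity \<gamma> \<alpha> + 4 * pi\<^sup>2 * R))"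

text \<open>The estimate at one instant, for coefficients \<open>a\<close> and \<open>b\<close> that
  are not yet required to evolve in any way: the rates are differences of the exact and the Galerkin
  right-hand sides. Smallness of \<xi> serves to bound u_N in the sup norm.\<close>

lemma energy_rate_le:
  fixes \<zeta> u :: "real \<Rightarrow> complex" and a b :: "int \<Rightarrow> complex" and N :: nat
  defines "\<theta> \<equiv> \<lambda>k. fourier_coeff \<zeta> k - a k" and "\<xi> \<equiv> \<lambda>k. fourier_coeff u k - b k"
  assumes \<gamma>: "0 < \<gamma>" "\<gamma> < 1" and \<alpha>: "1 < \<alpha>" and \<mu>: "\<mu> > 3 / 2" and R: "0 \<le> R"
    and \<zeta>: "reg \<mu> R \<zeta>" and u: "reg \<mu> R u" and real: "real_valued u" "real_valued (trig N b)"
    and N: "N \<ge> 1" and small: "coeff_sq N \<xi> \<le> 1 / (2 * real N + 1)"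
  shows "energy_rate \<gamma> \<alpha> N \<theta> \<xi>
      (\<lambda>k. rhs1 \<gamma> \<alpha> (fourier_coeff u) (fourier_coeff (\<lambda>x. \<zeta> x * u x)) k
         - rhs1 \<gamma> \<alpha> b (fourier_coeff (\<lambda>x. trig N a x * trig N b x)) k)
      (\<lambda>k. rhs2 \<gamma> (fourier_coeff \<zeta>) (fourier_coeff (\<lambda>x. (u x)\<^sup>2)) k
         - rhs2 \<gamma> a (fourier_coeff (\<lambda>x. (trig N b x)\<^sup>2)) k)
    \<le> growth_const \<gamma> \<alpha> \<mu> R * (energy \<gamma> \<alpha> N \<theta> \<xi> + real N powr (2 - 2 * \<mu>))"
proof -
  define B where "B = sup_const \<mu> R"
  define \<tau> where "\<tau> = 4 * pi\<^sup>2 * R * real N powr (2 - 2 * \<mu>)"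
  note tail_u = reg_tail[OF \<mu> u N, folded \<tau>_def] and tail_\<zeta> = reg_tail[OF \<mu> \<zeta> N, folded \<tau>_def]
  have \<tau>0: "0 \<le> \<tau>" using R by (simp add: \<tau>_def)
  \<comment> \<open>The common majorant: squared error inside the Galerkin space plus squared tail
    outside it.\<close>
  define X where "X = coeff_sq N \<theta> + coeff_sq N \<xi> + \<tau>"
  have nn: "0 \<le> coeff_sq N c" for c by (simp add: sum_nonneg)
  have X: "coeff_sq N \<theta> \<le> X" "coeff_sq N \<xi> \<le> X" "\<tau> \<le> X" "coeff_sq N \<theta> + \<tau> \<le> X" "coeff_sq N \<xi> + \<tau> \<le> X" "0 \<le> X"
    using nn[of \<theta>] nn[of \<xi>] \<tau>0 unfolding X_def by linarith+
  define p p' s s' where "p = trig N (fourier_coeff u)" and "p' = trig N (fdiff (fourier_coeff u))"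
    and "s = trig N \<xi>" and "s' = trig N (fdiff \<xi>)"
  note sup_u = reg_sup[OF \<mu> u, folded B_def] and sup_\<zeta> = reg_sup[OF \<mu> \<zeta>, folded B_def]
  have B0: "0 \<le> B" using sup_u(1)[of 0] norm_ge_zero[of "u 0"] by linarith
  have c: "continuous_on S \<zeta>" "continuous_on S u" "continuous_on S (dx u)" "continuous_on S p" "continuous_on S p'"
      "continuous_on S s" "continuous_on S s'" for S
    unfolding p_def p'_def s_def s'_def
    using reg_continuous[OF \<mu> u] reg_continuous[OF \<mu> \<zeta>] by (auto intro: continuous_on_trig)
  have ps: "trig N b x = p x - s x" "trig N (fdiff b) x = p' x - s' x" for x
  proof -
    have "fdiff \<xi> = (\<lambda>k. fdiff (fourier_coeff u) k - fdiff b k)"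
      by (rule ext) (simp add: \<xi>_def fdiff_diff)
    then show "trig N b x = p x - s x" "trig N (fdiff b) x = p' x - s' x"
      by (simp_all add: p_def p'_def s_def s'_def \<xi>_def trig_diff)
  qed
  have sup_s: "cmod (s x) \<le> 1" for x
  proof -
    have "(2 * real N + 1) * coeff_sq N \<xi> \<le> 1"
      using small by (simp add: pos_le_divide_eq mult.commute)
    then have "sqrt ((2 * real N + 1) * coeff_sq N \<xi>) \<le> 1" by simp
    then show ?thesis unfolding s_def using cmod_trig_le[of N \<xi> x] by linarith
  qed
  have sup_uN: "cmod (trig N b x) \<le> B + 1" for x
    unfolding ps using norm_triangle_ineq4[of "p x" "s x"] sup_u(3)[of N x] sup_s[of x] by (simp add: p_def)
  have rs: "real_valued s"
  proof -
    have "real_valued p"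
      unfolding p_def by (rule real_valued_trig) (rule fourier_coeff_real[OF c(2) real(1)])
    moreover have "s x = p x - trig N b x" for x by (simp add: ps(1))
    ultimately show ?thesis using real(2) by (simp add: real_valued_def)
  qed
  have d\<zeta>: "l2sq (\<lambda>x. \<zeta> x - trig N a x) \<le> 2 * X"
  proof -
    have "l2sq (\<lambda>x. (\<zeta> x - trig N (fourier_coeff \<zeta>) x) + trig N \<theta> x)
        \<le> 2 * l2sq (\<lambda>x. \<zeta> x - trig N (fourier_coeff \<zeta>) x) + 2 * l2sq (trig N \<theta>)"
      by (intro l2sq_add_le continuous_intros c)
    also have "\<dots> \<le> 2 * \<tau> + 2 * coeff_sq N \<theta>"
      using tail_\<zeta>(1) by (simp add: l2sq_trig)
    also have "\<dots> \<le> 2 * X" using X by simp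
    finally show ?thesis by (simp add: \<theta>_def trig_diff)
  qed
  have du: "l2sq (\<lambda>x. u x - trig N b x) \<le> 2 * X"
  proof -
    have "l2sq (\<lambda>x. (u x - p x) + s x) \<le> 2 * l2sq (\<lambda>x. u x - p x) + 2 * l2sq s"
      by (intro l2sq_add_le continuous_intros c)
    also have "\<dots> \<le> 2 * \<tau> + 2 * coeff_sq N \<xi>"
      using tail_u(1) by (simp add: l2sq_trig p_def s_def)
    also have "\<dots> \<le> 2 * X" using X by simp
    finally show ?thesis by (simp add: ps(1) algebra_simps)
  qed
  \<comment> \<open>The difference of products is split as u_N (\<zeta> - \<zeta>_N) + \<zeta> (u -
    u_N), so that no sup bound on \<zeta>_N is required.\<close>
  let ?w = "\<lambda>x. \<zeta> x * u x - trig N a x * trig N b x"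
  have cw: "continuous_on {0..1} ?w" by (intro continuous_intros c)
  have lw: "l2sq ?w \<le> 8 * (B + 1)\<^sup>2 * X"
  proof -
    have "l2sq (\<lambda>x. trig N b x * (\<zeta> x - trig N a x)) \<le> (B + 1)\<^sup>2 * l2sq (\<lambda>x. \<zeta> x - trig N a x)"
      using sup_uN by (intro l2sq_mono continuous_intros c) (simp add: norm_mult mult_right_mono)
    also have "\<dots> \<le> (B + 1)\<^sup>2 * (2 * X)" by (intro mult_left_mono d\<zeta>) simp
    finally have 1: "l2sq (\<lambda>x. trig N b x * (\<zeta> x - trig N a x)) \<le> (B + 1)\<^sup>2 * (2 * X)" .
    have "cmod (\<zeta> x) \<le> B + 1" for x using sup_\<zeta>(1)[of x] by simp
    then have "l2sq (\<lambda>x. \<zeta> x * (u x - trig N b x)) \<le> (B + 1)\<^sup>2 * l2sq (\<lambda>x. u x - trig N b x)"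
      by (intro l2sq_mono continuous_intros c) (simp add: norm_mult mult_right_mono)
    also have "\<dots> \<le> (B + 1)\<^sup>2 * (2 * X)" by (intro mult_left_mono du) simp
    finally have 2: "l2sq (\<lambda>x. \<zeta> x * (u x - trig N b x)) \<le> (B + 1)\<^sup>2 * (2 * X)" .
    have "l2sq (\<lambda>x. trig N b x * (\<zeta> x - trig N a x) + \<zeta> x * (u x - trig N b x))
        \<le> 2 * l2sq (\<lambda>x. trig N b x * (\<zeta> x - trig N a x)) + 2 * l2sq (\<lambda>x. \<zeta> x * (u x - trig N b x))"
      by (intro l2sq_add_le continuous_intros c)
    also have "\<dots> \<le> 8 * (B + 1)\<^sup>2 * X" using 1 2 by linarith
    also have "(\<lambda>x. trig N b x * (\<zeta> x - trig N a x) + \<zeta> x * (u x - trig N b x)) = ?w"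
      by (rule ext) (simp add: algebra_simps)
    finally show ?thesis .
  qed
  let ?q = "\<lambda>x. (u x)\<^sup>2 - (trig N b x)\<^sup>2"
  have cq: "continuous_on {0..1} ?q" by (intro continuous_intros c)
  have lq: "l2sq ?q \<le> 8 * (B + 1)\<^sup>2 * X"
  proof -
    have "cmod (u x + trig N b x) \<le> 2 * (B + 1)" for x
      using norm_triangle_ineq[of "u x" "trig N b x"] sup_u(1)[of x] sup_uN[of x] by simp
    then have "l2sq (\<lambda>x. (u x + trig N b x) * (u x - trig N b x)) \<le> (2 * (B + 1))\<^sup>2 * l2sq (\<lambda>x. u x - trig N b x)"
      by (intro l2sq_mono continuous_intros c) (simp add: norm_mult mult_right_mono)
    also have "\<dots> \<le> (2 * (B + 1))\<^sup>2 * (2 * X)" by (intro mult_left_mono du) simp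
    also have "\<dots> = 8 * (B + 1)\<^sup>2 * X" unfolding power_mult_distrib by simp
    also have "(\<lambda>x. (u x + trig N b x) * (u x - trig N b x)) = ?q"
      by (rule ext) (simp add: algebra_simps power2_eq_square)
    finally show ?thesis .
  qed
  \<comment> \<open>The derivative of u^2 - u_N^2 with u_N = p - s. Here \<open>?G1\<close> is 2 (u
    u_x - p p'), small through the tails, and \<open>?G2\<close> is 2 (p p' - (p - s)(p' - s')),
    which contains s' and is left to \<open>cubic_pairing_le\<close>.\<close>
  let ?G1 = "\<lambda>x. 2 * (dx u x * (u x - p x)) + 2 * (p x * (dx u x - p' x))"
  let ?G2 = "\<lambda>x. 2 * (p' x * s x + p x * s' x) - 2 * (s x * s' x)"
  have cG: "continuous_on {0..1} ?G1" "continuous_on {0..1} ?G2" by (intro continuous_intros c)+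
  have lG1: "l2sq ?G1 \<le> 16 * B\<^sup>2 * X"
  proof -
    have "l2sq (\<lambda>x. 2 * (dx u x * (u x - p x))) \<le> (2 * B)\<^sup>2 * l2sq (\<lambda>x. u x - p x)"
      using sup_u(2) by (intro l2sq_mono continuous_intros c) (simp add: norm_mult mult_right_mono mult.assoc)
    also have "\<dots> \<le> (2 * B)\<^sup>2 * \<tau>"
      using tail_u(1) by (intro mult_left_mono) (simp_all add: p_def)
    finally have 1: "l2sq (\<lambda>x. 2 * (dx u x * (u x - p x))) \<le> (2 * B)\<^sup>2 * \<tau>" .
    have "l2sq (\<lambda>x. 2 * (p x * (dx u x - p' x))) \<le> (2 * B)\<^sup>2 * l2sq (\<lambda>x. dx u x - p' x)"
      using sup_u(3) by (intro l2sq_mono continuous_intros c) (simp add: p_def norm_mult mult_right_mono mult.assoc)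
    also have "\<dots> \<le> (2 * B)\<^sup>2 * \<tau>"
      using tail_u(2) by (intro mult_left_mono) (simp_all add: p'_def)
    finally have 2: "l2sq (\<lambda>x. 2 * (p x * (dx u x - p' x))) \<le> (2 * B)\<^sup>2 * \<tau>" .
    have "l2sq ?G1 \<le> 2 * l2sq (\<lambda>x. 2 * (dx u x * (u x - p x))) + 2 * l2sq (\<lambda>x. 2 * (p x * (dx u x - p' x)))"
      by (intro l2sq_add_le continuous_intros c)
    also have "\<dots> \<le> 4 * ((2 * B)\<^sup>2 * \<tau>)" using 1 2 by linarith
    also have "\<dots> \<le> 4 * ((2 * B)\<^sup>2 * X)" using X by (intro mult_left_mono) auto
    also have "\<dots> = 16 * B\<^sup>2 * X" unfolding power_mult_distrib by simp
    finally show ?thesis .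
  qed
  have fw: "(\<lambda>k. fourier_coeff (\<lambda>x. \<zeta> x * u x) k - fourier_coeff (\<lambda>x. trig N a x * trig N b x) k)
      = fourier_coeff ?w"
    by (rule ext, rule fourier_coeff_diff[symmetric]) (intro continuous_intros c)+
  have fq: "(\<lambda>k. fourier_coeff (\<lambda>x. (u x)\<^sup>2) k - fourier_coeff (\<lambda>x. (trig N b x)\<^sup>2) k) = fourier_coeff ?q"
    by (rule ext, rule fourier_coeff_diff[symmetric]) (intro continuous_intros c)+
  have dq: "fdiff (fourier_coeff ?q) k = fourier_coeff ?G1 k + fourier_coeff ?G2 k" for k
  proof -
    have "(?q has_vector_derivative ?G1 x + ?G2 x) (at x)" for x
    proof -
      have "(?q has_vector_derivative (u x * dx u x + dx u x * u x)
          - (trig N b x * trig N (fdiff b) x + trig N (fdiff b) x * trig N b x)) (at x)"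
        unfolding power2_eq_square
        by (intro has_vector_derivative_diff has_vector_derivative_mult reg_dx_deriv[OF \<mu> u]
            has_vector_derivative_trig)
      moreover have "(u x * dx u x + dx u x * u x) - (trig N b x * trig N (fdiff b) x + trig N (fdiff b) x *
          trig N b x) = ?G1 x + ?G2 x"
        unfolding ps by (simp add: algebra_simps)
      ultimately show ?thesis by simp
    qed
    moreover have "periodic1 ?q"
      using u periodic1_trig[of N b] by (simp add: reg_def periodic1_def)
    moreover have "continuous_on {0..1} (\<lambda>x. ?G1 x + ?G2 x)" by (intro continuous_on_add cG)
    ultimately have "fourier_coeff (\<lambda>x. ?G1 x + ?G2 x) k = fdiff (fourier_coeff ?q) k"
      by (intro fourier_coeff_deriv)
    moreover have "fourier_coeff (\<lambda>x. ?G1 x + ?G2 x) k = fourier_coeff ?G1 k + fourier_coeff ?G2 k"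
      by (rule fourier_coeff_add[OF cG])
    ultimately show ?thesis by simp
  qed
  define c1 where "c1 = (1 + 8 * (B + 1)\<^sup>2) / 2"
  define c3 where "c3 = (1 + 16 * B\<^sup>2) / 2 + B"
  have S1: "(\<Sum>k = - int N..int N. j_symbol \<gamma> \<alpha> k * Re (cnj (\<theta> k) * fdiff (fourier_coeff ?w) k)) \<le> c1 * X"
    using j_symbol_pairing_le[OF cw \<gamma> \<alpha>, where N = N and c = \<theta>] lw X(1) unfolding c1_def by (simp add: field_simps)
  have S2: "(\<Sum>k = - int N..int N. j_symbol \<gamma> \<alpha> k * Re (cnj (\<xi> k) * fdiff (fourier_coeff ?q) k)) \<le> c1 * X"
    using j_symbol_pairing_le[OF cq \<gamma> \<alpha>, where N = N and c = \<xi>] lq X(2) unfolding c1_def by (simp add: field_simps)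
  have S3: "(\<Sum>k = - int N..int N. Re (cnj (\<xi> k) * fdiff (fourier_coeff ?q) k)) \<le> c3 * X"
  proof -
    have 1: "(\<Sum>k = - int N..int N. Re (cnj (\<xi> k) * fourier_coeff ?G1 k)) \<le> (X + 16 * B\<^sup>2 * X) / 2"
      by (rule order_trans[OF pairing_le[OF cG(1)]]) (intro divide_right_mono add_mono lG1 X(2), simp)
    have "(\<Sum>k = - int N..int N. Re (cnj (\<xi> k) * fourier_coeff ?G2 k)) \<le> B * coeff_sq N \<xi>"
      unfolding p_def p'_def s_def s'_def
      by (rule cubic_pairing_le) (use rs sup_u(4) in \<open>simp_all add: s_def\<close>)
    also have "\<dots> \<le> B * X" by (intro mult_left_mono X B0)
    finally have 2: "(\<Sum>k = - int N..int N. Re (cnj (\<xi> k) * fourier_coeff ?G2 k)) \<le> B * X" .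
    have "(\<Sum>k = - int N..int N. Re (cnj (\<xi> k) * fdiff (fourier_coeff ?q) k))
        = (\<Sum>k = - int N..int N. Re (cnj (\<xi> k) * fourier_coeff ?G1 k)) + (\<Sum>k =
            - int N..int N. Re (cnj (\<xi> k) * fourier_coeff ?G2 k))"
      unfolding dq distrib_left plus_complex.sel by (rule sum.distrib)
    also have "\<dots> \<le> (X + 16 * B\<^sup>2 * X) / 2 + B * X" using 1 2 by linarith
    also have "\<dots> = c3 * X" unfolding c3_def by (simp add: field_simps)
    finally show ?thesis .
  qed
  define K0 where "K0 = 2 * (1 - \<gamma>) / \<gamma> * c1 + 1 / (\<gamma>\<^sup>2 * \<alpha>) * c1 + (\<alpha> - 1) / (\<gamma>\<^sup>2 * \<alpha>) * c3"
  have K0: "0 \<le> K0"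
    using \<gamma> \<alpha> B0 by (simp add: K0_def c1_def c3_def)
  have "energy_rate \<gamma> \<alpha> N \<theta> \<xi> (rhs1 \<gamma> \<alpha> \<xi> (fourier_coeff ?w)) (rhs2 \<gamma> \<theta> (fourier_coeff ?q)) \<le>
      2 * (1 - \<gamma>) / \<gamma> * (c1 * X) + 1 / (\<gamma>\<^sup>2 * \<alpha>) * (c1 * X) + (\<alpha> - 1) / (\<gamma>\<^sup>2 * \<alpha>) * (c3 * X)"
    unfolding energy_rate_eq[OF \<gamma> \<alpha>] using \<gamma> \<alpha>
    by (intro add_mono mult_left_mono S1 S2 S3) auto
  also have "\<dots> = K0 * X" by (simp add: K0_def algebra_simps)
  also have "\<dots> \<le> K0 * ((1 / coercivity \<gamma> \<alpha> + 4 * pi\<^sup>2 * R) * (energy \<gamma> \<alpha> N \<theta> \<xi> + real N powr (2 - 2 * \<mu>)))"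
  proof (intro mult_left_mono K0)
    have c0: "0 < coercivity \<gamma> \<alpha>" by (rule coercivity_pos[OF \<gamma> \<alpha>])
    have "coeff_sq N \<theta> + coeff_sq N \<xi> \<le> 1 / coercivity \<gamma> \<alpha> * energy \<gamma> \<alpha> N \<theta> \<xi>"
      using energy_ge[OF \<gamma> \<alpha>, where N = N and \<theta> = \<theta> and \<xi> = \<xi>] c0 by (simp add: field_simps)
    moreover have "0 \<le> 1 / coercivity \<gamma> \<alpha> * real N powr (2 - 2 * \<mu>)" using c0 by simp
    moreover have "0 \<le> 4 * pi\<^sup>2 * R * energy \<gamma> \<alpha> N \<theta> \<xi>"
    proof -
      have "0 \<le> coercivity \<gamma> \<alpha> * (coeff_sq N \<theta> + coeff_sq N \<xi>)"
        using c0 by (simp add: sum_nonneg)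
      then have "0 \<le> energy \<gamma> \<alpha> N \<theta> \<xi>"
        using energy_ge[OF \<gamma> \<alpha>, where N = N and \<theta> = \<theta> and \<xi> = \<xi>] by linarith
      then show ?thesis using R by simp
    qed
    ultimately show "X \<le> (1 / coercivity \<gamma> \<alpha> + 4 * pi\<^sup>2 * R) * (energy \<gamma> \<alpha> N \<theta> \<xi> + real N powr (2 - 2 * \<mu>))"
      unfolding X_def \<tau>_def distrib_left distrib_right by linarith
  qed
  also have "\<dots> = growth_const \<gamma> \<alpha> \<mu> R * (energy \<gamma> \<alpha> N \<theta> \<xi> + real N powr (2 - 2 * \<mu>))"
    by (simp add: growth_const_def Let_def K0_def c1_def c3_def B_def mult.assoc)
  finally show ?thesis
    unfolding rhs1_diff rhs2_diff fw fq \<theta>_def \<xi>_def .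
qed

section \<open>The Galerkin system in Fourier space\<close>

text \<open>A geometric sum over powers of a root of unity; for l nonzero, |l| < n keeps the ratio
  different from 1.\<close>

lemma sum_fourier_mode_nodes:
  fixes n :: nat and l :: int
  assumes "\<bar>l\<bar> < int n"
  shows "(\<Sum>j<n. fourier_mode l (real j / real n)) = (if l = 0 then of_nat n else 0)"
proof (cases "l = 0")
  case False
  have n: "n > 0" using assms by linarith
  define z where "z = fourier_mode l (1 / real n)"
  have zj: "fourier_mode l (real j / real n) = z ^ j" for j
    by (simp add: z_def fourier_mode_def field_simps flip: exp_of_nat_mult)
  have "\<bar>real_of_int l / real n\<bar> < 1"
    using assms n by (simp add: abs_divide)
  from fourier_mode_1_eq_1_iff[OF this] have "fourier_mode 1 (real_of_int l / real n) \<noteq> 1"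
    using False n by simp
  moreover have "fourier_mode 1 (real_of_int l / real n) = z"
    by (simp add: z_def fourier_mode_def)
  ultimately have "z \<noteq> 1" by simp
  moreover have "z ^ n = 1"
    using zj[of n] n by simp
  ultimately show ?thesis using False by (simp add: zj geometric_sum)
qed simp

text \<open>
  The coefficients of a trigonometric polynomial are finite combinations of its values, so
  pointwise differentiability in time passes to them.
\<close>

lemma trig_coeff_nodes:
  assumes "\<bar>k\<bar> \<le> int N"
  shows "(\<Sum>j<2 * N + 1. fourier_mode (- k) (real j / real (2 * N + 1)) * trig N c (real j / real (2 * N + 1)))
    = of_nat (2 * N + 1) * c k"
proof -
  let ?x = "\<lambda>j. real j / real (2 * N + 1)"
  have "(\<Sum>j<2 * N + 1. fourier_mode (- k) (?x j) * trig N c (?x j))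
      = (\<Sum>j<2 * N + 1. \<Sum>l = - int N..int N. c l * fourier_mode (l - k) (?x j))"
  proof -
    have "fourier_mode (- k) x * fourier_mode l x = fourier_mode (l - k) x" for l x
      using fourier_mode_add[of "- k" l x] by simp
    then have "fourier_mode (- k) x * (c l * fourier_mode l x) = c l * fourier_mode (l - k) x" for l x
      by (metis mult.left_commute)
    then show ?thesis unfolding trig_def sum_distrib_left by (intro sum.cong refl)
  qed
  also have "\<dots> = (\<Sum>l = - int N..int N. c l * (\<Sum>j<2 * N + 1. fourier_mode (l - k) (?x j)))"
    by (subst sum.swap) (simp only: sum_distrib_left)
  also have "\<dots> = (\<Sum>l = - int N..int N. if l = k then of_nat (2 * N + 1) * c k else 0)"
  proof (rule sum.cong[OF refl])
    fix l assume "l \<in> {- int N..int N}"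
    \<comment> \<open>Two modes of the polynomial differ by at most 2N, so 2N + 1 nodes separate
      them without aliasing.\<close>
    then have "\<bar>l - k\<bar> < int (2 * N + 1)" using assms by auto
    from sum_fourier_mode_nodes[OF this]
    show "c l * (\<Sum>j<2 * N + 1. fourier_mode (l - k) (?x j)) = (if l = k then of_nat (2 * N + 1) * c k else 0)"
      by (simp only:) simp
  qed
  also have "\<dots> = of_nat (2 * N + 1) * c k" using assms by (subst sum.delta) auto
  finally show ?thesis .
qed

section \<open>The Galerkin equations in terms of coefficients\<close>

lemma trig_cong: "(\<And>k. \<bar>k\<bar> \<le> int N \<Longrightarrow> c k = d k) \<Longrightarrow> trig N c = trig N d"
  unfolding trig_def by (intro ext sum.cong) auto

lemma trig_fourier_coeff_trig: "trig N (fourier_coeff (trig N c)) = trig N c"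
  by (rule trig_cong) (simp add: fourier_coeff_trig)

lemma dx_trig: "dx (trig N c) = trig N (fdiff c)"
  by (rule ext) (simp add: dx_def vector_derivative_at[OF has_vector_derivative_trig])

lemma P_proj_eq: "P_proj N v = trig N (fourier_coeff v)"
  by (rule ext) (simp add: P_proj_def trig_def)

lemma fourier_multiplier_trig:
  "fourier_multiplier m (trig N c) = trig N (\<lambda>k. of_real (m (2 * pi * real_of_int k)) * c k)"
proof
  fix x
  have "((\<lambda>k. of_real (m (2 * pi * real_of_int k)) * fourier_coeff (trig N c) k * fourier_mode k x) has_sum
      trig N (\<lambda>k. of_real (m (2 * pi * real_of_int k)) * c k) x) UNIV"
    unfolding trig_def[of N "\<lambda>k. of_real (m (2 * pi * real_of_int k)) * c k"]
    by (rule has_sum_finite_neutralI[of "{- int N..int N}"]) (auto simp: fourier_coeff_trig intro!: sum.cong)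
  then show "fourier_multiplier m (trig N c) x = trig N (\<lambda>k. of_real (m (2 * pi * real_of_int k)) * c k) x"
    unfolding fourier_multiplier_def by (rule infsumI)
qed

lemma trig_lincomb: "trig N (\<lambda>k. r * a k - s * b k) x = r * trig N a x - s * trig N b x"
  by (simp add: trig_def sum_subtractf sum_distrib_left algebra_simps)

lemma trig_rhs1:
  assumes g: "\<And>\<xi>. g \<xi> = \<alpha> / \<gamma> * \<bar>\<xi>\<bar>"
  shows "trig N (rhs1 \<gamma> \<alpha> b w) x = of_real (1 / \<gamma>) * fourier_multiplier (\<lambda>\<xi>. 1 / (1 + g \<xi>)) (trig N (fdiff w)) x
    - of_real (1 / \<gamma>) * fourier_multiplier (\<lambda>\<xi>. 1 / (1 + g \<xi>) * (1 + (\<alpha> - 1) / \<alpha> * g \<xi>)) (trig N (fdiff b)) x"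
  unfolding fourier_multiplier_trig g m_symbol_def [symmetric]
  unfolding j_symbol_def [symmetric] trig_lincomb [symmetric] rhs1_def [symmetric]
  by (rule refl)

lemma trig_rhs2: "trig N (rhs2 \<gamma> a q) x = of_real (1 / (2 * \<gamma>)) * trig N (fdiff q) x - of_real (1
    - \<gamma>) * trig N (fdiff a) x"
  unfolding trig_lincomb [symmetric] rhs2_def [symmetric] by (rule refl)

definition gal_ode :: "real \<Rightarrow> real \<Rightarrow> real \<Rightarrow> nat \<Rightarrow> (real \<Rightarrow> int \<Rightarrow> complex) \<Rightarrow> (real \<Rightarrow> int \<Rightarrow> complex) \<Rightarrow> bool" where
  "gal_ode \<gamma> \<alpha> T N a b \<longleftrightarrow> (\<forall>t\<in>{0..T}. \<forall>k. \<bar>k\<bar> \<le> int N \<longrightarrow>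
     ((\<lambda>s. a s k) has_vector_derivative rhs1 \<gamma> \<alpha> (b t) (fourier_coeff (\<lambda>x. trig N (a t) x * trig N (b t) x))
         k) (at t within {0..T}) \<and>
     ((\<lambda>s. b s k) has_vector_derivative rhs2 \<gamma> (a t) (fourier_coeff (\<lambda>x. (trig N (b t) x)\<^sup>2)) k) (at t
         within {0..T}))"

lemma has_dt_trig:
  assumes "\<And>t k. t \<in> {0..T} \<Longrightarrow> \<bar>k\<bar> \<le> int N \<Longrightarrow> ((\<lambda>s. a s k) has_vector_derivative a' t k) (at t within {0..T})"
  shows "has_dt T (\<lambda>t. trig N (a t)) (\<lambda>t. trig N (a' t))"
  unfolding has_dt_def trig_def
  by (intro ballI allI has_vector_derivative_sum has_vector_derivative_mult_left assms) auto

lemma galerkin_solutionI: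
  assumes g: "\<And>\<xi>. g \<xi> = \<alpha> / \<gamma> * \<bar>\<xi>\<bar>" and ode: "gal_ode \<gamma> \<alpha> T N a b"
    and real: "\<And>t. t \<in> {0..T} \<Longrightarrow> real_valued (trig N (a t)) \<and> real_valued (trig N (b t))"
    and init: "\<And>k. \<bar>k\<bar> \<le> int N \<Longrightarrow> a 0 k = fourier_coeff \<zeta>0 k" "\<And>k. \<bar>k\<bar> \<le> int N \<Longrightarrow> b 0 k = fourier_coeff u0 k"
  shows "galerkin_solution \<gamma> \<alpha> g T N \<zeta>0 u0 (\<lambda>t. trig N (a t)) (\<lambda>t. trig N (b t))"
  unfolding galerkin_solution_def
proof (intro conjI)
  show "\<forall>t\<in>{0..T}. trig N (a t) \<in> S_space N \<and> trig N (b t) \<in> S_space N"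
    unfolding S_space_def trig_eq_fourier_sum by auto
  show "\<forall>t\<in>{0..T}. real_valued (trig N (a t)) \<and> real_valued (trig N (b t))" using real by blast
  show "trig N (a 0) = P_proj N \<zeta>0" "trig N (b 0) = P_proj N u0"
    unfolding P_proj_eq using init by (auto intro!: trig_cong)
  let ?a' = "\<lambda>t. trig N (rhs1 \<gamma> \<alpha> (b t) (fourier_coeff (\<lambda>x. trig N (a t) x * trig N (b t) x)))"
  let ?b' = "\<lambda>t. trig N (rhs2 \<gamma> (a t) (fourier_coeff (\<lambda>x. (trig N (b t) x)\<^sup>2)))"
  have "has_dt T (\<lambda>t. trig N (a t)) ?a'" "has_dt T (\<lambda>t. trig N (b t)) ?b'"
    using ode unfolding gal_ode_def by (auto intro!: has_dt_trig)
  then show "\<exists>\<zeta>t ut. has_dt T (\<lambda>t. trig N (a t)) \<zeta>t \<and> has_dt T (\<lambda>t. trig N (b t)) ut \<and>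
       (\<forall>t\<in>{0..T}. \<forall>x.
          \<zeta>t t x + of_real (1 / \<gamma>) *
              fourier_multiplier (\<lambda>\<xi>. 1 / (1 + g \<xi>) * (1 + (\<alpha> - 1) / \<alpha> * g \<xi>)) (dx (trig N (b t))) x
            = of_real (1 / \<gamma>) *
              fourier_multiplier (\<lambda>\<xi>. 1 / (1 + g \<xi>)) (dx (P_proj N (\<lambda>y. trig N (a t) y * trig N (b t) y))) x \<and>
          ut t x + of_real (1 - \<gamma>) * dx (trig N (a t)) x
            = of_real (1 / (2 * \<gamma>)) * dx (P_proj N (\<lambda>y. (trig N (b t) y)\<^sup>2)) x)"
    by (intro exI[of _ ?a'] exI[of _ ?b'] conjI ballI allI)
       (simp_all only: trig_rhs1[OF g] trig_rhs2 P_proj_eq dx_trig diff_add_cancel)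
qed

lemma trig_coeff_has_derivative:
  assumes dt: "has_dt T v (\<lambda>t. trig N (c' t))" and v: "\<And>t. t \<in> {0..T} \<Longrightarrow> v t = trig N (c t)"
    and t: "t \<in> {0..T}" and k: "\<bar>k\<bar> \<le> int N"
  shows "((\<lambda>s. c s k) has_vector_derivative c' t k) (at t within {0..T})"
proof -
  define n where "n = 2 * N + 1"
  have n: "n > 0" by (simp add: n_def)
  have node: "(\<Sum>j<n. fourier_mode (- k) (real j / real n) * trig N c (real j / real n)) = of_nat n * c k" for c
    unfolding n_def by (rule trig_coeff_nodes[OF k])
  have "((\<lambda>s. 1 / of_nat n * (\<Sum>j<n. fourier_mode (- k) (real j / real n) * v s (real j / real n)))
      has_vector_derivative
     1 / of_nat n * (\<Sum>j<n. fourier_mode (- k) (real j / real n) * trig N (c' t) (real j / real n))) (at t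
         within {0..T})"
    using dt t unfolding has_dt_def by (intro has_vector_derivative_mult_right has_vector_derivative_sum) blast
  moreover have "1 / of_nat n * (\<Sum>j<n. fourier_mode (- k) (real j / real n) * trig N (c' t) (real j / real
      n)) = c' t k"
    unfolding node using n by simp
  ultimately have D: "((\<lambda>s. 1 / of_nat n * (\<Sum>j<n. fourier_mode (- k) (real j / real n) * v s (real j / real
      n))) has_vector_derivative c' t k) (at t within {0..T})"
    by simp
  show ?thesis
  proof (rule has_vector_derivative_transform[OF t _ D])
    fix s assume "s \<in> {0..T}"
    then show "c s k = 1 / of_nat n * (\<Sum>j<n. fourier_mode (- k) (real j / real n) * v s (real j / real n))"
      using n by (simp only: v node) simp
  qed
qed

lemma galerkin_solutionD:
  assumes g: "\<And>\<xi>. g \<xi> = \<alpha> / \<gamma> * \<bar>\<xi>\<bar>" and sol: "galerkin_solution \<gamma> \<alpha> g T N \<zeta>0 u0 \<zeta>N uN" and T: "0 \<le> T"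
  obtains a b where "gal_ode \<gamma> \<alpha> T N a b"
    "\<And>t. t \<in> {0..T} \<Longrightarrow> \<zeta>N t = trig N (a t)" "\<And>t. t \<in> {0..T} \<Longrightarrow> uN t = trig N (b t)"
    "\<And>t. t \<in> {0..T} \<Longrightarrow> real_valued (trig N (b t))"
    "\<And>k. \<bar>k\<bar> \<le> int N \<Longrightarrow> a 0 k = fourier_coeff \<zeta>0 k" "\<And>k. \<bar>k\<bar> \<le> int N \<Longrightarrow> b 0 k = fourier_coeff u0 k"
proof -
  define a where "a t = fourier_coeff (\<zeta>N t)" for t
  define b where "b t = fourier_coeff (uN t)" for t
  have a: "\<zeta>N t = trig N (a t)" and b: "uN t = trig N (b t)" if t: "t \<in> {0..T}" for t
  proof -
    obtain c d where "\<zeta>N t = trig N c" "uN t = trig N d"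
      using sol t unfolding galerkin_solution_def S_space_def trig_eq_fourier_sum by blast
    then show "\<zeta>N t = trig N (a t)" "uN t = trig N (b t)"
      by (simp_all add: a_def b_def trig_fourier_coeff_trig)
  qed
  obtain \<zeta>t ut where dt: "has_dt T \<zeta>N \<zeta>t" "has_dt T uN ut"
    and eq1: "\<And>t x. t \<in> {0..T} \<Longrightarrow> \<zeta>t t x + of_real (1 / \<gamma>) *
              fourier_multiplier (\<lambda>\<xi>. 1 / (1 + g \<xi>) * (1 + (\<alpha> - 1) / \<alpha> * g \<xi>)) (dx (uN t)) x
            = of_real (1 / \<gamma>) *
              fourier_multiplier (\<lambda>\<xi>. 1 / (1 + g \<xi>)) (dx (P_proj N (\<lambda>y. \<zeta>N t y * uN t y))) x"
    and eq2: "\<And>t x. t \<in> {0..T} \<Longrightarrow> ut t x + of_real (1 - \<gamma>) * dx (\<zeta>N t) x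
        = of_real (1 / (2 * \<gamma>)) * dx (P_proj N (\<lambda>y. (uN t y)\<^sup>2)) x"
    using sol unfolding galerkin_solution_def by blast
  define a' where "a' t = rhs1 \<gamma> \<alpha> (b t) (fourier_coeff (\<lambda>x. trig N (a t) x * trig N (b t) x))" for t
  define b' where "b' t = rhs2 \<gamma> (a t) (fourier_coeff (\<lambda>x. (trig N (b t) x)\<^sup>2))" for t
  have "\<zeta>t t = trig N (a' t)" "ut t = trig N (b' t)" if t: "t \<in> {0..T}" for t
  proof -
    show "\<zeta>t t = trig N (a' t)"
      using eq1[OF t] by (intro ext) (simp only: a'_def trig_rhs1[OF g] a[OF t] b[OF t] P_proj_eq dx_trig
          eq_diff_eq)
    show "ut t = trig N (b' t)"
      using eq2[OF t] by (intro ext) (simp only: b'_def trig_rhs2 a[OF t] b[OF t] P_proj_eq dx_trig eq_diff_eq)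
  qed
  then have dt': "has_dt T \<zeta>N (\<lambda>t. trig N (a' t))" "has_dt T uN (\<lambda>t. trig N (b' t))"
    using dt unfolding has_dt_def by simp_all
  show ?thesis
  proof (rule that[of a b])
    show "gal_ode \<gamma> \<alpha> T N a b"
      unfolding gal_ode_def a'_def [symmetric] b'_def [symmetric]
      using trig_coeff_has_derivative[OF dt'(1) a] trig_coeff_has_derivative[OF dt'(2) b] by blast
    show "real_valued (trig N (b t))" if "t \<in> {0..T}" for t
      using sol that unfolding galerkin_solution_def b[OF that, symmetric] by blast
    have "\<zeta>N 0 = P_proj N \<zeta>0" "uN 0 = P_proj N u0" using sol unfolding galerkin_solution_def by blast+
    then show "\<And>k. \<bar>k\<bar> \<le> int N \<Longrightarrow> a 0 k = fourier_coeff \<zeta>0 k" "\<And>k. \<bar>k\<bar> \<le> int N \<Longrightarrow> b 0 k = fourier_coeff u0 k"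
      by (simp_all add: a_def b_def P_proj_eq fourier_coeff_trig)
  qed (rule a b, assumption)+
qed

section \<open>The truncated Galerkin system\<close>

text \<open>Clipping acts separately on real and imaginary part. It fixes the disc of radius r and,
  for r \<ge> 0, commutes with conjugation; using a square instead of a disc costs only factors 2 in
  the estimates.\<close>

definition trunc :: "real \<Rightarrow> complex \<Rightarrow> complex" where
  "trunc r z = Complex (max (- r) (min r (Re z))) (max (- r) (min r (Im z)))"

lemma trunc_eq:
  assumes "cmod z \<le> r"
  shows "trunc r z = z"
proof -
  have "max (- r) (min r x) = x" if "\<bar>x\<bar> \<le> r" for x :: real
    using that by linarith
  then show ?thesis
    using assms abs_Re_le_cmod[of z] abs_Im_le_cmod[of z] by (simp add: trunc_def)
qed

lemma trunc_cnj:
  assumes "0 \<le> r"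
  shows "trunc r (cnj z) = cnj (trunc r z)"
proof -
  have "max (- r) (min r (- x)) = - max (- r) (min r x)" for x :: real
    using assms by linarith
  then show ?thesis by (simp add: trunc_def complex_eq_iff)
qed

lemma trunc_bound:
  assumes "0 \<le> r"
  shows "cmod (trunc r z) \<le> 2 * r"
proof -
  define h where "h x = max (- r) (min r x)" for x
  have h: "\<bar>h x\<bar> \<le> r" for x
    unfolding h_def using assms by linarith
  have "trunc r z = Complex (h (Re z)) (h (Im z))" by (simp only: trunc_def h_def)
  then show ?thesis
    using cmod_le[of "trunc r z"] h[of "Re z"] h[of "Im z"] by simp
qed

lemma trunc_lipschitz: "cmod (trunc r z - trunc r w) \<le> 2 * cmod (z - w)"
proof -
  define h where "h x = max (- r) (min r x)" for x
  have h: "\<bar>h x - h y\<bar> \<le> \<bar>x - y\<bar>" for x y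
    unfolding h_def by linarith
  have "trunc r z = Complex (h (Re z)) (h (Im z))" for z by (simp only: trunc_def h_def)
  then have "cmod (trunc r z - trunc r w) \<le> \<bar>h (Re z) - h (Re w)\<bar> + \<bar>h (Im z) - h (Im w)\<bar>"
    using cmod_le[of "trunc r z - trunc r w"] by simp
  moreover have "\<bar>Re z - Re w\<bar> \<le> cmod (z - w)" "\<bar>Im z - Im w\<bar> \<le> cmod (z - w)"
    using abs_Re_le_cmod[of "z - w"] abs_Im_le_cmod[of "z - w"] by simp_all
  ultimately show ?thesis
    using h[of "Re z" "Re w"] h[of "Im z" "Im w"] by linarith
qed

text \<open>Global Lipschitz continuity in the coordinates from \<open>K\<close> with an unspecified
  constant, so that a vector field can be treated by closure rules; constants are made explicit
  once, in \<open>trunc_field_lipschitz\<close>.\<close>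

definition lip :: "int set \<Rightarrow> ((int \<Rightarrow> complex \<times> complex) \<Rightarrow> 'b::real_normed_vector) \<Rightarrow> bool" where
  "lip K f \<longleftrightarrow> (\<exists>L\<ge>0. \<forall>y z. norm (f y - f z) \<le> L * (\<Sum>j\<in>K. norm (y j - z j)))"

lemma lipI: "0 \<le> L \<Longrightarrow> (\<And>y z. norm (f y - f z) \<le> L * (\<Sum>j\<in>K. norm (y j - z j))) \<Longrightarrow> lip K f"
  unfolding lip_def by blast

lemma lip_const: "lip K (\<lambda>y. c)"
  by (rule lipI[of 0]) auto

lemma lip_add: "lip K f \<Longrightarrow> lip K g \<Longrightarrow> lip K (\<lambda>y. f y + g y)"
proof -
  assume "lip K f" "lip K g"
  then obtain L M where L: "0 \<le> L" "\<And>y z. norm (f y - f z) \<le> L * (\<Sum>j\<in>K. norm (y j - z j))"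
    and M: "0 \<le> M" "\<And>y z. norm (g y - g z) \<le> M * (\<Sum>j\<in>K. norm (y j - z j))"
    unfolding lip_def by blast
  show ?thesis
  proof (rule lipI[of "L + M"])
    fix y z
    show "norm (f y + g y - (f z + g z)) \<le> (L + M) * (\<Sum>j\<in>K. norm (y j - z j))"
      unfolding add_diff_add distrib_right by (rule norm_triangle_mono[OF L(2) M(2)])
  qed (use L M in simp)
qed

lemma lip_bounded_linear:
  assumes h: "bounded_linear h" and "lip K f"
  shows "lip K (\<lambda>y. h (f y))"
proof -
  obtain L where L: "0 \<le> L" "\<And>y z. norm (f y - f z) \<le> L * (\<Sum>j\<in>K. norm (y j - z j))"
    using assms(2) unfolding lip_def by blast
  obtain C where C: "0 \<le> C" "\<And>x. norm (h x) \<le> norm x * C"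
    using bounded_linear.nonneg_bounded[OF h] by blast
  show ?thesis
  proof (rule lipI[of "L * C"])
    fix y z
    have "norm (h (f y) - h (f z)) \<le> norm (f y - f z) * C"
      using C(2)[of "f y - f z"] by (simp add: linear_diff[OF bounded_linear.linear[OF h]])
    also have "\<dots> \<le> L * (\<Sum>j\<in>K. norm (y j - z j)) * C"
      by (intro mult_right_mono L C)
    finally show "norm (h (f y) - h (f z)) \<le> L * C * (\<Sum>j\<in>K. norm (y j - z j))" by (simp add: mult_ac)
  qed (use L C in simp)
qed

lemma lip_cmult: "lip K f \<Longrightarrow> lip K (\<lambda>y. c * f y)" for f :: "_ \<Rightarrow> complex"
  by (rule lip_bounded_linear[OF bounded_linear_mult_right])

lemma lip_diff:
  assumes "lip K f" "lip K g"
  shows "lip K (\<lambda>y. f y - g y)"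
proof -
  have "lip K (\<lambda>y. - g y)"
    by (rule lip_bounded_linear[OF bounded_linear_minus[OF bounded_linear_ident] assms(2)])
  from lip_add[OF assms(1) this] show ?thesis by (simp only: add_uminus_conv_diff)
qed

lemma lip_sum: "finite I \<Longrightarrow> (\<And>i. i \<in> I \<Longrightarrow> lip K (f i)) \<Longrightarrow> lip K (\<lambda>y. \<Sum>i\<in>I. f i y)"
  by (induction I rule: finite_induct) (simp_all add: lip_const lip_add)

text \<open>Boundedness of both factors is what makes a product globally Lipschitz, and it is the
  purpose of the clipping.\<close>

lemma lip_mult:
  fixes f g :: "(int \<Rightarrow> complex \<times> complex) \<Rightarrow> complex"
  assumes "lip K f" "lip K g" and f: "\<And>y. cmod (f y) \<le> r" and g: "\<And>y. cmod (g y) \<le> r"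
  shows "lip K (\<lambda>y. f y * g y)"
proof -
  obtain L M where L: "0 \<le> L" "\<And>y z. norm (f y - f z) \<le> L * (\<Sum>j\<in>K. norm (y j - z j))"
    and M: "0 \<le> M" "\<And>y z. norm (g y - g z) \<le> M * (\<Sum>j\<in>K. norm (y j - z j))"
    using assms(1,2) unfolding lip_def by blast
  have r: "0 \<le> r" using order_trans[OF norm_ge_zero f] by blast
  show ?thesis
  proof (rule lipI[of "r * M + r * L"])
    fix y z
    have "f y * g y - f z * g z = f y * (g y - g z) + g z * (f y - f z)" by (simp add: algebra_simps)
    also have "cmod \<dots> \<le> r * (M * (\<Sum>j\<in>K. norm (y j - z j))) + r * (L * (\<Sum>j\<in>K. norm (y j - z j)))"
      by (rule norm_triangle_mono) (unfold norm_mult, (intro mult_mono f g L M r norm_ge_zero)+)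
    finally show "cmod (f y * g y - f z * g z) \<le> (r * M + r * L) * (\<Sum>j\<in>K. norm (y j - z j))"
      by (simp add: distrib_right mult.assoc)
  qed (use L M r in simp)
qed

lemma lip_trunc: "lip K f \<Longrightarrow> lip K (\<lambda>y. trunc r (f y))"
proof -
  assume "lip K f"
  then obtain L where L: "0 \<le> L" "\<And>y z. norm (f y - f z) \<le> L * (\<Sum>j\<in>K. norm (y j - z j))"
    unfolding lip_def by blast
  show ?thesis
  proof (rule lipI[of "2 * L"])
    fix y z
    show "cmod (trunc r (f y) - trunc r (f z)) \<le> 2 * L * (\<Sum>j\<in>K. norm (y j - z j))"
      using trunc_lipschitz[of r "f y" "f z"] mult_left_mono[OF L(2)[of y z], of 2] by (simp add: mult.assoc)
  qed (use L in simp)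
qed

lemma lip_coord:
  assumes "finite K" "k \<in> K"
  shows "lip K (\<lambda>y. y k)"
proof (rule lipI[of 1])
  fix y z :: "int \<Rightarrow> complex \<times> complex"
  show "norm (y k - z k) \<le> 1 * (\<Sum>j\<in>K. norm (y j - z j))"
    using member_le_sum[of k K "\<lambda>j. norm (y j - z j)"] assms by simp
qed simp

lemma lip_fst: "finite K \<Longrightarrow> k \<in> K \<Longrightarrow> lip K (\<lambda>y. fst (y k))"
  and lip_snd: "finite K \<Longrightarrow> k \<in> K \<Longrightarrow> lip K (\<lambda>y. snd (y k))"
  by (simp_all add: lip_bounded_linear[OF bounded_linear_fst lip_coord] lip_bounded_linear[OF
      bounded_linear_snd lip_coord])

lemma lip_Pair: "lip K f \<Longrightarrow> lip K g \<Longrightarrow> lip K (\<lambda>y. (f y, g y))"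
proof -
  assume "lip K f" "lip K g"
  then obtain L M where L: "0 \<le> L" "\<And>y z. norm (f y - f z) \<le> L * (\<Sum>j\<in>K. norm (y j - z j))"
    and M: "0 \<le> M" "\<And>y z. norm (g y - g z) \<le> M * (\<Sum>j\<in>K. norm (y j - z j))"
    unfolding lip_def by blast
  show ?thesis
  proof (rule lipI[of "L + M"])
    fix y z
    have "norm ((f y, g y) - (f z, g z)) \<le> norm (f y - f z) + norm (g y - g z)"
      by (simp add: norm_Pair_le)
    then show "norm ((f y, g y) - (f z, g z)) \<le> (L + M) * (\<Sum>j\<in>K. norm (y j - z j))"
      using L(2)[of y z] M(2)[of y z] unfolding distrib_right by linarith
  qed (use L M in simp)
qed

lemma fourier_coeff_sum:
  assumes "finite I" "\<And>i. i \<in> I \<Longrightarrow> continuous_on {0..1} (f i)"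
  shows "fourier_coeff (\<lambda>x. \<Sum>i\<in>I. f i x) k = (\<Sum>i\<in>I. fourier_coeff (f i) k)"
  using assms
proof (induction I rule: finite_induct)
  case empty
  then show ?case by (simp add: fourier_coeff_def)
next
  case (insert i I)
  then show ?case by (simp add: fourier_coeff_add continuous_on_sum)
qed

text \<open>A finite convolution, written with an indicator so that it is a plain sum of products to
  which the rules for \<open>lip\<close> apply.\<close>

lemma fourier_coeff_trig_mult:
  "fourier_coeff (\<lambda>x. trig N a x * trig N b x) k =
    (\<Sum>i = - int N..int N. \<Sum>j = - int N..int N. a i * b j * (if k = i + j then 1 else 0))"
proof -
  have "(\<lambda>x. trig N a x * trig N b x) = (\<lambda>x. \<Sum>i = - int N..int N. \<Sum>j =
      - int N..int N. a i * b j * fourier_mode (i + j) x)"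
    unfolding trig_def sum_product fourier_mode_add by (simp add: mult_ac)
  then show ?thesis
    by (simp add: fourier_coeff_sum fourier_coeff_cmult fourier_coeff_fourier_mode continuous_intros)
qed

text \<open>The arguments are clipped and not the values: each value is then a combination of
  clipped coefficients and of products of two of them.\<close>

definition trunc_field :: "real \<Rightarrow> real \<Rightarrow> real \<Rightarrow> nat \<Rightarrow> (int \<Rightarrow> complex \<times> complex) \<Rightarrow> int \<Rightarrow> complex \<times> complex" where
  "trunc_field \<gamma> \<alpha> r N y k = (let a = \<lambda>k. trunc r (fst (y k)); b = \<lambda>k. trunc r (snd (y k)) in
     (rhs1 \<gamma> \<alpha> b (fourier_coeff (\<lambda>x. trig N a x * trig N b x)) k,
      rhs2 \<gamma> a (fourier_coeff (\<lambda>x. (trig N b x)\<^sup>2)) k))"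

lemma trunc_field_lipschitz:
  assumes r: "0 \<le> r"
  obtains L where "0 \<le> L"
    "\<And>y z k. k \<in> {- int N..int N} \<Longrightarrow>
       norm (trunc_field \<gamma> \<alpha> r N y k - trunc_field \<gamma> \<alpha> r N z k) \<le> L * (\<Sum>j = - int N..int N. norm (y j - z j))"
proof -
  let ?K = "{- int N..int N}"
  have tr: "lip ?K (\<lambda>y. trunc r (fst (y k)))" "lip ?K (\<lambda>y. trunc r (snd (y k)))" if "k \<in> ?K" for k
    using that by (auto intro!: lip_trunc lip_fst lip_snd)
  have "lip ?K (\<lambda>y. trunc_field \<gamma> \<alpha> r N y k)" if k: "k \<in> ?K" for k
    unfolding trunc_field_def Let_def rhs1_def rhs2_def fdiff_def power2_eq_square fourier_coeff_trig_mult
    by (intro lip_Pair lip_diff lip_cmult lip_sum tr k finite_atLeastAtMost_int)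
       (auto intro!: lip_const lip_bounded_linear[OF bounded_linear_mult_left] lip_mult[where r
           = "2 * r"] tr trunc_bound[OF r])
  then have "\<exists>L. 0 \<le> L \<and> (k \<in> ?K \<longrightarrow> (\<forall>y z. norm (trunc_field \<gamma> \<alpha> r N y k - trunc_field \<gamma> \<alpha> r N z k)
      \<le> L * (\<Sum>j\<in>?K. norm (y j - z j))))" for k
    unfolding lip_def by (cases "k \<in> ?K") auto
  from choice[OF allI[OF this]]
  obtain L where "\<forall>k. 0 \<le> L k \<and> (k \<in> ?K \<longrightarrow> (\<forall>y z. norm (trunc_field \<gamma> \<alpha> r N y k - trunc_field \<gamma> \<alpha> r N z k)
      \<le> L k * (\<Sum>j\<in>?K. norm (y j - z j))))" ..
  then have L: "0 \<le> L k" "k \<in> ?K \<Longrightarrow> norm (trunc_field \<gamma> \<alpha> r N y k - trunc_field \<gamma> \<alpha> r N z k)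
      \<le> L k * (\<Sum>j\<in>?K. norm (y j - z j))" for k and y z :: "int \<Rightarrow> complex \<times> complex"
    by simp_all
  show ?thesis
  proof (rule that[of "sum L ?K"])
    show "0 \<le> sum L ?K" by (simp add: sum_nonneg L)
    fix y z :: "int \<Rightarrow> complex \<times> complex" and k assume k: "k \<in> ?K"
    have "L k * (\<Sum>j\<in>?K. norm (y j - z j)) \<le> sum L ?K * (\<Sum>j\<in>?K. norm (y j - z j))"
      using k L by (intro mult_right_mono member_le_sum sum_nonneg) auto
    then show "norm (trunc_field \<gamma> \<alpha> r N y k - trunc_field \<gamma> \<alpha> r N z k) \<le> sum L ?K * (\<Sum>j\<in>?K. norm (y j - z j))"
      using L(2)[OF k, of y z] by linarith
  qed
qed

text \<open>What complex conjugation of a function does to its Fourier coefficients; a fixed point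
  belongs to a real function.\<close>

definition reflect :: "(int \<Rightarrow> complex) \<Rightarrow> int \<Rightarrow> complex" where
  "reflect c k = cnj (c (- k))"

lemma fdiff_reflect: "fdiff (reflect c) = reflect (fdiff c)"
  by (rule ext) (simp add: fdiff_def reflect_def)

lemma rhs1_reflect: "rhs1 \<gamma> \<alpha> (reflect b) (reflect w) = reflect (rhs1 \<gamma> \<alpha> b w)"
  unfolding rhs1_def fdiff_reflect by (rule ext) (simp add: reflect_def j_symbol_def m_symbol_def)

lemma rhs2_reflect: "rhs2 \<gamma> (reflect a) (reflect q) = reflect (rhs2 \<gamma> a q)"
  unfolding rhs2_def fdiff_reflect by (rule ext) (simp add: reflect_def)

lemma trig_reflect: "trig N (reflect c) x = cnj (trig N c x)"
  unfolding trig_def reflect_def cnj_sum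
  by (rule sum.reindex_bij_witness[of _ uminus uminus]) (auto simp: fourier_mode_minus)

lemma fourier_coeff_reflect:
  assumes "continuous_on {0..1} f"
  shows "fourier_coeff (\<lambda>x. cnj (f x)) = reflect (fourier_coeff f)"
proof
  fix k
  show "fourier_coeff (\<lambda>x. cnj (f x)) k = reflect (fourier_coeff f) k"
    using fourier_coeff_cnj[OF assms, of "- k"] by (simp add: reflect_def)
qed

text \<open>Both symbols are real and even, the factor 2 pi i k is imaginary and odd, and clipping
  commutes with conjugation; so the field is equivariant under reflection.\<close>

lemma trunc_field_reflect:
  assumes r: "0 \<le> r"
  shows "trunc_field \<gamma> \<alpha> r N (\<lambda>k. (cnj (fst (y (- k))), cnj (snd (y (- k))))) k
    = (cnj (fst (trunc_field \<gamma> \<alpha> r N y (- k))), cnj (snd (trunc_field \<gamma> \<alpha> r N y (- k))))"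
proof -
  define a where "a = (\<lambda>k. trunc r (fst (y k)))"
  define b where "b = (\<lambda>k. trunc r (snd (y k)))"
  have a': "(\<lambda>k. trunc r (cnj (fst (y (- k))))) = reflect a" and b': "(\<lambda>k. trunc r (cnj (snd (y (- k)))))
      = reflect b"
    by (auto simp: a_def b_def reflect_def trunc_cnj r)
  have 1: "fourier_coeff (\<lambda>x. trig N (reflect a) x * trig N (reflect b) x)
      = reflect (fourier_coeff (\<lambda>x. trig N a x * trig N b x))"
    unfolding trig_reflect complex_cnj_mult [symmetric] by (intro fourier_coeff_reflect continuous_intros)
  have 2: "fourier_coeff (\<lambda>x. (trig N (reflect b) x)\<^sup>2) = reflect (fourier_coeff (\<lambda>x. (trig N b x)\<^sup>2))"
    unfolding trig_reflect complex_cnj_power [symmetric] by (intro fourier_coeff_reflect continuous_intros)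
  show ?thesis
    unfolding trunc_field_def Let_def fst_conv snd_conv a' b' 1 2 rhs1_reflect rhs2_reflect
    by (simp add: reflect_def a_def b_def)
qed

definition trunc_sol :: "real \<Rightarrow> real \<Rightarrow> real \<Rightarrow> real \<Rightarrow> nat \<Rightarrow> (real \<Rightarrow> int \<Rightarrow> complex \<times> complex) \<Rightarrow> bool" where
  "trunc_sol \<gamma> \<alpha> r T N y \<longleftrightarrow> (\<forall>t\<in>{0..T}. \<forall>k\<in>{- int N..int N}.
     ((\<lambda>s. y s k) has_vector_derivative trunc_field \<gamma> \<alpha> r N (y t) k) (at t within {0..T}))"

section \<open>Uniqueness, existence and reality for the truncated system\<close>

lemma trunc_sol_unique:
  assumes r: "0 \<le> r" and y: "trunc_sol \<gamma> \<alpha> r T N y" and z: "trunc_sol \<gamma> \<alpha> r T N z"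
    and init: "\<And>k. \<bar>k\<bar> \<le> int N \<Longrightarrow> y 0 k = z 0 k" and t: "t \<in> {0..T}" and k: "\<bar>k\<bar> \<le> int N"
  shows "y t k = z t k"
proof -
  obtain L where L: "0 \<le> L" "\<And>y z k. k \<in> {- int N..int N} \<Longrightarrow>
       norm (trunc_field \<gamma> \<alpha> r N y k - trunc_field \<gamma> \<alpha> r N z k) \<le> L * (\<Sum>j = - int N..int N. norm (y j - z j))"
    by (rule trunc_field_lipschitz[OF r]) blast
  have K: "j \<in> {- int N..int N} \<longleftrightarrow> \<bar>j\<bar> \<le> int N" for j by auto
  show ?thesis
  proof (rule ode_coordinates_unique[where K = "{- int N..int N}" and F = "trunc_field \<gamma> \<alpha> r N" and y = y
      and z = z])
    show "((\<lambda>s. y s k) has_vector_derivative trunc_field \<gamma> \<alpha> r N (y t) k) (at t within {0..T})"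
      "((\<lambda>s. z s k) has_vector_derivative trunc_field \<gamma> \<alpha> r N (z t) k) (at t within {0..T})"
      if "t \<in> {0..T}" "k \<in> {- int N..int N}" for t k
      using y z that unfolding trunc_sol_def by blast+
    show "y 0 k = z 0 k" if "k \<in> {- int N..int N}" for k using init that K by blast
    show "k \<in> {- int N..int N}" using k K by blast
  qed (rule finite_atLeastAtMost_int L(1) t | rule L(2), assumption)+
qed

lemma trunc_sol_exists:
  assumes r: "0 \<le> r" and T: "0 \<le> T"
  obtains y where "trunc_sol \<gamma> \<alpha> r T N y" "\<And>k. \<bar>k\<bar> \<le> int N \<Longrightarrow> y 0 k = y0 k"
proof -
  obtain L where L: "0 \<le> L" "\<And>y z k. k \<in> {- int N..int N} \<Longrightarrow>
       norm (trunc_field \<gamma> \<alpha> r N y k - trunc_field \<gamma> \<alpha> r N z k) \<le> L * (\<Sum>j = - int N..int N. norm (y j - z j))"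
    by (rule trunc_field_lipschitz[OF r]) blast
  obtain y where y: "\<And>k. k \<in> {- int N..int N} \<Longrightarrow> y 0 k = y0 k"
    "\<And>t k. t \<in> {0..T} \<Longrightarrow> k \<in> {- int N..int N} \<Longrightarrow>
       ((\<lambda>s. y s k) has_vector_derivative trunc_field \<gamma> \<alpha> r N (y t) k) (at t within {0..T})"
    by (rule Picard_coordinates[OF finite_atLeastAtMost_int L T, where ?y0.0 = y0]) blast+
  show ?thesis
  proof (rule that[of y])
    show "trunc_sol \<gamma> \<alpha> r T N y" using y(2) by (simp add: trunc_sol_def)
    show "y 0 k = y0 k" if "\<bar>k\<bar> \<le> int N" for k using that by (intro y(1)) auto
  qed
qed

text \<open>The reflected solution solves the same system with the same initial data, hence it is
  the original one.\<close>

lemma trunc_sol_real: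
  assumes r: "0 \<le> r" and y: "trunc_sol \<gamma> \<alpha> r T N y"
    and init: "\<And>k. \<bar>k\<bar> \<le> int N \<Longrightarrow> y 0 (- k) = (cnj (fst (y 0 k)), cnj (snd (y 0 k)))"
    and t: "t \<in> {0..T}"
  shows "real_valued (trig N (\<lambda>k. fst (y t k)))" "real_valued (trig N (\<lambda>k. snd (y t k)))"
proof -
  define z where "z s k = (cnj (fst (y s (- k))), cnj (snd (y s (- k))))" for s k
  have "trunc_sol \<gamma> \<alpha> r T N z"
    unfolding trunc_sol_def
  proof (intro ballI)
    fix s k assume s: "s \<in> {0..T}" and k: "k \<in> {- int N..int N}"
    have D: "((\<lambda>s. y s (- k)) has_vector_derivative trunc_field \<gamma> \<alpha> r N (y s) (- k)) (at s within {0..T})"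
      using y s k unfolding trunc_sol_def by auto
    have "((\<lambda>s. (cnj (fst (y s (- k))), cnj (snd (y s (- k))))) has_vector_derivative
        (cnj (fst (trunc_field \<gamma> \<alpha> r N (y s) (- k))), cnj (snd (trunc_field \<gamma> \<alpha> r N (y s) (- k))))) (at s
            within {0..T})"
      by (intro has_vector_derivative_Pair has_vector_derivative_cnj
          bounded_linear.has_vector_derivative[OF bounded_linear_fst D]
              bounded_linear.has_vector_derivative[OF bounded_linear_snd D])
    then show "((\<lambda>s. z s k) has_vector_derivative trunc_field \<gamma> \<alpha> r N (z s) k) (at s within {0..T})"
      unfolding z_def[abs_def] trunc_field_reflect[OF r] .
  qed
  moreover have "y 0 k = z 0 k" if "\<bar>k\<bar> \<le> int N" for k
    using init[of "- k"] that by (simp add: z_def)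
  ultimately have eq: "y t k = z t k" if "\<bar>k\<bar> \<le> int N" for k
    using trunc_sol_unique[OF r y _ _ t that] by blast
  have "y t (- k) = (cnj (fst (y t k)), cnj (snd (y t k)))" if "\<bar>k\<bar> \<le> int N" for k
    using eq[of "- k"] that by (simp add: z_def)
  then show "real_valued (trig N (\<lambda>k. fst (y t k)))" "real_valued (trig N (\<lambda>k. snd (y t k)))"
    by (auto intro!: real_valued_trig)
qed

lemma trunc_field_eq:
  assumes "\<And>k. \<bar>k\<bar> \<le> int N \<Longrightarrow> cmod (fst (y k)) \<le> r" "\<And>k. \<bar>k\<bar> \<le> int N \<Longrightarrow> cmod (snd (y k)) \<le> r" and k: "\<bar>k\<bar> \<le> int N"
  defines "a \<equiv> \<lambda>k. fst (y k)" and "b \<equiv> \<lambda>k. snd (y k)"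
  shows "trunc_field \<gamma> \<alpha> r N y k = (rhs1 \<gamma> \<alpha> b (fourier_coeff (\<lambda>x. trig N a x * trig N b x)) k,
      rhs2 \<gamma> a (fourier_coeff (\<lambda>x. (trig N b x)\<^sup>2)) k)"
proof -
  have "trig N (\<lambda>k. trunc r (fst (y k))) = trig N a" "trig N (\<lambda>k. trunc r (snd (y k))) = trig N b"
    using assms(1,2) by (auto intro!: trig_cong simp: trunc_eq a_def b_def)
  then show ?thesis
    using assms(1,2)[OF k] by (simp add: trunc_field_def rhs1_def rhs2_def fdiff_def trunc_eq a_def b_def)
qed

section \<open>The bootstrap argument\<close>

text \<open>Up to the first time m at which E reaches \<delta> the differential inequality is
  available, so Gronwall gives E m \<le> \<eta> exp(K T) < \<delta>, a contradiction.\<close>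

lemma bootstrap_Gronwall:
  fixes E :: "real \<Rightarrow> real"
  assumes D: "\<And>t. t \<in> {0..T} \<Longrightarrow> (E has_vector_derivative E' t) (at t within {0..T})"
    and E0: "E 0 = 0"
    and le: "\<And>t. t \<in> {0..T} \<Longrightarrow> E t \<le> \<delta> \<Longrightarrow> E' t \<le> K * (E t + \<eta>)"
    and K: "0 \<le> K" and \<eta>: "0 \<le> \<eta>" and small: "\<eta> * exp (K * T) < \<delta>" and t: "t \<in> {0..T}"
  shows "E t \<le> \<eta> * exp (K * T)"
proof -
  have G: "E t \<le> \<eta> * exp (K * T)" if t: "t \<in> {0..T}" and below: "\<And>s. s \<in> {0..t} \<Longrightarrow> E s \<le> \<delta>" for t
  proof -
    \<comment> \<open>Gronwall is applied to E + \<eta>, for which the inequality is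
      homogeneous.\<close>
    have "E t + \<eta> \<le> (E 0 + \<eta>) * exp (K * t)"
    proof (rule Gronwall[where \<phi> = "\<lambda>s. E s + \<eta>" and \<phi>' = E'])
      show "((\<lambda>s. E s + \<eta>) has_vector_derivative E' s) (at s within {0..t})" if "s \<in> {0..t}" for s
        using has_vector_derivative_add[OF has_vector_derivative_within_subset[OF D, of s "{0..t}"]
            has_vector_derivative_const[of \<eta>]] that t
        by simp
      show "E' s \<le> K * (E s + \<eta>)" if "s \<in> {0..t}" for s
        using that t by (intro le below) auto
    qed (use t in auto)
    also have "\<dots> \<le> \<eta> * exp (K * T)"
      using t K \<eta> by (simp add: E0 mult_left_mono)
    finally show ?thesis using \<eta> by simp
  qed
  have cont: "continuous_on {0..T} E"
    using D by (rule continuous_on_vector_derivative)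
  have \<delta>: "0 < \<delta>" using small \<eta> by (smt (verit) exp_gt_zero mult_nonneg_nonneg)
  have "E t1 \<le> \<delta>" if t1: "t1 \<in> {0..T}" for t1
  proof (rule ccontr)
    assume gt: "\<not> E t1 \<le> \<delta>"
    define S where "S = {s \<in> {0..t1}. \<delta> \<le> E s}"
    have cont1: "continuous_on {0..t1} E" using cont by (rule continuous_on_subset) (use t1 in auto)
    have "S = {0..t1} \<inter> E -` {\<delta>..}" by (auto simp: S_def)
    then have "closed S"
      using continuous_closed_preimage[OF cont1 closed_atLeastAtMost closed_atLeast[of \<delta>]] by simp
    moreover have "S \<noteq> {}" using gt t1 by (auto simp: S_def)
    moreover have bdd: "bdd_below S" by (rule bdd_belowI[of _ 0]) (auto simp: S_def)
    ultimately have m: "Inf S \<in> S" by (intro closed_contains_Inf)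
    define m where "m = Inf S"
    have m1: "0 \<le> m" "m \<le> t1" "\<delta> \<le> E m" using m by (auto simp: S_def m_def)
    have "continuous_on {0..m} E" using cont1 by (rule continuous_on_subset) (use m1 in auto)
    \<comment> \<open>The intermediate value theorem yields E m = \<delta> exactly, so that E \<le>
      \<delta> holds at m as well and not only before it.\<close>
    then obtain s where s: "0 \<le> s" "s \<le> m" "E s = \<delta>"
      using IVT'[of E 0 \<delta> m] m1 E0 \<delta> by auto
    then have "s \<in> S" using m1 by (simp add: S_def)
    then have "m \<le> s" unfolding m_def by (rule cInf_lower[OF _ bdd])
    with s have Em: "E m = \<delta>" by simp
    have "E s \<le> \<delta>" if "s \<in> {0..m}" for s
    proof (cases "s = m")
      case False
      then have "s \<notin> S" using cInf_lower[OF _ bdd, of s] that by (auto simp: m_def)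
      then show ?thesis using that m1 by (auto simp: S_def)
    qed (simp add: Em)
    then have "E m \<le> \<eta> * exp (K * T)" using m1 t1 by (intro G) auto
    then show False using small Em by simp
  qed
  then show ?thesis using t by (intro G) auto
qed

lemma has_vector_derivative_cmod_square:
  assumes "(f has_vector_derivative f') (at t within S)"
  shows "((\<lambda>s. (cmod (f s))\<^sup>2) has_vector_derivative 2 * Re (cnj (f t) * f')) (at t within S)"
proof -
  have "((\<lambda>s. f s \<bullet> f s) has_vector_derivative f t \<bullet> f' + f' \<bullet> f t) (at t within S)"
    by (rule bounded_bilinear.has_vector_derivative[OF bounded_bilinear_inner assms assms])
  moreover have "f t \<bullet> f' + f' \<bullet> f t = 2 * Re (cnj (f t) * f')" by (simp add: inner_complex_def)
  ultimately show ?thesis by (simp only: power2_norm_eq_inner)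
qed

lemma energy_has_derivative:
  assumes "\<And>k. \<bar>k\<bar> \<le> int N \<Longrightarrow> ((\<lambda>s. \<theta> s k) has_vector_derivative \<theta>' k) (at t within S)"
    and "\<And>k. \<bar>k\<bar> \<le> int N \<Longrightarrow> ((\<lambda>s. \<xi> s k) has_vector_derivative \<xi>' k) (at t within S)"
  shows "((\<lambda>s. energy \<gamma> \<alpha> N (\<theta> s) (\<xi> s)) has_vector_derivative energy_rate \<gamma> \<alpha> N (\<theta> t) (\<xi> t) \<theta>' \<xi>') (at t within S)"
  unfolding energy_def energy_rate_def
  by (intro has_vector_derivative_sum has_vector_derivative_add has_vector_derivative_mult_right
      has_vector_derivative_cmod_square assms) auto

lemma energy_rate_cong:
  assumes "\<And>k. \<bar>k\<bar> \<le> int N \<Longrightarrow> \<theta>1 k = \<theta>2 k" "\<And>k. \<bar>k\<bar> \<le> int N \<Longrightarrow> \<xi>1 k = \<xi>2 k"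
  shows "energy_rate \<gamma> \<alpha> N \<theta> \<xi> \<theta>1 \<xi>1 = energy_rate \<gamma> \<alpha> N \<theta> \<xi> \<theta>2 \<xi>2"
  unfolding energy_rate_def using assms by (intro sum.cong) auto

text \<open>Only |k| \<le> N is ever summed, where this is the coefficient of P_N v minus that of
  the Galerkin function.\<close>

definition err :: "(real \<Rightarrow> complex) \<Rightarrow> (int \<Rightarrow> complex) \<Rightarrow> int \<Rightarrow> complex" where
  "err v a k = fourier_coeff v k - a k"

text \<open>What \<open>bo_solution_coeffs\<close> extracts from the exact solution; its equations
  enter below only in the form of \<open>d\<zeta>\<close> and \<open>du\<close>.\<close>

locale exact_solution =
  fixes \<gamma> \<alpha> T \<mu> R :: real and \<zeta> u :: "real \<Rightarrow> real \<Rightarrow> complex"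
  assumes \<gamma>: "0 < \<gamma>" "\<gamma> < 1" and \<alpha>: "1 < \<alpha>" and T: "0 < T" and \<mu>: "\<mu> > 3 / 2" and R: "0 \<le> R"
    and reg: "\<And>t. t \<in> {0..T} \<Longrightarrow> reg \<mu> R (\<zeta> t)" "\<And>t. t \<in> {0..T} \<Longrightarrow> reg \<mu> R (u t)"
    and real: "\<And>t. t \<in> {0..T} \<Longrightarrow> real_valued (\<zeta> t)" "\<And>t. t \<in> {0..T} \<Longrightarrow> real_valued (u t)"
    and d\<zeta>: "\<And>t k. t \<in> {0..T} \<Longrightarrow> ((\<lambda>s. fourier_coeff (\<zeta> s) k) has_vector_derivative
       rhs1 \<gamma> \<alpha> (fourier_coeff (u t)) (fourier_coeff (\<lambda>x. \<zeta> t x * u t x)) k) (at t within {0..T})"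
    and du: "\<And>t k. t \<in> {0..T} \<Longrightarrow> ((\<lambda>s. fourier_coeff (u s) k) has_vector_derivative
       rhs2 \<gamma> (fourier_coeff (\<zeta> t)) (fourier_coeff (\<lambda>x. (u t x)\<^sup>2)) k) (at t within {0..T})"
begin

text \<open>The maximum with 0 provides the nonnegative rate that \<open>bootstrap_Gronwall\<close>
  asks for.\<close>

definition growth :: real where "growth = max 0 (growth_const \<gamma> \<alpha> \<mu> R)"
definition \<eta> :: "nat \<Rightarrow> real" where "\<eta> N = real N powr (2 - 2 * \<mu>)"
text \<open>The threshold at which coercivity gives a squared L^2 error of at most 1/(2N + 1) and
  hence, by \<open>cmod_trig_le\<close>, a sup norm of at most 1.\<close>

definition \<delta> :: "nat \<Rightarrow> real" where "\<delta> N = coercivity \<gamma> \<alpha> / (2 * real N + 1)"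
definition err_energy :: "nat \<Rightarrow> (real \<Rightarrow> int \<Rightarrow> complex) \<Rightarrow> (real \<Rightarrow> int \<Rightarrow> complex) \<Rightarrow> real \<Rightarrow> real" where
  "err_energy N a b t = energy \<gamma> \<alpha> N (err (\<zeta> t) (a t)) (err (u t) (b t))"

lemma \<eta>_nonneg: "0 \<le> \<eta> N" by (simp add: \<eta>_def)

lemma coeff_sq_err_le:
  assumes "err_energy N a b t \<le> E"
  shows "coeff_sq N (err (\<zeta> t) (a t)) \<le> E / coercivity \<gamma> \<alpha>" "coeff_sq N (err (u t) (b t)) \<le> E / coercivity \<gamma> \<alpha>"
proof -
  let ?x = "coeff_sq N (err (\<zeta> t) (a t))" and ?y = "coeff_sq N (err (u t) (b t))"
  have c0: "0 < coercivity \<gamma> \<alpha>" by (rule coercivity_pos[OF \<gamma> \<alpha>])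
  have "coercivity \<gamma> \<alpha> * (?x + ?y) \<le> E"
    using energy_ge[OF \<gamma> \<alpha>] assms unfolding err_energy_def by (rule order_trans)
  then have "?x + ?y \<le> E / coercivity \<gamma> \<alpha>"
    using c0 by (simp add: pos_le_divide_eq mult.commute)
  moreover have "0 \<le> ?x" "0 \<le> ?y" by (simp_all add: sum_nonneg)
  ultimately show "?x \<le> E / coercivity \<gamma> \<alpha>" "?y \<le> E / coercivity \<gamma> \<alpha>" by linarith+
qed

lemma coeff_sq_err_small:
  assumes "err_energy N a b t \<le> \<delta> N"
  shows "coeff_sq N (err (\<zeta> t) (a t)) \<le> 1 / (2 * real N + 1)" "coeff_sq N (err (u t) (b t)) \<le> 1 / (2 * real N + 1)"
proof -
  have "\<delta> N / coercivity \<gamma> \<alpha> = 1 / (2 * real N + 1)"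
    using coercivity_pos[OF \<gamma> \<alpha>] by (simp add: \<delta>_def)
  then show "coeff_sq N (err (\<zeta> t) (a t)) \<le> 1 / (2 * real N + 1)" "coeff_sq N (err (u t) (b t)) \<le> 1 / (2 *
      real N + 1)"
    using coeff_sq_err_le[OF assms] by simp_all
qed

text \<open>The rates \<open>a'\<close> and \<open>b'\<close> have to be the Galerkin ones only
  while the energy is at most \<open>\<delta> N\<close>. This covers the truncated solution before
  it is known to solve the Galerkin system, and every Galerkin solution alike.\<close>

lemma err_energy_le:
  assumes N: "N \<ge> 1" and small: "\<eta> N * exp (growth * T) < \<delta> N"
    and da: "\<And>t k. t \<in> {0..T} \<Longrightarrow> \<bar>k\<bar> \<le> int N \<Longrightarrow> ((\<lambda>s. a s k) has_vector_derivative a' t k) (at t within {0..T})"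
    and db: "\<And>t k. t \<in> {0..T} \<Longrightarrow> \<bar>k\<bar> \<le> int N \<Longrightarrow> ((\<lambda>s. b s k) has_vector_derivative b' t k) (at t within {0..T})"
    and init: "\<And>k. \<bar>k\<bar> \<le> int N \<Longrightarrow> a 0 k = fourier_coeff (\<zeta> 0) k" "\<And>k. \<bar>k\<bar> \<le> int N \<Longrightarrow> b 0 k = fourier_coeff (u 0) k"
    and realb: "\<And>t. t \<in> {0..T} \<Longrightarrow> real_valued (trig N (b t))"
    and field: "\<And>t k. t \<in> {0..T} \<Longrightarrow> err_energy N a b t \<le> \<delta> N \<Longrightarrow> \<bar>k\<bar> \<le> int N \<Longrightarrow>
        a' t k = rhs1 \<gamma> \<alpha> (b t) (fourier_coeff (\<lambda>x. trig N (a t) x * trig N (b t) x)) k \<and>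
        b' t k = rhs2 \<gamma> (a t) (fourier_coeff (\<lambda>x. (trig N (b t) x)\<^sup>2)) k"
    and t: "t \<in> {0..T}"
  shows "err_energy N a b t \<le> \<eta> N * exp (growth * T)"
proof (rule bootstrap_Gronwall[where E = "err_energy N a b" and \<delta> = "\<delta> N", OF _ _ _ _ \<eta>_nonneg small t])
  let ?A = "\<lambda>t k. rhs1 \<gamma> \<alpha> (fourier_coeff (u t)) (fourier_coeff (\<lambda>x. \<zeta> t x * u t x)) k"
  let ?B = "\<lambda>t k. rhs2 \<gamma> (fourier_coeff (\<zeta> t)) (fourier_coeff (\<lambda>x. (u t x)\<^sup>2)) k"
  let ?E' = "\<lambda>t. energy_rate \<gamma> \<alpha> N (err (\<zeta> t) (a t)) (err (u t) (b t)) (\<lambda>k. ?A t k - a' t k) (\<lambda>k. ?B t k - b' t k)"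
  show "0 \<le> growth" by (simp add: growth_def)
  show "err_energy N a b 0 = 0"
    unfolding err_energy_def energy_def err_def using init by (intro sum.neutral) auto
  fix t assume t: "t \<in> {0..T}"
  show "(err_energy N a b has_vector_derivative ?E' t) (at t within {0..T})"
    unfolding err_energy_def[abs_def] err_def[abs_def]
    by (intro energy_has_derivative has_vector_derivative_diff d\<zeta> du da db t)
  assume le: "err_energy N a b t \<le> \<delta> N"
  have "?E' t = energy_rate \<gamma> \<alpha> N (err (\<zeta> t) (a t)) (err (u t) (b t))
      (\<lambda>k. ?A t k - rhs1 \<gamma> \<alpha> (b t) (fourier_coeff (\<lambda>x. trig N (a t) x * trig N (b t) x)) k)
      (\<lambda>k. ?B t k - rhs2 \<gamma> (a t) (fourier_coeff (\<lambda>x. (trig N (b t) x)\<^sup>2)) k)"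
    using field[OF t le] by (intro energy_rate_cong) auto
  also have "\<dots> \<le> growth_const \<gamma> \<alpha> \<mu> R * (err_energy N a b t + \<eta> N)"
    using energy_rate_le[OF \<gamma> \<alpha> \<mu> R reg(1)[OF t] reg(2)[OF t] real(2)[OF t] realb[OF t] N
        coeff_sq_err_small(2)[OF le, unfolded err_def[abs_def]], where a = "a t"]
    unfolding err_energy_def err_def[abs_def] \<eta>_def .
  also have "\<dots> \<le> growth * (err_energy N a b t + \<eta> N)"
  proof (rule mult_right_mono)
    have "0 \<le> coercivity \<gamma> \<alpha> * (coeff_sq N (err (\<zeta> t) (a t)) + coeff_sq N (err (u t) (b t)))"
      using coercivity_pos[OF \<gamma> \<alpha>] by (simp add: sum_nonneg)
    then have "0 \<le> err_energy N a b t"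
      unfolding err_energy_def by (rule order_trans[OF _ energy_ge[OF \<gamma> \<alpha>]])
    then show "0 \<le> err_energy N a b t + \<eta> N" using \<eta>_nonneg[of N] by simp
  qed (simp add: growth_def)
  finally show "?E' t \<le> growth * (err_energy N a b t + \<eta> N)" .
qed

text \<open>Below the threshold the coefficients have a bound independent of N, namely the sup norm
  of the exact solution plus an error of at most 1. This bound becomes the clipping level.\<close>

lemma coeff_le:
  assumes t: "t \<in> {0..T}" and le: "err_energy N a b t \<le> \<delta> N" and k: "\<bar>k\<bar> \<le> int N"
  shows "cmod (a t k) \<le> sup_const \<mu> R + 1" "cmod (b t k) \<le> sup_const \<mu> R + 1"
proof -
  have *: "cmod (c k) \<le> sup_const \<mu> R + 1" if v: "reg \<mu> R v"
      and small: "coeff_sq N (err v c) \<le> 1 / (2 * real N + 1)" for v c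
  proof -
    have B0: "0 \<le> sup_const \<mu> R" using reg_sup(1)[OF \<mu> v] norm_ge_zero order_trans by blast
    have "(cmod (fourier_coeff v k))\<^sup>2 \<le> l2sq v"
      using Bessel[OF reg_continuous(1)[OF \<mu> v], of "{k}"] by simp
    also have "\<dots> \<le> (sup_const \<mu> R)\<^sup>2"
      by (rule l2sq_le_const[OF reg_continuous(1)[OF \<mu> v] reg_sup(1)[OF \<mu> v]])
    finally have 1: "cmod (fourier_coeff v k) \<le> sup_const \<mu> R"
      using B0 by (rule power2_le_imp_le)
    have "(cmod (err v c k))\<^sup>2 \<le> coeff_sq N (err v c)"
      using k by (intro member_le_sum) auto
    also have "\<dots> \<le> 1 / (2 * real N + 1)" by (rule small)
    also have "\<dots> \<le> 1\<^sup>2" by simp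
    finally have 2: "cmod (err v c k) \<le> 1" by (rule power2_le_imp_le) simp
    show ?thesis
      using 1 2 norm_triangle_ineq4[of "fourier_coeff v k" "err v c k"] by (simp add: err_def)
  qed
  show "cmod (a t k) \<le> sup_const \<mu> R + 1" "cmod (b t k) \<le> sup_const \<mu> R + 1"
    using *[OF reg(1)[OF t] coeff_sq_err_small(1)[OF le]] *[OF reg(2)[OF t] coeff_sq_err_small(2)[OF le]]
        by simp_all
qed

text \<open>The projection error and the error inside the Galerkin space are both of order
  N^(1-\<mu>). Under the root \<open>l2sq_add_le\<close> doubles both contributions; the outer
  factor 2 adds the two components.\<close>

lemma error_le:
  assumes t: "t \<in> {0..T}" and N: "N \<ge> 1" and le: "err_energy N a b t \<le> \<eta> N * exp (growth * T)"
  shows "L2_norm (\<lambda>x. trig N (a t) x - \<zeta> t x) + L2_norm (\<lambda>x. trig N (b t) x - u t x)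
    \<le> 2 * sqrt (8 * pi\<^sup>2 * R + 2 * exp (growth * T) / coercivity \<gamma> \<alpha>) * real N powr (1 - \<mu>)"
proof -
  let ?C = "8 * pi\<^sup>2 * R + 2 * exp (growth * T) / coercivity \<gamma> \<alpha>"
  have *: "L2_norm (\<lambda>x. trig N c x - v x) \<le> sqrt ?C * real N powr (1 - \<mu>)"
    if v: "reg \<mu> R v" and small: "coeff_sq N (err v c) \<le> \<eta> N * exp (growth * T) / coercivity \<gamma> \<alpha>" for v c
  proof -
    have cont: "continuous_on {0..1} v" by (rule reg_continuous(1)[OF \<mu> v])
    have eq: "v x - trig N c x = (v x - trig N (fourier_coeff v) x) + trig N (err v c) x" for x
      by (simp add: err_def[abs_def] trig_diff)
    have "l2sq (\<lambda>x. trig N c x - v x) = l2sq (\<lambda>x. v x - trig N c x)"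
      by (simp add: l2sq_def norm_minus_commute)
    also have "\<dots> \<le> 2 * l2sq (\<lambda>x. v x - trig N (fourier_coeff v) x) + 2 * l2sq (trig N (err v c))"
      unfolding eq by (intro l2sq_add_le continuous_intros cont)
    also have "\<dots> \<le> 2 * (4 * pi\<^sup>2 * R * \<eta> N) + 2 * (\<eta> N * exp (growth * T) / coercivity \<gamma> \<alpha>)"
      using reg_tail(1)[OF \<mu> v N] small unfolding l2sq_trig \<eta>_def by (intro add_mono mult_left_mono) auto
    also have "\<dots> = ?C * \<eta> N" by (simp add: field_simps)
    also have "\<eta> N = (real N powr (1 - \<mu>))\<^sup>2"
      by (simp add: \<eta>_def power2_eq_square flip: powr_add)
    finally have "sqrt (l2sq (\<lambda>x. trig N c x - v x)) \<le> sqrt (?C * (real N powr (1 - \<mu>))\<^sup>2)"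
      by (rule real_sqrt_le_mono)
    also have "\<dots> = sqrt ?C * real N powr (1 - \<mu>)" by (simp add: real_sqrt_mult)
    finally show ?thesis
      by (subst L2_norm_eq) (intro continuous_intros cont)
  qed
  show ?thesis
    using *[OF reg(1)[OF t] coeff_sq_err_le(1)[OF le]] *[OF reg(2)[OF t] coeff_sq_err_le(2)[OF le]] by linarith
qed

text \<open>After multiplication by 2N + 1 \<le> 3N it remains to make a multiple of N^(3-2\<mu>)
  small, and the exponent is negative since \<mu> > 3/2.\<close>

lemma eventually_small: "\<exists>N0\<ge>1. \<forall>N\<ge>N0. \<eta> N * exp (growth * T) < \<delta> N"
proof -
  have c0: "0 < coercivity \<gamma> \<alpha>" by (rule coercivity_pos[OF \<gamma> \<alpha>])
  have "(\<lambda>N. 3 * exp (growth * T) * real N powr (3 - 2 * \<mu>)) \<longlonglongrightarrow> 3 * exp (growth * T) * 0"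
    using \<mu> by (intro tendsto_mult_left tendsto_neg_powr filterlim_real_sequentially) simp
  then have "\<forall>\<^sub>F N in sequentially. 3 * exp (growth * T) * real N powr (3 - 2 * \<mu>) < coercivity \<gamma> \<alpha>"
    by (rule order_tendstoD(2)) (simp add: c0)
  then obtain N1 where N1: "\<And>N. N \<ge> N1 \<Longrightarrow> 3 * exp (growth * T) * real N powr (3 - 2 * \<mu>) < coercivity \<gamma> \<alpha>"
    unfolding eventually_sequentially by blast
  have "\<eta> N * exp (growth * T) < \<delta> N" if N: "N \<ge> max 1 N1" for N
  proof -
    have "real N powr (3 - 2 * \<mu>) = real N * \<eta> N"
      using N powr_add[of "real N" 1 "2 - 2 * \<mu>"] by (simp add: \<eta>_def)
    then have "\<eta> N * exp (growth * T) * (3 * real N) < coercivity \<gamma> \<alpha>"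
      using N1[of N] N by (simp add: mult_ac)
    moreover have "\<eta> N * exp (growth * T) * (2 * real N + 1) \<le> \<eta> N * exp (growth * T) * (3 * real N)"
      using N \<eta>_nonneg[of N] by (intro mult_left_mono) auto
    ultimately have "\<eta> N * exp (growth * T) * (2 * real N + 1) < coercivity \<gamma> \<alpha>" by linarith
    then show ?thesis unfolding \<delta>_def by (subst pos_less_divide_eq) auto
  qed
  then show ?thesis by (intro exI[of _ "max 1 N1"]) auto
qed

end

theorem proposition2p2:
  fixes \<gamma> \<alpha> T \<mu> :: real
    and g :: "real \<Rightarrow> real"
    and \<zeta>0 u0 :: "real \<Rightarrow> complex"
    and \<zeta> u :: "real \<Rightarrow> real \<Rightarrow> complex"
  assumes "0 < \<gamma>" "\<gamma> < 1" "\<alpha> > 1" "T > 0" "\<mu> > 3 / 2"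
    and g: "\<And>\<xi>. g \<xi> = \<alpha> / \<gamma> * \<bar>\<xi>\<bar>"
    and "real_valued \<zeta>0" "smooth \<zeta>0" "periodic1 \<zeta>0"
    and "real_valued u0" "smooth u0" "periodic1 u0"
    and sol: "bo_solution \<gamma> \<alpha> g T \<mu> \<zeta>0 u0 \<zeta> u"
    and sol_unique: "\<And>\<zeta>' u'. bo_solution \<gamma> \<alpha> g T \<mu> \<zeta>0 u0 \<zeta>' u' \<Longrightarrow>
                       \<forall>t\<in>{0..T}. \<zeta>' t = \<zeta> t \<and> u' t = u t"
  shows "\<exists>(C::real) (N0::nat). N0 \<ge> 1 \<and> (\<forall>N\<ge>N0.
           \<exists>\<zeta>N uN. galerkin_solution \<gamma> \<alpha> g T N \<zeta>0 u0 \<zeta>N uN \<and>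
             (\<forall>\<zeta>N' uN'. galerkin_solution \<gamma> \<alpha> g T N \<zeta>0 u0 \<zeta>N' uN' \<longrightarrow>
                (\<forall>t\<in>{0..T}. \<zeta>N' t = \<zeta>N t \<and> uN' t = uN t)) \<and>
             (\<forall>t\<in>{0..T}. L2_norm (\<lambda>x. \<zeta>N t x - \<zeta> t x) + L2_norm (\<lambda>x. uN t x - u t x)
                \<le> C * real N powr (1 - \<mu>)))"
proof -
  obtain R where R: "0 \<le> R"
    and reg: "\<And>t. t \<in> {0..T} \<Longrightarrow> reg \<mu> R (\<zeta> t) \<and> reg \<mu> R (u t)"
    and d: "\<And>t k. t \<in> {0..T} \<Longrightarrow> ((\<lambda>s. fourier_coeff (\<zeta> s) k) has_vector_derivative
       rhs1 \<gamma> \<alpha> (fourier_coeff (u t)) (fourier_coeff (\<lambda>x. \<zeta> t x * u t x)) k) (at t within {0..T})"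
      "\<And>t k. t \<in> {0..T} \<Longrightarrow> ((\<lambda>s. fourier_coeff (u s) k) has_vector_derivative
       rhs2 \<gamma> (fourier_coeff (\<zeta> t)) (fourier_coeff (\<lambda>x. (u t x)\<^sup>2)) k) (at t within {0..T})"
    by (rule bo_solution_coeffs[OF \<open>0 < \<gamma>\<close> \<open>\<gamma> < 1\<close> \<open>\<alpha> > 1\<close> \<open>T > 0\<close> \<open>\<mu> > 3 / 2\<close> g sol]) blast
  have real: "real_valued (\<zeta> t)" "real_valued (u t)" if "t \<in> {0..T}" for t
    using sol that unfolding bo_solution_def by blast+
  have start: "\<zeta> 0 = \<zeta>0" "u 0 = u0" using sol unfolding bo_solution_def by blast+
  interpret exact_solution \<gamma> \<alpha> T \<mu> R \<zeta> u
    using assms(1-5) R reg real d by unfold_locales blast+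
  have T0: "0 \<in> {0..T}" using T by simp
  \<comment> \<open>The bound of \<open>coeff_le\<close>, so that clipping does nothing as long as
    the error energy is below the threshold.\<close>
  define r where "r = sup_const \<mu> R + 1"
  have r: "0 \<le> r"
    unfolding r_def using reg_sup(1)[OF \<mu> reg(1)[OF T0], of 0] norm_ge_zero[of "\<zeta> 0 0"] by linarith
  obtain N0 where N0: "N0 \<ge> 1" and small: "\<And>N. N \<ge> N0 \<Longrightarrow> \<eta> N * exp (growth * T) < \<delta> N"
    using eventually_small by blast
  define C where "C = 2 * sqrt (8 * pi\<^sup>2 * R + 2 * exp (growth * T) / coercivity \<gamma> \<alpha>)"
  have "\<exists>\<zeta>N uN. galerkin_solution \<gamma> \<alpha> g T N \<zeta>0 u0 \<zeta>N uN \<and>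
      (\<forall>\<zeta>N' uN'. galerkin_solution \<gamma> \<alpha> g T N \<zeta>0 u0 \<zeta>N' uN' \<longrightarrow>
         (\<forall>t\<in>{0..T}. \<zeta>N' t = \<zeta>N t \<and> uN' t = uN t)) \<and>
      (\<forall>t\<in>{0..T}. L2_norm (\<lambda>x. \<zeta>N t x - \<zeta> t x) + L2_norm (\<lambda>x. uN t x - u t x) \<le> C * real N powr (1 - \<mu>))"
    if "N \<ge> N0" for N
  proof -
    have N: "N \<ge> 1" using that N0 by simp
    note small_N = small[OF that]
    \<comment> \<open>It exists on all of {0..T} because the clipped field is globally Lipschitz;
      that it solves the Galerkin system is known only at \<open>ode\<close>.\<close>
    obtain y where y: "trunc_sol \<gamma> \<alpha> r T N y"
      and y0: "\<And>k. \<bar>k\<bar> \<le> int N \<Longrightarrow> y 0 k = (fourier_coeff \<zeta>0 k, fourier_coeff u0 k)"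
      by (rule trunc_sol_exists[OF r less_imp_le[OF T], where ?y0.0 = "\<lambda>k. (fourier_coeff \<zeta>0 k, fourier_coeff u0 k)"]) blast
    define a b where "a t k = fst (y t k)" and "b t k = snd (y t k)" for t k
    have ab: "(\<lambda>k. fst (y t k)) = a t" "(\<lambda>k. snd (y t k)) = b t" for t
      by (auto simp: a_def b_def)
    have conj0: "y 0 (- k) = (cnj (fst (y 0 k)), cnj (snd (y 0 k)))" if "\<bar>k\<bar> \<le> int N" for k
    proof -
      have "fourier_coeff \<zeta>0 (- k) = cnj (fourier_coeff \<zeta>0 k)" "fourier_coeff u0 (- k) = cnj (fourier_coeff u0 k)"
        using fourier_coeff_real[OF reg_continuous(1)[OF \<mu> reg(1)[OF T0]] real(1)[OF T0]]
          fourier_coeff_real[OF reg_continuous(1)[OF \<mu> reg(2)[OF T0]] real(2)[OF T0]] by (simp_all add: start)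
      then show ?thesis using y0[of k] y0[of "- k"] that by simp
    qed
    have real_ab: "real_valued (trig N (a t))" "real_valued (trig N (b t))" if "t \<in> {0..T}" for t
      using trunc_sol_real[OF r y conj0 that] by (simp_all add: ab)
    have D: "((\<lambda>s. a s k) has_vector_derivative fst (trunc_field \<gamma> \<alpha> r N (y t) k)) (at t within {0..T})"
      "((\<lambda>s. b s k) has_vector_derivative snd (trunc_field \<gamma> \<alpha> r N (y t) k)) (at t within {0..T})"
      if "t \<in> {0..T}" "\<bar>k\<bar> \<le> int N" for t k
    proof -
      have "((\<lambda>s. y s k) has_vector_derivative trunc_field \<gamma> \<alpha> r N (y t) k) (at t within {0..T})"
        using y that(1) that(2)[unfolded abs_le_iff] unfolding trunc_sol_def by (metis atLeastAtMost_iff minus_le_iff)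
      from bounded_linear.has_vector_derivative[OF bounded_linear_fst this]
        bounded_linear.has_vector_derivative[OF bounded_linear_snd this]
      show "((\<lambda>s. a s k) has_vector_derivative fst (trunc_field \<gamma> \<alpha> r N (y t) k)) (at t within {0..T})"
        "((\<lambda>s. b s k) has_vector_derivative snd (trunc_field \<gamma> \<alpha> r N (y t) k)) (at t within {0..T})"
        unfolding a_def b_def .
    qed
    have field: "trunc_field \<gamma> \<alpha> r N (y t) k =
        (rhs1 \<gamma> \<alpha> (b t) (fourier_coeff (\<lambda>x. trig N (a t) x * trig N (b t) x)) k,
         rhs2 \<gamma> (a t) (fourier_coeff (\<lambda>x. (trig N (b t) x)\<^sup>2)) k)"
      if "t \<in> {0..T}" "err_energy N a b t \<le> \<delta> N" "\<bar>k\<bar> \<le> int N" for t k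
      using trunc_field_eq[of N "y t" r k] coeff_le[OF that(1,2)] that(3) by (simp add: ab r_def a_def b_def)
    have init: "a 0 k = fourier_coeff (\<zeta> 0) k" "b 0 k = fourier_coeff (u 0) k" if "\<bar>k\<bar> \<le> int N" for k
      using y0[OF that] by (simp_all add: a_def b_def start)
    \<comment> \<open>Below the threshold clipping is inactive, and \<open>field\<close> is just the
      conditional hypothesis that the bootstrap requires.\<close>
    have en: "err_energy N a b t \<le> \<eta> N * exp (growth * T)" if "t \<in> {0..T}" for t
      by (rule err_energy_le[OF N small_N D init real_ab(2) _ that]) (simp_all add: field)
    then have en\<delta>: "err_energy N a b t \<le> \<delta> N" if "t \<in> {0..T}" for t
      using small_N that by (meson less_imp_le order_trans)
    have ode: "gal_ode \<gamma> \<alpha> T N a b"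
      unfolding gal_ode_def using D field[OF _ en\<delta>] by simp
    show ?thesis
    proof (intro exI conjI allI impI ballI)
      show "galerkin_solution \<gamma> \<alpha> g T N \<zeta>0 u0 (\<lambda>t. trig N (a t)) (\<lambda>t. trig N (b t))"
        using init real_ab by (intro galerkin_solutionI[OF g ode]) (simp_all add: start)
      fix t assume t: "t \<in> {0..T}"
      show "L2_norm (\<lambda>x. trig N (a t) x - \<zeta> t x) + L2_norm (\<lambda>x. trig N (b t) x - u t x) \<le> C * real N powr (1 - \<mu>)"
        unfolding C_def by (rule error_le[OF t N en[OF t]])
    next
      fix \<zeta>N' uN' t
      assume gal: "galerkin_solution \<gamma> \<alpha> g T N \<zeta>0 u0 \<zeta>N' uN'" and t: "t \<in> {0..T}"
      obtain a' b' where ode': "gal_ode \<gamma> \<alpha> T N a' b'"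
        and eq: "\<And>t. t \<in> {0..T} \<Longrightarrow> \<zeta>N' t = trig N (a' t)" "\<And>t. t \<in> {0..T} \<Longrightarrow> uN' t = trig N (b' t)"
        and real': "\<And>t. t \<in> {0..T} \<Longrightarrow> real_valued (trig N (b' t))"
        and init': "\<And>k. \<bar>k\<bar> \<le> int N \<Longrightarrow> a' 0 k = fourier_coeff \<zeta>0 k" "\<And>k. \<bar>k\<bar> \<le> int N \<Longrightarrow> b' 0 k = fourier_coeff u0 k"
        by (rule galerkin_solutionD[OF g gal less_imp_le[OF T]]) blast
      have D': "((\<lambda>s. a' s k) has_vector_derivative rhs1 \<gamma> \<alpha> (b' t) (fourier_coeff (\<lambda>x. trig N (a' t) x * trig N (b' t) x)) k) (at t within {0..T})"
        "((\<lambda>s. b' s k) has_vector_derivative rhs2 \<gamma> (a' t) (fourier_coeff (\<lambda>x. (trig N (b' t) x)\<^sup>2)) k) (at t within {0..T})"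
        if "t \<in> {0..T}" "\<bar>k\<bar> \<le> int N" for t k
        using ode' that unfolding gal_ode_def by blast+
      \<comment> \<open>The bootstrap holds for an arbitrary Galerkin solution too. Its coefficients
        therefore stay below the clipping level, and it solves the truncated system, whose solution
        is unique.\<close>
      have "err_energy N a' b' t \<le> \<eta> N * exp (growth * T)" if "t \<in> {0..T}" for t
        by (rule err_energy_le[OF N small_N D' _ _ real' _ that]) (simp_all add: start init')
      then have en': "err_energy N a' b' t \<le> \<delta> N" if "t \<in> {0..T}" for t
        using small_N that by (meson less_imp_le order_trans)
      define z where "z t k = (a' t k, b' t k)" for t k
      have z: "trunc_sol \<gamma> \<alpha> r T N z"
        unfolding trunc_sol_def
      proof (intro ballI)
        fix t k assume t: "t \<in> {0..T}" and "k \<in> {- int N..int N}"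
        then have k: "\<bar>k\<bar> \<le> int N" by auto
        have "trunc_field \<gamma> \<alpha> r N (z t) k =
            (rhs1 \<gamma> \<alpha> (b' t) (fourier_coeff (\<lambda>x. trig N (a' t) x * trig N (b' t) x)) k,
             rhs2 \<gamma> (a' t) (fourier_coeff (\<lambda>x. (trig N (b' t) x)\<^sup>2)) k)"
          using trunc_field_eq[of N "z t" r k] coeff_le[OF t en'[OF t]] k by (simp add: z_def r_def)
        then show "((\<lambda>s. z s k) has_vector_derivative trunc_field \<gamma> \<alpha> r N (z t) k) (at t within {0..T})"
          unfolding z_def by (simp only:) (intro has_vector_derivative_Pair D'[OF t k])
      qed
      have "y t k = z t k" if "\<bar>k\<bar> \<le> int N" for k
        by (rule trunc_sol_unique[OF r y z _ t that]) (simp add: y0 z_def init')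
      then have "trig N (a' t) = trig N (a t)" "trig N (b' t) = trig N (b t)"
        by (auto intro!: trig_cong simp: a_def b_def z_def)
      then show "\<zeta>N' t = trig N (a t)" "uN' t = trig N (b t)"
        using eq[OF t] by simp_all
    qed
  qed
  then show ?thesis using N0 by blast
qed

end
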